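(* Let $n\ge 1$. A functional $Z\colon \mathrm{Conv}(\mathbb{R}^n;\mathbb{R})\to\mathbb{R}$ is a continuous and dually epi-translation invariant valuation that is homogeneous of degree $n$ if and only if there exists $\zeta\in C_c(\mathbb{R}^n)$ such that $$Z(v)=\int_{\mathbb{R}^n\times\mathbb{R}^n}\zeta(x)\,d\Theta_0(v,(x,y))$$ for every $v\in\mathrm{Conv}(\mathbb{R}^n;\mathbb{R})$.
   Context: $\mathrm{Conv}(\mathbb{R}^n;\mathbb{R})$ is the set of convex functions $v\colon\mathbb{R}^n\to\mathbb{R}$ (finite everywhere). Topology: continuity is with respect to epi-convergence. A sequence $v_k$ epi-converges to $v$ if for every $x\in\mathbb{R}^n$: (i) $v(x)\le\liminf_{k\to\infty}v_k(x_k)$ for every sequence $x_k\to x$, and (ii) there is a sequence $x_k\to x$ with $v(x)=\lim_{k\to\infty}v_k(x_k)$. (On $\mathrm{Conv}(\mathbb{R}^n;\mathbb{R})$ this is equivalent to uniform convergence on compact sets.) A functional $Z\colon X\to\mathbb{R}$ on a set $X$ of functions is a valuation if $Z(u\vee v)+Z(u\wedge v)=Z(u)+Z(v)$ for all $u,v\in X$ with $u\vee v\in X$ and $u\wedge v\in X$, where $\vee$ and $\wedge$ denote pointwise maximum and minimum. $Z$ is dually epi-translation invariant if $Z(v+\ell)=Z(v)$ for every $v$ and every linear function $\ell\colon\mathbb{R}^n\to\mathbb{R}$ and $Z(v+\alpha)=Z(v)$ for every $v$ and every constant $\alpha\in\mathbb{R}$. $Z$ is homogeneous of degree $\alpha$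 if $Z(\lambda v)=\lambda^\alpha Z(v)$ for all $v$ and $\lambda\ge 0$. Hessian measures: let $\partial v(x)=\{y\in\mathbb{R}^n: v(z)\ge v(x)+\langle z-x,y\rangle\ \forall z\in\mathbb{R}^n\}$ and $\Gamma_v=\{(x,y)\in\mathbb{R}^n\times\mathbb{R}^n: y\in\partial v(x)\}$. For a Borel set $\eta\subset\mathbb{R}^n\times\mathbb{R}^n$ and $s>0$ let $P_s(v,\eta)=\{x+sy:(x,y)\in\Gamma_v\cap\eta\}$. This set is measurable and its $n$-dimensional Hausdorff (Lebesgue) measure is a polynomial in $s$, $$\mathcal{H}^n(P_s(v,\eta))=\sum_{i=0}^n\binom{n}{i}s^i\,\Theta_{n-i}(v,\eta),$$ with non-negative coefficients; this defines the Hessian measures $\Theta_i(v,\cdot)$, $i=0,\dots,n$, which are non-negative Borel measures on $\mathbb{R}^n\times\mathbb{R}^n$. In particular $\Theta_0(v,\eta)$ is the coefficient of $s^n$. $C_c(\mathbb{R}^n)$ is the set of continuous real-valued functions on $\mathbb{R}^n$ with compact support. *)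

theory Defs
  imports "HOL-Analysis.Analysis"
begin

definition Conv :: "(real^'n \<Rightarrow> real) set" where
  "Conv = {v. convex_on UNIV v}"

definition epi_converges :: "(nat \<Rightarrow> real^'n \<Rightarrow> real) \<Rightarrow> (real^'n \<Rightarrow> real) \<Rightarrow> bool" where
  "epi_converges vs v \<longleftrightarrow>
     (\<forall>x. (\<forall>xs. xs \<longlonglongrightarrow> x \<longrightarrow> ereal (v x) \<le> liminf (\<lambda>k. ereal (vs k (xs k)))) \<and>
          (\<exists>xs. xs \<longlonglongrightarrow> x \<and> (\<lambda>k. vs k (xs k)) \<longlonglongrightarrow> v x))"

text \<open>Functionals on a set \<open>X\<close> of functions are total functions in HOL; every property below
  only constrains their values on \<open>X\<close>.\<close>

definition epi_continuous_on ::
    "(real^'n \<Rightarrow> real) set \<Rightarrow> ((real^'n \<Rightarrow> real) \<Rightarrow> real) \<Rightarrow> bool" where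
  "epi_continuous_on X Z \<longleftrightarrow>
     (\<forall>vs v. (\<forall>k. vs k \<in> X) \<longrightarrow> v \<in> X \<longrightarrow> epi_converges vs v \<longrightarrow> (\<lambda>k. Z (vs k)) \<longlonglongrightarrow> Z v)"

definition valuation_on ::
    "(real^'n \<Rightarrow> real) set \<Rightarrow> ((real^'n \<Rightarrow> real) \<Rightarrow> real) \<Rightarrow> bool" where
  "valuation_on X Z \<longleftrightarrow>
     (\<forall>u\<in>X. \<forall>v\<in>X. (\<lambda>x. max (u x) (v x)) \<in> X \<longrightarrow> (\<lambda>x. min (u x) (v x)) \<in> X \<longrightarrow>
        Z (\<lambda>x. max (u x) (v x)) + Z (\<lambda>x. min (u x) (v x)) = Z u + Z v)"

definition dually_epi_translation_invariant_on ::
    "(real^'n \<Rightarrow> real) set \<Rightarrow> ((real^'n \<Rightarrow> real) \<Rightarrow> real) \<Rightarrow> bool" where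
  "dually_epi_translation_invariant_on X Z \<longleftrightarrow>
     (\<forall>v\<in>X. (\<forall>l. linear l \<longrightarrow> Z (\<lambda>x. v x + l x) = Z v) \<and> (\<forall>\<alpha>. Z (\<lambda>x. v x + \<alpha>) = Z v))"

definition homogeneous_on ::
    "(real^'n \<Rightarrow> real) set \<Rightarrow> nat \<Rightarrow> ((real^'n \<Rightarrow> real) \<Rightarrow> real) \<Rightarrow> bool" where
  "homogeneous_on X d Z \<longleftrightarrow> (\<forall>v\<in>X. \<forall>c\<ge>0. Z (\<lambda>x. c * v x) = c ^ d * Z v)"

definition subdifferential :: "(real^'n \<Rightarrow> real) \<Rightarrow> real^'n \<Rightarrow> (real^'n) set" where
  "subdifferential v x = {y. \<forall>z. v z \<ge> v x + (z - x) \<bullet> y}"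

definition subdiff_graph :: "(real^'n \<Rightarrow> real) \<Rightarrow> ((real^'n) \<times> (real^'n)) set" where
  "subdiff_graph v = {(x, y). y \<in> subdifferential v x}"

definition parallel_set ::
    "real \<Rightarrow> (real^'n \<Rightarrow> real) \<Rightarrow> ((real^'n) \<times> (real^'n)) set \<Rightarrow> (real^'n) set" where
  "parallel_set s v \<eta> = {x + s *\<^sub>R y | x y. (x, y) \<in> subdiff_graph v \<inter> \<eta>}"

text \<open>\<open>\<Theta>\<close> is the family of coefficient measures in the local Steiner formula of \<open>v\<close>. The formula
  is stated in the extended non-negative reals because both sides may be infinite when \<open>\<eta>\<close> is
  unbounded. For bounded \<open>\<eta>\<close> both sides are finite, so that the formula determines the
  coefficients \<open>\<Theta> i \<eta>\<close>, \<open>i \<le> n\<close>; as the space is a countable union of bounded Borel sets,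
  this determines the measures \<open>\<Theta> i\<close>, \<open>i \<le> n\<close>.\<close>

definition steiner_coefficients ::
    "(real^'n \<Rightarrow> real) \<Rightarrow> (nat \<Rightarrow> ((real^'n) \<times> (real^'n)) measure) \<Rightarrow> bool" where
  "steiner_coefficients v \<Theta> \<longleftrightarrow>
     (\<forall>i\<le>CARD('n). sets (\<Theta> i) = sets borel) \<and>
     (\<forall>\<eta>\<in>sets borel. \<forall>s>0.
        emeasure lebesgue (parallel_set s v \<eta>) =
          (\<Sum>i\<le>CARD('n). ennreal (real (CARD('n) choose i) * s ^ i) * emeasure (\<Theta> (CARD('n) - i)) \<eta>))"

text \<open>Only meaningful for \<open>i \<le> n\<close>.\<close>

definition hessian_measure ::
    "nat \<Rightarrow> (real^'n \<Rightarrow> real) \<Rightarrow> ((real^'n) \<times> (real^'n)) measure" where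
  "hessian_measure i v = (THE M. \<exists>\<Theta>. steiner_coefficients v \<Theta> \<and> M = \<Theta> i)"

definition C_c :: "(real^'n \<Rightarrow> real) set" where
  "C_c = {\<zeta>. continuous_on UNIV \<zeta> \<and> compact (closure {x. \<zeta> x \<noteq> 0})}"

end

theory Submission
  imports Defs "HOL-Computational_Algebra.Polynomial"
begin

text \<open>
  The Minty map \<open>z \<mapsto> (J z, z - J z)\<close>, \<open>J = prox v\<close>, parametrizes the graph of the subdifferential of
  \<open>v\<close>, and the parallel set \<open>P\<^sub>s(v, \<eta>)\<close> becomes the image of a Borel set under \<open>T\<^sub>s z = J z + s (z - J z)\<close>.
  Here \<open>R = 2 J - id\<close> is nonexpansive and \<open>T\<^sub>s = (1 + s)/2 id + (1 - s)/2 R\<close> is bijective. If \<open>R\<close> is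
  differentiable, then \<open>det DT\<^sub>s\<close> is a polynomial in \<open>s\<close> with nonnegative coefficients; mollifying
  \<open>R\<close> and passing to the limit gives nonnegative densities of the Steiner polynomial, hence the Hessian
  measures. Moreover \<open>s \<mapsto> \<integral> \<zeta> (prox (s v) w) dw\<close> is a polynomial whose leading coefficient is
  \<open>\<integral> \<zeta>(x) d\<Theta>\<^sub>0(v, (x, y))\<close>, so the latter inherits continuity, the valuation property and the
  invariances from the resolvents.

  Conversely, given \<open>Z\<close>, let \<open>\<zeta> c\<close> be the value of \<open>Z\<close> at the support function of the unit cube, moved
  to the apex \<open>c\<close>. Stretching the cube in one direction shows that \<open>\<zeta>\<close> has compact support. The
  difference of \<open>Z\<close> and the functional with density \<open>\<zeta>\<close> vanishes at all these support functions. It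
  vanishes at the conjugate of \<open>u + I\<^sub>K\<close> for smooth convex \<open>u\<close> and cubes \<open>K\<close> by repeated bisection: on small
  boxes \<open>u\<close> is almost affine, and homogeneity of degree \<open>n\<close> compensates the number of boxes. Such conjugates
  are dense.
\<close>


section \<open>Determinants of perturbed contractions\<close>

text \<open>The obstacle is regularity: \<open>prox v\<close> is only Lipschitz, and the existence
  of the Hessian measures has to be proved. Nonexpansiveness is the one property of R that is
  carried along, because averaging over translates preserves it; this is why R and not v is
  mollified. The limit controls integrals, not densities, and interpolation bridges the gap: the
  coefficients of a polynomial of degree at most n are fixed linear combinations of its values at 1,
  ..., n + 1. So what is linear passes from values at positive s to coefficients, first for the
  densities, later from the resolvent integrals to the functional.

  In the converse, u exceeds its tangent on a box of side h by O(h^2), and O(h) remains after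
  rescaling; hence u must lie below its tangents plus a quadratic. A box of dimension d < n collects
  the factor 2^(-m(n-d)) after m bisections, so Z vanishes on it, common faces of cut boxes do not
  count, and the values at corners enter only for d = n. Such a u arises as the conjugate of a
  strongly convex function, and a small multiple of |x|^2 makes any v strongly convex.\<close>

lemma det_rows_add_scaled:
  fixes a b c :: "'n::finite \<Rightarrow> real^'n"
  assumes "finite F"
  shows "det (\<chi> i. if i \<in> F then a i + s *\<^sub>R b i else c i) =
    (\<Sum>I\<in>Pow F. s ^ card I * det (\<chi> i. if i \<in> I then b i else if i \<in> F then a i else c i))"
  using assms
proof (induction F arbitrary: c)
  case empty
  then show ?case by simp
next
  case (insert k F)
  let ?r = "\<lambda>x. (\<chi> i. if i = k then x else if i \<in> F then a i + s *\<^sub>R b i else c i) :: real^'n^'n"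
  have "det (\<chi> i. if i \<in> insert k F then a i + s *\<^sub>R b i else c i) = det (?r (a k + s *\<^sub>R b k))"
    by (rule arg_cong[of _ _ det]) (auto simp: vec_eq_iff)
  also have "\<dots> = det (?r (a k)) + s * det (?r (b k))"
  proof -
    have "s *\<^sub>R b k = s *s b k" by (simp add: vec_eq_iff)
    then show ?thesis by (simp only: det_row_add det_row_mul)
  qed
  \<comment> \<open>Row \<open>k\<close> has been treated and now counts among the fixed rows, which
    is why the induction hypothesis is applied to a modified \<open>c\<close>.\<close>
  also have "?r (a k) = (\<chi> i. if i \<in> F then a i + s *\<^sub>R b i else (if i = k then a k else c i))"
    using insert by (auto simp: vec_eq_iff)
  also have "?r (b k) = (\<chi> i. if i \<in> F then a i + s *\<^sub>R b i else (if i = k then b k else c i))"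
    using insert by (auto simp: vec_eq_iff)
  also have "det (\<chi> i. if i \<in> F then a i + s *\<^sub>R b i else (if i = k then a k else c i)) =
    (\<Sum>I\<in>Pow F. s ^ card I * det (\<chi> i. if i \<in> I then b i else if i \<in> insert k F then a i else c i))"
    unfolding insert.IH
    by (intro sum.cong arg_cong2[where f="(*)"] refl arg_cong[where f=det])
      (use insert in \<open>auto simp: vec_eq_iff\<close>)
  also have "s * det (\<chi> i. if i \<in> F then a i + s *\<^sub>R b i else (if i = k then b k else c i)) =
    (\<Sum>I\<in>Pow F. s ^ card (insert k I) *
       det (\<chi> i. if i \<in> insert k I then b i else if i \<in> insert k F then a i else c i))"
    unfolding insert.IH sum_distrib_left
  proof (intro sum.cong refl)
    fix I assume "I \<in> Pow F"
    then have "k \<notin> I" "finite I" using insert by (auto intro: finite_subset)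
    moreover have "(\<chi> i. if i \<in> I then b i else if i \<in> F then a i else if i = k then b k else c i)
      = (\<chi> i. if i \<in> insert k I then b i else if i \<in> insert k F then a i else c i)"
      using insert \<open>I \<in> Pow F\<close> by (auto simp: vec_eq_iff)
    ultimately show "s * (s ^ card I * det (\<chi> i. if i \<in> I then b i else if i \<in> F then a i else if i = k then b k else c i))
      = s ^ card (insert k I) *
       det (\<chi> i. if i \<in> insert k I then b i else if i \<in> insert k F then a i else c i)"
      by simp
  qed
  also have "(\<Sum>I\<in>Pow F. s ^ card (insert k I) *
       det (\<chi> i. if i \<in> insert k I then b i else if i \<in> insert k F then a i else c i)) =
    (\<Sum>I\<in>insert k ` Pow F. s ^ card I *
       det (\<chi> i. if i \<in> I then b i else if i \<in> insert k F then a i else c i))"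
  proof (subst sum.reindex)
    show "inj_on (insert k) (Pow F)"
      using insert by (intro inj_onI) (metis Pow_iff insert_ident subsetD)
  qed simp
  finally show ?case
    unfolding Pow_insert using insert
    by (subst sum.union_disjoint) auto
qed

text \<open>For t < 1 the matrix \<open>mat 1 + t *\<^sub>R B\<close> has trivial kernel, since a
  kernel vector would satisfy norm x <= t norm x. Its determinant is 1 at t = 0, so it stays
  positive on [0, 1), and the limit t -> 1 leaves a nonnegative value.\<close>

lemma det_one_plus_contraction_nonneg:
  fixes B :: "real^'n^'n"
  assumes "\<And>x. norm (B *v x) \<le> norm x"
  shows "det (mat 1 + B) \<ge> 0"
proof -
  let ?f = "\<lambda>t. det (mat 1 + t *\<^sub>R B)"
  have cont: "continuous_on {0..1} ?f"
    unfolding det_def by (intro continuous_intros)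
  have nz: "?f t \<noteq> 0" if t: "0 \<le> t" "t < 1" for t
  proof
    assume "?f t = 0"
    then obtain x where x: "(mat 1 + t *\<^sub>R B) *v x = 0" "x \<noteq> 0"
      by (metis invertible_det_nz invertible_left_inverse matrix_left_invertible_ker)
    then have "x = - t *\<^sub>R (B *v x)"
      by (simp add: matrix_vector_mult_add_rdistrib scaleR_matrix_vector_assoc[symmetric] eq_neg_iff_add_eq_0)
    then have "norm x = t * norm (B *v x)" using t
      by (metis abs_minus abs_of_nonneg norm_scaleR)
    also have "\<dots> \<le> t * norm x" using assms t by (simp add: mult_left_mono)
    finally show False using t x by simp
  qed
  have pos: "?f t > 0" if t: "0 \<le> t" "t < 1" for t
  proof (rule ccontr)
    assume "\<not> ?f t > 0"
    then have "\<exists>x\<ge>0. x \<le> t \<and> ?f x = 0"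
      by (intro IVT2'[of ?f t 0 0]) (use t continuous_on_subset[OF cont] in auto)
    then show False using nz t by force
  qed
  have "((\<lambda>t. ?f t) \<longlongrightarrow> ?f 1) (at 1 within {0..1})"
    using cont unfolding continuous_on_def by (rule bspec) simp
  then have "(?f \<longlongrightarrow> ?f 1) (at_left 1)"
    using at_within_Icc_at_left[of 0 "1::real"] by simp
  then have "?f 1 \<ge> 0"
    by (rule tendsto_lowerbound)
      (auto simp: eventually_at_left[of 0] intro!: exI[of _ 0] less_imp_le pos)
  then show ?thesis by simp
qed

text \<open>Changing the sign of the rows of \<open>A\<close> in \<open>I\<close> does not change
  norm (A x), so the matrix is half of \<open>mat 1\<close> plus a contraction.\<close>

lemma det_mixed_rows_nonneg:
  fixes A :: "real^'n^'n"
  assumes "\<And>x. norm (A *v x) \<le> norm x"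
  shows "det (\<chi> i. if i \<in> I then (1/2) *\<^sub>R (mat 1 - A) $ i else (1/2) *\<^sub>R (mat 1 + A) $ i) \<ge> 0"
proof -
  define B :: "real^'n^'n" where "B = (\<chi> i. if i \<in> I then - A $ i else A $ i)"
  have "norm (B *v x) \<le> norm x" for x
  proof -
    have "norm (B *v x) = norm (A *v x)"
      unfolding norm_vec_def B_def matrix_vector_mult_def
      by (intro L2_set_cong) (auto simp: sum_negf)
    then show ?thesis using assms by simp
  qed
  then have "det (mat 1 + B) \<ge> 0" by (rule det_one_plus_contraction_nonneg)
  moreover have "(\<chi> i. if i \<in> I then (1/2) *\<^sub>R (mat 1 - A) $ i else (1/2) *\<^sub>R (mat 1 + A) $ i)
      = (\<chi> i. (1/2) *s (mat 1 + B) $ i)"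
    by (auto simp: vec_eq_iff B_def)
  ultimately show ?thesis
    by (simp only: det_rows_mul vec_lambda_eta) (simp add: prod_nonneg)
qed

text \<open>The matrix equals (1 + A)/2 + s (1 - A)/2. Expanding by rows, the coefficient of s^i
  collects the determinants with exactly i rows from (1 - A)/2, and each of them is
  nonnegative.\<close>

lemma det_affine_contraction_polynomial:
  fixes A :: "real^'n^'n"
  assumes "\<And>x. norm (A *v x) \<le> norm x"
  obtains d where "\<And>i. d i \<ge> 0"
    and "\<And>s. det (((1 + s) / 2) *\<^sub>R mat 1 + ((1 - s) / 2) *\<^sub>R A) = (\<Sum>i\<le>CARD('n). d i * s ^ i)"
proof
  let ?e = "\<lambda>I. det (\<chi> i. if i \<in> I then (1/2) *\<^sub>R (mat 1 - A) $ i else (1/2) *\<^sub>R (mat 1 + A) $ i)"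
  define d where "d i = (\<Sum>I | card I = i. ?e I)" for i
  show "d i \<ge> 0" for i
    unfolding d_def by (intro sum_nonneg det_mixed_rows_nonneg assms)
  fix s
  have "((1 + s) / 2) *\<^sub>R mat 1 + ((1 - s) / 2) *\<^sub>R A =
    (\<chi> i. if i \<in> UNIV then (1/2) *\<^sub>R (mat 1 + A) $ i + s *\<^sub>R ((1/2) *\<^sub>R (mat 1 - A) $ i) else 0)"
    by (simp add: vec_eq_iff field_simps)
  then have "det (((1 + s) / 2) *\<^sub>R mat 1 + ((1 - s) / 2) *\<^sub>R A) = (\<Sum>I\<in>UNIV. s ^ card I * ?e I)"
    using det_rows_add_scaled[of UNIV "\<lambda>i. (1/2) *\<^sub>R (mat 1 + A) $ i" s "\<lambda>i. (1/2) *\<^sub>R (mat 1 - A) $ i" "\<lambda>_. 0"]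
    by (simp only: finite UNIV_I if_True Pow_UNIV)
  also have "\<dots> = (\<Sum>i\<le>CARD('n). \<Sum>I | I \<in> UNIV \<and> card I = i. s ^ card I * ?e I)"
    by (rule sum.group[symmetric]) (auto intro: card_mono)
  also have "\<dots> = (\<Sum>i\<le>CARD('n). d i * s ^ i)"
    by (simp add: d_def sum_distrib_left mult.commute)
  finally show "det (((1 + s) / 2) *\<^sub>R mat 1 + ((1 - s) / 2) *\<^sub>R A) = (\<Sum>i\<le>CARD('n). d i * s ^ i)" .
qed


section \<open>Polynomials with nonnegative coefficients\<close>

text \<open>Lagrange interpolation at the nodes 1, ..., n + 1. The nodes are positive because the
  polynomials are known only for s > 0, and the weights \<open>a\<close> do not depend on
  \<open>c\<close>, so every linear operation on the values (limit, integral, sum of measurable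
  functions) passes to the coefficients.\<close>

lemma interpolation_coefficients:
  obtains a :: "nat \<Rightarrow> nat \<Rightarrow> real"
  where "\<And>c i. i \<le> n \<Longrightarrow> c i = (\<Sum>j\<in>{1..Suc n}. a i j * (\<Sum>l\<le>n. c l * real j ^ l))"
proof
  define L where "L j = (\<Prod>m\<in>{1..Suc n} - {j}. smult (1 / (real j - real m)) [:- real m, 1:])" for j :: nat
  have degL: "degree (L j) \<le> n" if "j \<in> {1..Suc n}" for j
  proof -
    have "degree (L j) \<le> (\<Sum>m\<in>{1..Suc n} - {j}. degree (smult (1 / (real j - real m)) [:- real m, 1:]))"
      unfolding L_def by (rule order_trans[OF degree_prod_sum_le]) (auto simp: o_def)
    also have "\<dots> \<le> (\<Sum>m\<in>{1..Suc n} - {j}. 1)" by (intro sum_mono) auto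
    also have "\<dots> = n" using that by simp
    finally show ?thesis .
  qed
  have polyL: "poly (L j) (real k) = (if k = j then 1 else 0)" if "j \<in> {1..Suc n}" "k \<in> {1..Suc n}" for j k
  proof (cases "k = j")
    case True
    have "poly (L j) (real k) = (\<Prod>m\<in>{1..Suc n} - {j}. 1)"
      unfolding L_def poly_prod using True by (intro prod.cong) (auto simp: divide_simps)
    then show ?thesis using True by simp
  next
    case False
    then have "poly (L j) (real k) = 0"
      unfolding L_def poly_prod using that by (intro prod_zero) auto
    then show ?thesis using False by simp
  qed
  fix c :: "nat \<Rightarrow> real" and i assume i: "i \<le> n"
  define p where "p = (\<Sum>l\<le>n. monom (c l) l)"
  define q where "q = (\<Sum>j\<in>{1..Suc n}. smult (poly p (real j)) (L j))"
  have "degree p \<le> n" unfolding p_def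
    by (intro degree_sum_le) (auto intro: order_trans[OF degree_monom_le])
  moreover have "degree q \<le> n" unfolding q_def
    by (intro degree_sum_le) (auto intro: order_trans[OF degree_smult_le] degL)
  moreover have "poly p x = poly q x" if x: "x \<in> real ` {1..Suc n}" for x
  proof -
    obtain k where k: "x = real k" "k \<in> {1..Suc n}" using x by blast
    have "poly q x = (\<Sum>j\<in>{1..Suc n}. poly p (real j) * (if k = j then 1 else 0))"
      unfolding q_def poly_sum k(1) by (intro sum.cong refl) (simp only: polyL k poly_smult)
    also have "\<dots> = poly p x" using k by (simp add: sum.delta' if_distrib cong: if_cong)
    finally show ?thesis by simp
  qed
  moreover have "card (real ` {1..Suc n}) = Suc n"
    by (subst card_image) (auto simp: inj_on_def)
  ultimately have "p = q"
    by (intro poly_eqI_degree[of "real ` {1..Suc n}"]) auto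
  then have "coeff p i = coeff q i" by simp
  moreover have "coeff p i = c i" using i by (simp add: p_def coeff_sum)
  moreover have "poly p x = (\<Sum>l\<le>n. c l * x ^ l)" for x
    by (simp add: p_def poly_sum poly_monom)
  ultimately show "c i = (\<Sum>j\<in>{1..Suc n}. (\<lambda>i j. coeff (L j) i) i j * (\<Sum>l\<le>n. c l * real j ^ l))"
    by (simp add: q_def coeff_sum mult.commute)
qed

lemma coefficients_convergent:
  fixes c :: "nat \<Rightarrow> nat \<Rightarrow> real"
  assumes "\<And>s. s > 0 \<Longrightarrow> (\<lambda>k. \<Sum>l\<le>n. c k l * s ^ l) \<longlonglongrightarrow> (\<Sum>l\<le>n. d l * s ^ l)" "i \<le> n"
  shows "(\<lambda>k. c k i) \<longlonglongrightarrow> d i"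
proof -
  obtain a :: "nat \<Rightarrow> nat \<Rightarrow> real"
    where a: "\<And>c i. i \<le> n \<Longrightarrow> c i = (\<Sum>j\<in>{1..Suc n}. a i j * (\<Sum>l\<le>n. c l * real j ^ l))"
    using interpolation_coefficients by blast
  show ?thesis
    unfolding a[OF \<open>i \<le> n\<close>, of d] a[OF \<open>i \<le> n\<close>, of "c _"]
    by (intro tendsto_intros assms) auto
qed

lemma coefficients_unique:
  fixes c d :: "nat \<Rightarrow> real"
  assumes "\<And>s. s > 0 \<Longrightarrow> (\<Sum>l\<le>n. c l * s ^ l) = (\<Sum>l\<le>n. d l * s ^ l)" "i \<le> n"
  shows "c i = d i"
  using coefficients_convergent[where c="\<lambda>_. c" and d=d and n=n and i=i] assms by (simp add: LIMSEQ_const_iff)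

definition nonneg_polynomial :: "nat \<Rightarrow> (real \<Rightarrow> real) \<Rightarrow> bool" where
  "nonneg_polynomial n p \<longleftrightarrow> (\<exists>c. (\<forall>i. c i \<ge> 0) \<and> (\<forall>s>0. p s = (\<Sum>l\<le>n. c l * s ^ l)))"

text \<open>The fixed weights turn pointwise convergence into convergence of each coefficient, and
  limits of nonnegative numbers are nonnegative.\<close>

lemma nonneg_polynomial_LIMSEQ:
  assumes "\<And>k. nonneg_polynomial n (p k)" "\<And>s. s > 0 \<Longrightarrow> (\<lambda>k. p k s) \<longlonglongrightarrow> q s"
  shows "nonneg_polynomial n q"
proof -
  obtain c where c: "\<And>k i. c k i \<ge> 0" "\<And>k s. s > 0 \<Longrightarrow> p k s = (\<Sum>l\<le>n. c k l * s ^ l)"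
    using assms(1) unfolding nonneg_polynomial_def by metis
  obtain a :: "nat \<Rightarrow> nat \<Rightarrow> real"
    where a: "\<And>c i. i \<le> n \<Longrightarrow> c i = (\<Sum>j\<in>{1..Suc n}. a i j * (\<Sum>l\<le>n. c l * real j ^ l))"
    using interpolation_coefficients by blast
  define d where "d i = (if i \<le> n then \<Sum>j\<in>{1..Suc n}. a i j * q (real j) else 0)" for i
  have lim: "(\<lambda>k. c k i) \<longlonglongrightarrow> d i" if "i \<le> n" for i
  proof -
    have "(\<lambda>k. \<Sum>j\<in>{1..Suc n}. a i j * p k (real j)) \<longlonglongrightarrow> d i"
      unfolding d_def using that by (auto intro!: tendsto_intros assms)
    moreover have "(\<Sum>j\<in>{1..Suc n}. a i j * p k (real j)) = c k i" for k
      unfolding a[OF that, of "c k"] by (intro sum.cong refl arg_cong2[where f="(*)"] c(2)) auto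
    ultimately show ?thesis by simp
  qed
  have "d i \<ge> 0" for i
  proof (cases "i \<le> n")
    case True
    then show ?thesis using lim[OF True] c(1) by (meson LIMSEQ_le_const)
  qed (simp add: d_def)
  moreover have "q s = (\<Sum>l\<le>n. d l * s ^ l)" if "s > 0" for s
  proof (rule LIMSEQ_unique[OF assms(2)[OF that]])
    show "(\<lambda>k. p k s) \<longlonglongrightarrow> (\<Sum>l\<le>n. d l * s ^ l)"
      unfolding c(2)[OF that] by (intro tendsto_intros lim) auto
  qed
  ultimately show ?thesis unfolding nonneg_polynomial_def by blast
qed


section \<open>Euclidean spaces over a well-ordered copy of the index type\<close>

text \<open>The library's change of variables theorem requires a well-ordered index type, whereas \<open>'n\<close> is
  only finite.\<close>

typedef 'a wellordered_copy = "UNIV :: 'a set" by simp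

instance wellordered_copy :: (finite) finite
proof
  have "UNIV = Abs_wellordered_copy ` (UNIV :: 'a set)"
    using Rep_wellordered_copy_inverse by (metis surjI)
  then show "finite (UNIV :: 'a wellordered_copy set)"
    by (rule ssubst) simp
qed

definition copy_index :: "'a::finite wellordered_copy \<Rightarrow> nat" where
  "copy_index = (SOME f. inj f)"

lemma inj_copy_index: "inj copy_index"
proof -
  have "\<exists>f :: 'a wellordered_copy \<Rightarrow> nat. inj f"
    using finite_imp_inj_to_nat_seg[of "UNIV :: 'a wellordered_copy set"] by auto
  then show ?thesis unfolding copy_index_def by (rule someI_ex)
qed

instantiation wellordered_copy :: (finite) wellorder
begin

definition "x \<le> y \<longleftrightarrow> copy_index x \<le> copy_index y" for x y :: "'a wellordered_copy"
definition "x < y \<longleftrightarrow> copy_index x < copy_index y" for x y :: "'a wellordered_copy"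

instance
proof
  fix x y z :: "'a wellordered_copy" and P :: "'a wellordered_copy \<Rightarrow> bool"
  show "(x < y) = (x \<le> y \<and> \<not> y \<le> x)"
    by (auto simp: less_eq_wellordered_copy_def less_wellordered_copy_def)
  show "x \<le> x" "x \<le> y \<Longrightarrow> y \<le> z \<Longrightarrow> x \<le> z" "x \<le> y \<or> y \<le> x"
    by (auto simp: less_eq_wellordered_copy_def)
  show "x \<le> y \<Longrightarrow> y \<le> x \<Longrightarrow> x = y"
    by (simp add: less_eq_wellordered_copy_def inj_eq[OF inj_copy_index])
  assume step: "\<And>x. (\<And>y. y < x \<Longrightarrow> P y) \<Longrightarrow> P x"
  have "\<forall>x. copy_index x = m \<longrightarrow> P x" for m
  proof (induction m rule: less_induct)
    case (less m)
    show ?case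
    proof (intro allI impI)
      fix x :: "'a wellordered_copy" assume x: "copy_index x = m"
      show "P x"
        by (rule step) (use less x in \<open>simp add: less_wellordered_copy_def\<close>)
    qed
  qed
  then show "P x" by simp
qed

end

lemma bij_Rep_wellordered_copy: "bij Rep_wellordered_copy"
  by (intro bijI injI surjI[of _ Abs_wellordered_copy])
    (auto simp: Rep_wellordered_copy_inject Abs_wellordered_copy_inverse)

lemma card_wellordered_copy: "CARD('n::finite wellordered_copy) = CARD('n)"
  using bij_betw_same_card[OF bij_Rep_wellordered_copy] .

definition reindex :: "real^'n \<Rightarrow> real^('n wellordered_copy)" where
  "reindex x = (\<chi> i. x $ Rep_wellordered_copy i)"

definition unindex :: "real^('n wellordered_copy) \<Rightarrow> real^'n" where
  "unindex x = (\<chi> i. x $ Abs_wellordered_copy i)"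

lemma reindex_unindex [simp]: "reindex (unindex x) = x" "unindex (reindex y) = y"
  by (auto simp: reindex_def unindex_def vec_eq_iff Rep_wellordered_copy_inverse Abs_wellordered_copy_inverse)

lemma linear_reindex: "linear reindex" "linear unindex"
  by (auto simp: reindex_def unindex_def vec_eq_iff intro!: linearI)

lemma norm_reindex [simp]: "norm (reindex x) = norm x"
proof -
  have "(\<Sum>i\<in>UNIV. (x $ Rep_wellordered_copy i)\<^sup>2) = (\<Sum>i\<in>UNIV. (x $ i)\<^sup>2)"
    using bij_Rep_wellordered_copy by (rule sum.reindex_bij_betw)
  then show ?thesis by (simp add: norm_vec_def L2_set_def reindex_def)
qed

lemma norm_unindex [simp]: "norm (unindex x) = norm x"
  by (metis norm_reindex reindex_unindex(1))

lemma continuous_on_reindex: "continuous_on S reindex" "continuous_on T unindex"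
  by (auto simp: linear_continuous_on linear_linear linear_reindex)

lemma borel_measurable_reindex [measurable]:
  "reindex \<in> borel_measurable borel" "unindex \<in> borel_measurable borel"
  by (auto intro!: borel_measurable_continuous_onI continuous_on_reindex)

lemma prod_Basis_cart: "(\<Prod>b\<in>Basis. (x :: real^'n) \<bullet> b) = (\<Prod>i\<in>UNIV. x $ i)"
proof -
  have "(Basis :: (real^'n) set) = (\<lambda>i. axis i 1) ` UNIV" by (auto simp: Basis_vec_def)
  moreover have "inj (\<lambda>i::'n. axis i (1::real))" by (auto simp: inj_on_def axis_eq_axis)
  ultimately show ?thesis
    using prod.reindex[of "\<lambda>i::'n. axis i (1::real)" UNIV "\<lambda>b. x \<bullet> b"]
    by (simp add: inner_axis o_def)
qed

lemma lborel_distr_reindex: "distr lborel borel (reindex :: real^'n \<Rightarrow> _) = lborel"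
proof (rule lborel_eqI[symmetric])
  fix l u :: "real^('n wellordered_copy)"
  assume lu: "\<And>b. b \<in> Basis \<Longrightarrow> l \<bullet> b \<le> u \<bullet> b"
  have le: "l $ i \<le> u $ i" for i
    using lu[of "axis i 1"] by (simp add: inner_axis axis_in_Basis_iff)
  have "reindex -` box l u = box (unindex l) (unindex u)"
  proof (intro set_eqI)
    fix x :: "real^'n"
    have "(\<forall>i. P (Rep_wellordered_copy i) i) \<longleftrightarrow> (\<forall>i. P i (Abs_wellordered_copy i))" for P :: "'n \<Rightarrow> _ \<Rightarrow> bool"
      by (auto dest: spec[of _ "Abs_wellordered_copy _"] spec[of _ "Rep_wellordered_copy _"]
          simp: Abs_wellordered_copy_inverse Rep_wellordered_copy_inverse)
    from this[of "\<lambda>i j. l $ j < x $ i \<and> x $ i < u $ j"]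
    show "x \<in> reindex -` box l u \<longleftrightarrow> x \<in> box (unindex l) (unindex u)"
      by (simp add: mem_box_cart reindex_def unindex_def)
  qed
  then have "emeasure (distr lborel borel reindex) (box l u) = emeasure lborel (box (unindex l) (unindex u))"
    by (subst emeasure_distr) auto
  also have "\<dots> = ennreal (\<Prod>i\<in>UNIV. (unindex u - unindex l) $ i)"
    by (subst emeasure_lborel_box, unfold prod_Basis_cart)
      (auto simp: le unindex_def Basis_vec_def inner_axis)
  also have "(\<Prod>i\<in>UNIV. (unindex u - unindex l) $ i) = (\<Prod>i\<in>UNIV. (unindex u - unindex l) $ Rep_wellordered_copy i)"
    using bij_Rep_wellordered_copy by (rule prod.reindex_bij_betw[symmetric])
  also have "\<dots> = (\<Prod>i\<in>UNIV. (u - l) $ i)"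
    by (simp add: unindex_def Rep_wellordered_copy_inverse)
  finally show "emeasure (distr lborel borel reindex) (box l u) = (\<Prod>b\<in>Basis. (u - l) \<bullet> b)"
    by (simp add: prod_Basis_cart)
qed simp


section \<open>Parallel maps of nonexpansive maps\<close>

definition nonexpansive :: "('a::real_normed_vector \<Rightarrow> 'a) \<Rightarrow> bool" where
  "nonexpansive R \<longleftrightarrow> (\<forall>x y. norm (R x - R y) \<le> norm (x - y))"

definition parallel_map :: "('a::real_normed_vector \<Rightarrow> 'a) \<Rightarrow> real \<Rightarrow> 'a \<Rightarrow> 'a" where
  "parallel_map R s z = ((1 + s) / 2) *\<^sub>R z + ((1 - s) / 2) *\<^sub>R R z"

definition parallel_inv :: "('a::real_normed_vector \<Rightarrow> 'a) \<Rightarrow> real \<Rightarrow> 'a \<Rightarrow> 'a" where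
  "parallel_inv R s = inv (parallel_map R s)"

lemma parallel_map_diff:
  "parallel_map R s x - parallel_map R s y = ((1 + s) / 2) *\<^sub>R (x - y) + ((1 - s) / 2) *\<^sub>R (R x - R y)"
  by (simp add: parallel_map_def algebra_simps)

text \<open>The triangle inequality with (1 + s)/2 - |1 - s|/2 = min 1 s. The inverse is thus
  Lipschitz with a constant depending only on s, hence uniformly for a sequence of maps.\<close>

lemma parallel_map_lower:
  assumes "nonexpansive R" "s > 0"
  shows "min 1 s * norm (x - y) \<le> norm (parallel_map R s x - parallel_map R s y)"
proof -
  have "\<bar>(1 - s) / 2\<bar> * norm (R x - R y) \<le> \<bar>(1 - s) / 2\<bar> * norm (x - y)"
    using assms by (intro mult_left_mono) (auto simp: nonexpansive_def)
  moreover have "min 1 s * norm (x - y) = (1 + s) / 2 * norm (x - y) - \<bar>(1 - s) / 2\<bar> * norm (x - y)"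
    unfolding left_diff_distrib[symmetric] by (simp add: min_def abs_if field_simps)
  moreover have "norm (((1 + s) / 2) *\<^sub>R (x - y)) - norm (- (((1 - s) / 2) *\<^sub>R (R x - R y)))
      \<le> norm (((1 + s) / 2) *\<^sub>R (x - y) - (- (((1 - s) / 2) *\<^sub>R (R x - R y))))"
    by (rule norm_triangle_ineq2)
  ultimately show ?thesis unfolding parallel_map_diff using assms by simp
qed

lemma parallel_map_upper:
  assumes "nonexpansive R" "s > 0"
  shows "norm (parallel_map R s x - parallel_map R s y) \<le> max 1 s * norm (x - y)"
proof -
  have "\<bar>(1 - s) / 2\<bar> * norm (R x - R y) \<le> \<bar>(1 - s) / 2\<bar> * norm (x - y)"
    using assms by (intro mult_left_mono) (auto simp: nonexpansive_def)
  moreover have "max 1 s * norm (x - y) = (1 + s) / 2 * norm (x - y) + \<bar>(1 - s) / 2\<bar> * norm (x - y)"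
    unfolding distrib_right[symmetric] by (simp add: max_def abs_if field_simps)
  ultimately show ?thesis unfolding parallel_map_diff using assms
    by (intro norm_triangle_le) simp
qed

lemma bij_parallel_map:
  fixes R :: "'a::banach \<Rightarrow> 'a"
  assumes "nonexpansive R" "s > 0"
  shows "bij (parallel_map R s)"
proof (rule bijI)
  show "inj (parallel_map R s)"
  proof (rule injI)
    fix x y assume "parallel_map R s x = parallel_map R s y"
    then have "min 1 s * norm (x - y) \<le> 0" using parallel_map_lower[OF assms, of x y] by simp
    then have "norm (x - y) \<le> 0" using \<open>s > 0\<close> by (simp add: mult_le_0_iff min_def split: if_splits)
    then show "x = y" by simp
  qed
  show "surj (parallel_map R s)"
  proof (rule surjI[of _ "\<lambda>w. SOME z. parallel_map R s z = w"], rule someI_ex)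
    fix w
    \<comment> \<open>Solving for the first summand turns \<open>parallel_map R s z = w\<close> into
      a fixed-point equation. Its Lipschitz constant |1 - s|/(1 + s) is below 1 because s >
      0.\<close>
    let ?f = "\<lambda>z. (2 / (1 + s)) *\<^sub>R w - ((1 - s) / (1 + s)) *\<^sub>R R z"
    have "\<exists>!z. ?f z = z"
    proof (rule banach_fix_type)
      show "\<bar>1 - s\<bar> / (1 + s) \<ge> 0" "\<bar>1 - s\<bar> / (1 + s) < 1" using \<open>s > 0\<close> by (auto simp: abs_if)
      show "\<forall>x y. dist (?f x) (?f y) \<le> \<bar>1 - s\<bar> / (1 + s) * dist x y"
      proof (intro allI)
        fix x y
        have "dist (?f x) (?f y) = norm (((1 - s) / (1 + s)) *\<^sub>R (R y - R x))"
          by (simp add: dist_norm algebra_simps)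
        also have "\<dots> = \<bar>1 - s\<bar> / (1 + s) * norm (R y - R x)" using \<open>s > 0\<close> by (simp)
        also have "\<dots> \<le> \<bar>1 - s\<bar> / (1 + s) * dist x y" using assms
          by (intro mult_left_mono) (auto simp: nonexpansive_def dist_norm norm_minus_commute)
        finally show "dist (?f x) (?f y) \<le> \<bar>1 - s\<bar> / (1 + s) * dist x y" .
      qed
    qed
    then obtain z where z: "?f z = z" by blast
    have "parallel_map R s z = ((1 + s) / 2) *\<^sub>R ?f z + ((1 - s) / 2) *\<^sub>R R z"
      unfolding z by (simp add: parallel_map_def)
    also have "\<dots> = w"
    proof -
      have "(1 + s) / 2 * (2 / (1 + s)) = 1" "(1 + s) / 2 * ((1 - s) / (1 + s)) = (1 - s) / 2"
        using \<open>s > 0\<close> by (auto simp: field_simps)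
      then show ?thesis by (simp only: scaleR_right_diff_distrib scaleR_scaleR) simp
    qed
    finally show "\<exists>z. parallel_map R s z = w" by blast
  qed
qed

context
  fixes R :: "'a::banach \<Rightarrow> 'a" and s :: real
  assumes R: "nonexpansive R" and s: "s > 0"
begin

lemma parallel_map_inv [simp]: "parallel_map R s (parallel_inv R s w) = w"
  unfolding parallel_inv_def by (rule surj_f_inv_f) (rule bij_is_surj[OF bij_parallel_map[OF R s]])

lemma parallel_inv_map [simp]: "parallel_inv R s (parallel_map R s z) = z"
  unfolding parallel_inv_def by (rule inv_f_f) (rule bij_is_inj[OF bij_parallel_map[OF R s]])

lemma parallel_inv_lipschitz:
  "norm (parallel_inv R s x - parallel_inv R s y) \<le> norm (x - y) / min 1 s"
  using parallel_map_lower[OF R s, of "parallel_inv R s x" "parallel_inv R s y"] s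
  by (simp add: field_simps)

lemma continuous_on_parallel_inv: "continuous_on S (parallel_inv R s)"
proof (rule lipschitz_on_continuous_on)
  show "(1 / min 1 s)-lipschitz_on S (parallel_inv R s)"
    using parallel_inv_lipschitz s by (intro lipschitz_onI) (auto simp: dist_norm)
qed

end

lemma nonexpansive_continuous: "nonexpansive R \<Longrightarrow> continuous_on S R"
  by (rule lipschitz_on_continuous_on[of 1], rule lipschitz_onI) (auto simp: nonexpansive_def dist_norm)

text \<open>Controls supports: a function supported in a ball keeps compact support after
  composition with \<open>parallel_inv R s\<close>, with a radius that depends on \<open>R\<close>
  only through a bound for \<open>R 0\<close>. This uniformity provides dominating functions when
  \<open>R\<close> is approximated.\<close>

lemma parallel_inv_norm_bound:
  fixes R :: "'a::banach \<Rightarrow> 'a"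
  assumes "nonexpansive R" "s > 0" "norm (parallel_inv R s w) \<le> r" "norm (R 0) \<le> b"
  shows "norm w \<le> max 1 s * r + \<bar>1 - s\<bar> / 2 * b"
proof -
  have "w = (parallel_map R s (parallel_inv R s w) - parallel_map R s 0) + parallel_map R s 0"
    using assms by simp
  then have "norm w \<le> norm (parallel_map R s (parallel_inv R s w) - parallel_map R s 0) + norm (parallel_map R s 0)"
    by (metis norm_triangle_ineq)
  also have "\<dots> \<le> max 1 s * r + \<bar>1 - s\<bar> / 2 * b"
  proof (intro add_mono)
    have "norm (parallel_map R s (parallel_inv R s w) - parallel_map R s 0) \<le> max 1 s * norm (parallel_inv R s w)"
      using parallel_map_upper[OF assms(1,2), of _ 0] by simp
    also have "\<dots> \<le> max 1 s * r" using assms by (intro mult_left_mono) auto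
    finally show "norm (parallel_map R s (parallel_inv R s w) - parallel_map R s 0) \<le> max 1 s * r" .
    show "norm (parallel_map R s 0) \<le> \<bar>1 - s\<bar> / 2 * b"
      using assms by (auto simp: parallel_map_def intro!: mult_left_mono divide_right_mono)
  qed
  finally show ?thesis .
qed

text \<open>The point z = \<open>parallel_inv R s w\<close> is also the preimage of
  \<open>parallel_map (Rk k) s z\<close> under the k-th map, and these points tend to w. The
  inverses share one Lipschitz constant.\<close>

lemma parallel_inv_LIMSEQ:
  fixes R :: "'a::banach \<Rightarrow> 'a"
  assumes "nonexpansive R" "\<And>k. nonexpansive (Rk k)" "s > 0" "\<And>x. (\<lambda>k. Rk k x) \<longlonglongrightarrow> R x"
  shows "(\<lambda>k. parallel_inv (Rk k) s w) \<longlonglongrightarrow> parallel_inv R s w"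
proof -
  let ?z = "parallel_inv R s w"
  have "norm (parallel_inv (Rk k) s w - ?z) \<le> norm (w - parallel_map (Rk k) s ?z) / min 1 s" for k
    using parallel_inv_lipschitz[OF assms(2,3), of k w "parallel_map (Rk k) s ?z"] assms by simp
  moreover have "(\<lambda>k. norm (w - parallel_map (Rk k) s ?z) / min 1 s) \<longlonglongrightarrow> norm (w - parallel_map R s ?z) / min 1 s"
    unfolding parallel_map_def using assms by (intro tendsto_intros assms) auto
  then have "(\<lambda>k. norm (w - parallel_map (Rk k) s ?z) / min 1 s) \<longlonglongrightarrow> 0" using assms by simp
  ultimately have "(\<lambda>k. parallel_inv (Rk k) s w - ?z) \<longlonglongrightarrow> 0"
    by (rule Lim_null_comparison[OF always_eventually[OF allI]])
  then show ?thesis by (simp add: LIM_zero_iff)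
qed

lemma integrable_compact_support:
  fixes f :: "'a::euclidean_space \<Rightarrow> 'b::{banach,second_countable_topology}"
  assumes "continuous_on UNIV f" "\<And>x. f x \<noteq> 0 \<Longrightarrow> norm x \<le> r"
  shows "integrable lborel f"
proof -
  have "integrable lborel (\<lambda>x. indicator (cball 0 r) x *\<^sub>R f x)"
    using continuous_on_subset[OF assms(1)] by (intro borel_integrable_compact) auto
  also have "(\<lambda>x. indicator (cball 0 r) x *\<^sub>R f x) = f"
    using assms(2) by (auto simp: indicator_def fun_eq_iff)
  finally show ?thesis .
qed

lemma nonexpansive_derivative_bound:
  fixes R :: "'a::real_normed_vector \<Rightarrow> 'a"
  assumes "nonexpansive R" "(R has_derivative R') (at z)"
  shows "norm (R' h) \<le> norm h"
proof -
  have lin: "linear R'" using assms(2) by (rule has_derivative_linear)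
  show ?thesis
  proof (cases "h = 0")
    case True
    then show ?thesis using linear_0[OF lin] by simp
  next
    case False
    show ?thesis
    proof (rule field_le_epsilon)
      fix e :: real assume "e > 0"
      define e' where "e' = e / norm h"
      have "e' > 0" using \<open>e > 0\<close> False by (simp add: e'_def)
      then obtain d where d: "d > 0"
        "\<And>y. norm (y - z) < d \<Longrightarrow> norm (R y - R z - R' (y - z)) \<le> e' * norm (y - z)"
        using assms(2) unfolding has_derivative_at_alt by blast
      define t where "t = d / (2 * norm h)"
      have t: "t > 0" "t * norm h < d" using d False by (auto simp: t_def)
      have "norm (t *\<^sub>R R' h) \<le> norm (R (z + t *\<^sub>R h) - R z) + norm (R (z + t *\<^sub>R h) - R z - R' (t *\<^sub>R h))"
        using norm_triangle_ineq4[of "R (z + t *\<^sub>R h) - R z" "R (z + t *\<^sub>R h) - R z - R' (t *\<^sub>R h)"]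
        by (simp add: linear_cmul[OF lin])
      also have "\<dots> \<le> t * norm h + e' * (t * norm h)"
      proof (rule add_mono)
        show "norm (R (z + t *\<^sub>R h) - R z) \<le> t * norm h"
          using assms(1)[unfolded nonexpansive_def, rule_format, of "z + t *\<^sub>R h" z] t by simp
        show "norm (R (z + t *\<^sub>R h) - R z - R' (t *\<^sub>R h)) \<le> e' * (t * norm h)"
          using d(2)[of "z + t *\<^sub>R h"] t by simp
      qed
      also have "\<dots> = t * (norm h + e)" using False by (simp add: e'_def field_simps)
      finally show "norm (R' h) \<le> norm h + e" using t by simp
    qed
  qed
qed

lemma matrix_parallel_derivative:
  fixes R' :: "real^'n \<Rightarrow> real^'n"
  assumes "linear R'"
  shows "matrix (\<lambda>h. a *\<^sub>R h + b *\<^sub>R R' h) = a *\<^sub>R mat 1 + b *\<^sub>R matrix R'"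
  by (simp add: matrix_def vec_eq_iff mat_def axis_def)

text \<open>Substituting w = T_s z gives the integral of f(z) det DT_s(z), and for each z the
  determinant is a polynomial in s with nonnegative coefficients \<open>d z i\<close>.\<close>

lemma steiner_polynomial_smooth:
  fixes R :: "real^'m::{finite,wellorder} \<Rightarrow> real^'m::_"
  assumes R: "nonexpansive R" and R': "\<And>z. (R has_derivative R' z) (at z)"
    and f: "continuous_on UNIV f" "\<And>x. f x \<noteq> 0 \<Longrightarrow> norm x \<le> r" "\<And>x. f x \<ge> 0"
  shows "nonneg_polynomial CARD('m) (\<lambda>s. \<integral>w. f (parallel_inv R s w) \<partial>lborel)"
proof -
  have R'le: "norm (R' z h) \<le> norm h" for z h
    by (rule nonexpansive_derivative_bound[OF R R'])
  have lin: "linear (R' z)" for z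
    using R' by (rule has_derivative_linear)
  have "\<exists>d. (\<forall>i. d i \<ge> 0) \<and> (\<forall>s. det (((1 + s) / 2) *\<^sub>R mat 1 + ((1 - s) / 2) *\<^sub>R matrix (R' z)) = (\<Sum>i\<le>CARD('m). d i * s ^ i))" for z
    by (rule det_affine_contraction_polynomial[of "matrix (R' z)"]) (auto simp: fun_cong[OF matrix_vector_mul(2)[OF lin]] R'le)
  then obtain d where d0: "\<And>z i. d z i \<ge> 0"
    and d: "\<And>z s. det (((1 + s) / 2) *\<^sub>R mat 1 + ((1 - s) / 2) *\<^sub>R matrix (R' z)) = (\<Sum>i\<le>CARD('m). d z i * s ^ i)"
    by metis
  define p where "p s = (\<integral>w. f (parallel_inv R s w) \<partial>lborel)" for s
  define q where "q s z = (\<Sum>i\<le>CARD('m). (f z * d z i) * s ^ i)" for s z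
  have q: "q s absolutely_integrable_on UNIV \<and> integral UNIV (q s) = p s" if s: "s > 0" for s
  proof -
    let ?g = "parallel_map R s" and ?g' = "\<lambda>z h. ((1 + s) / 2) *\<^sub>R h + ((1 - s) / 2) *\<^sub>R R' z h"
    \<comment> \<open>The change of variables rule concerns vector-valued integrands, so the real
      function is wrapped into \<open>real^1\<close>.\<close>
    let ?F = "\<lambda>w. f (parallel_inv R s w) *\<^sub>R (1 :: real^1)"
    have img: "range ?g = UNIV" using bij_parallel_map[OF R s] by (simp add: bij_is_surj)
    have det: "det (matrix (?g' z)) = (\<Sum>i\<le>CARD('m). d z i * s ^ i)" for z
      by (simp add: matrix_parallel_derivative[OF lin] d)
    have "det (matrix (?g' z)) \<ge> 0" for z
      unfolding det using d0 s by (intro sum_nonneg) auto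
    then have eq: "\<bar>det (matrix (?g' z))\<bar> *\<^sub>R ?F (?g z) = q s z *\<^sub>R 1" for z
      using R s by (simp add: det q_def sum_distrib_left mult_ac)
    have int: "integrable lborel (\<lambda>w. f (parallel_inv R s w))"
      by (rule integrable_compact_support)
        (auto intro!: continuous_on_compose2[OF f(1)] continuous_on_parallel_inv R s
           parallel_inv_norm_bound[OF R s f(2)])
    then have ai: "(\<lambda>w. f (parallel_inv R s w)) absolutely_integrable_on UNIV"
      by (simp add: set_integrable_def integrable_completion)
    have pi: "integral UNIV (\<lambda>w. f (parallel_inv R s w)) = p s"
      unfolding p_def using int by (rule integral_lborel)
    have "?F absolutely_integrable_on (range ?g) \<and> integral (range ?g) ?F = p s *\<^sub>R 1"
      unfolding img
    proof
      show "?F absolutely_integrable_on UNIV" using ai by (intro set_integrable_scaleR_left)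
      show "integral UNIV ?F = p s *\<^sub>R 1"
        using integral_linear[OF set_lebesgue_integral_eq_integral(1)[OF ai]
            bounded_linear_scaleR_left[of "1::real^1"]] pi
        by (simp add: o_def)
    qed
    moreover have "(?g has_derivative ?g' z) (at z within UNIV)" for z
      unfolding parallel_map_def[abs_def]
      using has_derivative_add[OF has_derivative_scaleR_right[OF has_derivative_ident]
          has_derivative_scaleR_right[OF R']] by simp
    moreover have "inj ?g" by (rule bij_is_inj[OF bij_parallel_map[OF R s]])
    ultimately have "(\<lambda>z. \<bar>det (matrix (?g' z))\<bar> *\<^sub>R ?F (?g z)) absolutely_integrable_on UNIV \<and>
        integral UNIV (\<lambda>z. \<bar>det (matrix (?g' z))\<bar> *\<^sub>R ?F (?g z)) = p s *\<^sub>R 1"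
      by (intro iffD2[OF has_absolute_integral_change_of_variables[where g="?g" and g'="?g'"]]) auto
    then have *: "(\<lambda>z. q s z *\<^sub>R (1::real^1)) absolutely_integrable_on UNIV"
      "integral UNIV (\<lambda>z. q s z *\<^sub>R (1::real^1)) = p s *\<^sub>R 1"
      by (simp_all only: eq)
    have comp: "(\<lambda>z. (q s z *\<^sub>R (1::real^1)) \<bullet> 1) = q s" by (simp add: inner_vec_def)
    have "q s absolutely_integrable_on UNIV"
    proof -
      have "(\<lambda>z. (q s z *\<^sub>R (1::real^1)) \<bullet> 1) absolutely_integrable_on UNIV"
        using *(1) by (rule absolutely_integrable_component)
      then show ?thesis by (simp only: comp)
    qed
    moreover have "integral UNIV (q s) = p s"
      using integral_component_eq[OF set_lebesgue_integral_eq_integral(1)[OF *(1)], of 1] *(2)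
      unfolding comp by (simp add: inner_vec_def)
    ultimately show ?thesis by simp
  qed
  obtain a :: "nat \<Rightarrow> nat \<Rightarrow> real"
    where a: "\<And>c i. i \<le> CARD('m) \<Longrightarrow> c i = (\<Sum>j\<in>{1..Suc CARD('m)}. a i j * (\<Sum>l\<le>CARD('m). c l * real j ^ l))"
    using interpolation_coefficients by blast
  \<comment> \<open>The coefficients \<open>d z i\<close> were chosen pointwise and carry no
    measurability in z. Integrability of \<open>f z * d z i\<close> is read off from the integrable
    functions \<open>q (real j)\<close> by interpolation.\<close>
  have fd: "(\<lambda>z. f z * d z i) integrable_on UNIV" if "i \<le> CARD('m)" for i
  proof -
    have "(\<lambda>z. \<Sum>j\<in>{1..Suc CARD('m)}. a i j * q (real j) z) integrable_on UNIV"
      using q by (intro integrable_sum integrable_on_mult_right set_lebesgue_integral_eq_integral(1)) auto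
    moreover have "(\<Sum>j\<in>{1..Suc CARD('m)}. a i j * q (real j) z) = f z * d z i" for z
      unfolding q_def using a[OF that, of "\<lambda>i. f z * d z i"] by simp
    ultimately show ?thesis by simp
  qed
  define c where "c i = integral UNIV (\<lambda>z. f z * d z i)" for i
  have "c i \<ge> 0" for i
    unfolding c_def
    \<comment> \<open>For i > CARD('m) integrability has not been established, and the integral may
      be the default value 0.\<close>
    by (cases "(\<lambda>z. f z * d z i) integrable_on UNIV")
      (auto intro!: integral_nonneg simp: not_integrable_integral d0 f)
  moreover have "p s = (\<Sum>i\<le>CARD('m). c i * s ^ i)" if "s > 0" for s
  proof -
    have "p s = integral UNIV (\<lambda>z. \<Sum>i\<le>CARD('m). (f z * d z i) * s ^ i)"
      using q[OF that, THEN conjunct2] by (simp only: q_def[abs_def])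
    also have "\<dots> = (\<Sum>i\<le>CARD('m). integral UNIV (\<lambda>z. (f z * d z i) * s ^ i))"
      using fd by (intro integral_sum integrable_on_mult_left) auto
    finally show ?thesis by (simp add: c_def)
  qed
  ultimately show ?thesis
    unfolding nonneg_polynomial_def p_def[symmetric] by (intro exI[of _ c]) auto
qed


section \<open>Mollification\<close>

lemma lborel_integral_affine:
  fixes g :: "'a::euclidean_space \<Rightarrow> 'b::{banach,second_countable_topology}"
  assumes [measurable]: "g \<in> borel_measurable borel" and "c \<noteq> 0"
  shows "(\<integral>x. g x \<partial>lborel) = \<bar>c\<bar> ^ DIM('a) *\<^sub>R (\<integral>x. g (t + c *\<^sub>R x) \<partial>lborel)"
  by (subst lborel_affine[OF \<open>c \<noteq> 0\<close>, of t])
    (simp add: integral_density integral_distr)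

text \<open>Supported in the ball of radius 1/m for m >= 1. Squaring the positive part removes its
  kink, so the function is C^1, and one derivative is what differentiation under the integral asks
  for. The mass is normalised in \<open>mollify\<close>.\<close>

definition bump :: "real \<Rightarrow> 'a::euclidean_space \<Rightarrow> real" where
  "bump m x = (max 0 (1 - m\<^sup>2 * (x \<bullet> x)))\<^sup>2"

definition mollify :: "real \<Rightarrow> ('a::euclidean_space \<Rightarrow> 'a) \<Rightarrow> 'a \<Rightarrow> 'a" where
  "mollify m R x = (1 / (\<integral>w. bump m (w :: 'a) \<partial>lborel)) *\<^sub>R (\<integral>w. bump m w *\<^sub>R R (x - w) \<partial>lborel)"

lemma bump_nonneg [simp]: "bump m x \<ge> 0"
  by (simp add: bump_def)

lemma bump_support:
  assumes "bump m x \<noteq> 0" "m \<ge> 1"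
  shows "norm x \<le> 1 / m"
proof -
  have "m\<^sup>2 * (x \<bullet> x) \<le> 1" using assms by (auto simp: bump_def max_def split: if_splits)
  then have "(m * norm x)\<^sup>2 \<le> 1\<^sup>2" by (simp add: power_mult_distrib power2_norm_eq_inner)
  then have "m * norm x \<le> 1" by (rule power2_le_imp_le) simp
  then show ?thesis using assms by (simp add: field_simps)
qed

lemma continuous_on_bump: "continuous_on S (bump m)"
  unfolding bump_def by (intro continuous_intros)

lemma integrable_bump: "m \<ge> 1 \<Longrightarrow> integrable lborel (bump m)"
  by (rule integrable_compact_support[where r="1/m"]) (auto intro: continuous_on_bump bump_support)

lemma integral_bump_pos:
  assumes "m \<ge> 1"
  shows "(\<integral>w. bump m (w :: 'a::euclidean_space) \<partial>lborel) > 0"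
proof -
  \<comment> \<open>On this ball m^2 |w|^2 <= 1/4, so the bump is at least (3/4)^2 > 1/2
    there.\<close>
  let ?B = "ball (0::'a) (1 / (2 * m))"
  have "(\<integral>w. indicator ?B w * (1/2) \<partial>lborel) \<le> (\<integral>w. bump m (w :: 'a) \<partial>lborel)"
  proof (rule integral_mono)
    show "integrable lborel (\<lambda>w. indicator ?B w * (1/2::real))"
      using emeasure_bounded_finite[of ?B]
      by (intro integrable_mult_left integrable_real_indicator) auto
    show "integrable lborel (bump m :: 'a \<Rightarrow> _)" using assms by (rule integrable_bump)
    fix w :: 'a
    show "indicator ?B w * (1/2) \<le> bump m w"
    proof (cases "w \<in> ?B")
      case True
      then have "m * norm w \<le> 1 / 2" using assms by (simp add: field_simps)
      then have "(m * norm w)\<^sup>2 \<le> (1 / 2)\<^sup>2" using assms by (intro power_mono) auto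
      moreover have "(m * norm w)\<^sup>2 = m\<^sup>2 * (w \<bullet> w)"
        by (simp add: power_mult_distrib power2_norm_eq_inner)
      ultimately have "1 - m\<^sup>2 * (w \<bullet> w) \<ge> 3 / 4" by (simp add: power_divide)
      then have "(3 / 4)\<^sup>2 \<le> bump m w" unfolding bump_def by (intro power_mono) auto
      then show ?thesis using True by (simp add: power2_eq_square)
    qed simp
  qed
  moreover have "(\<integral>w. indicator ?B w * (1/2) \<partial>lborel) = measure lborel ?B / 2"
    by simp
  moreover have "measure lborel ?B > 0"
    by (rule content_ball_pos) (use assms in simp)
  ultimately show ?thesis by linarith
qed

context
  fixes R :: "'a::euclidean_space \<Rightarrow> 'a" and m :: real
  assumes R: "nonexpansive R" and m: "m \<ge> 1"
begin

lemma integrable_mollify: "integrable lborel (\<lambda>w. bump m w *\<^sub>R R (x - w))"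
proof (rule integrable_compact_support)
  show "continuous_on UNIV (\<lambda>w. bump m w *\<^sub>R R (x - w))"
    by (intro continuous_intros continuous_on_bump continuous_on_compose2[OF nonexpansive_continuous[OF R, of UNIV]]) auto
qed (use bump_support m in auto)

text \<open>A weighted mean is bounded by the bound of its integrand on the support of the weight.
  With \<open>g\<close> the difference of two translates of \<open>R\<close> this gives
  nonexpansiveness; with \<open>g\<close> the deviation from \<open>R x\<close> it gives the error
  1/m.\<close>

lemma mollify_diff_bound:
  fixes g :: "'a \<Rightarrow> 'a"
  assumes "integrable lborel (\<lambda>w. bump m w *\<^sub>R g w)" "\<And>w. bump m w \<noteq> 0 \<Longrightarrow> norm (g w) \<le> b"
  shows "norm ((1 / (\<integral>w. bump m (w :: 'a) \<partial>lborel)) *\<^sub>R (\<integral>w. bump m w *\<^sub>R g w \<partial>lborel)) \<le> b"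
proof -
  have "norm (\<integral>w. bump m w *\<^sub>R g w \<partial>lborel) \<le> (\<integral>w. bump m (w :: 'a) * b \<partial>lborel)"
  proof -
    have "norm (\<integral>w. bump m w *\<^sub>R g w \<partial>lborel) \<le> (\<integral>w. norm (bump m w *\<^sub>R g w) \<partial>lborel)"
      by (rule integral_norm_bound)
    also have "\<dots> \<le> (\<integral>w. bump m (w :: 'a) * b \<partial>lborel)"
    proof (rule integral_mono)
      show "integrable lborel (\<lambda>w. norm (bump m w *\<^sub>R g w))" using assms(1) by (rule integrable_norm)
      show "integrable lborel (\<lambda>w. bump m (w :: 'a) * b)" using integrable_bump[OF m, where 'a='a] by simp
      show "norm (bump m w *\<^sub>R g w) \<le> bump m w * b" for w
        using assms(2)[of w] by (cases "bump m w = 0") (auto intro!: mult_left_mono)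
    qed
    finally show ?thesis .
  qed
  then show ?thesis
    using integral_bump_pos[OF m, where 'a='a] by (simp add: field_simps)
qed

lemma nonexpansive_mollify: "nonexpansive (mollify m R)"
  unfolding nonexpansive_def
proof (intro allI)
  fix x y
  have "mollify m R x - mollify m R y =
    (1 / (\<integral>w. bump m (w :: 'a) \<partial>lborel)) *\<^sub>R (\<integral>w. bump m w *\<^sub>R (R (x - w) - R (y - w)) \<partial>lborel)"
    unfolding mollify_def scaleR_right_diff_distrib
    by (simp add: Bochner_Integration.integral_diff integrable_mollify scaleR_right_diff_distrib)
  also have "norm \<dots> \<le> norm (x - y)"
  proof (rule mollify_diff_bound)
    show "integrable lborel (\<lambda>w. bump m w *\<^sub>R (R (x - w) - R (y - w)))"
      unfolding scaleR_right_diff_distrib by (intro Bochner_Integration.integrable_diff integrable_mollify)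
    show "norm (R (x - w) - R (y - w)) \<le> norm (x - y)" for w
      using R[unfolded nonexpansive_def, rule_format, of "x - w" "y - w"] by simp
  qed
  finally show "norm (mollify m R x - mollify m R y) \<le> norm (x - y)" .
qed

lemma mollify_approx: "norm (mollify m R x - R x) \<le> 1 / m"
proof -
  let ?N = "\<integral>w. bump m (w :: 'a) \<partial>lborel"
  have "R x = (1 / ?N) *\<^sub>R (\<integral>w. bump m (w :: 'a) *\<^sub>R R x \<partial>lborel)"
    using integral_bump_pos[OF m, where 'a='a] integrable_bump[OF m, where 'a='a] by simp
  then have "mollify m R x - R x = (1 / ?N) *\<^sub>R (\<integral>w. bump m w *\<^sub>R R (x - w) \<partial>lborel) -
      (1 / ?N) *\<^sub>R (\<integral>w. bump m (w :: 'a) *\<^sub>R R x \<partial>lborel)"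
    unfolding mollify_def by simp
  also have "\<dots> = (1 / ?N) *\<^sub>R (\<integral>w. bump m w *\<^sub>R (R (x - w) - R x) \<partial>lborel)"
    unfolding scaleR_right_diff_distrib
    by (subst Bochner_Integration.integral_diff)
      (auto simp: integrable_mollify integrable_bump m scaleR_right_diff_distrib)
  also have "norm \<dots> \<le> 1 / m"
  proof (rule mollify_diff_bound)
    show "integrable lborel (\<lambda>w. bump m w *\<^sub>R (R (x - w) - R x))"
      unfolding scaleR_right_diff_distrib
      by (intro Bochner_Integration.integrable_diff integrable_mollify integrable_scaleR_left integrable_bump m)
    show "norm (R (x - w) - R x) \<le> 1 / m" if "bump m w \<noteq> 0" for w
      using R[unfolded nonexpansive_def, rule_format, of "x - w" "x"] bump_support[OF that m] by simp
  qed
  finally show ?thesis .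
qed

text \<open>The substitution y = x - w moves x into the C^1 kernel, so that the derivative falls on
  \<open>bump\<close> alone and \<open>R\<close> enters only through its continuity.\<close>

lemma mollify_differentiable:
  obtains D where "(mollify m R has_derivative D) (at x0)"
proof -
  \<comment> \<open>For x within distance 1 of \<open>x0\<close> the kernel lives within distance
    1/m <= 1 of x, so one compact box serves all these x.\<close>
  obtain a where a: "cball x0 2 \<subseteq> cbox (-a) a"
    using bounded_subset_cbox_symmetric[OF bounded_cball] by blast
  let ?f = "\<lambda>x y. bump m (x - y) *\<^sub>R R y"
  \<comment> \<open>The derivative of \<open>bump m (x - y)\<close> in x, as a bounded linear
    functional, times \<open>R y\<close>. The factor 4 is 2 from the outer square times 2 from the
    inner product.\<close>
  let ?fx = "\<lambda>x y. blinfun_scaleR_left (R y) o\<^sub>L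
    blinfun_inner_right ((- 4 * m\<^sup>2 * max 0 (1 - m\<^sup>2 * ((x - y) \<bullet> (x - y)))) *\<^sub>R (x - y))"
  have eq: "(\<integral>w. bump m w *\<^sub>R R (x - w) \<partial>lborel) = integral (cbox (-a) a) (?f x)" if x: "x \<in> ball x0 1" for x
  proof -
    have meas: "(\<lambda>w. bump m w *\<^sub>R R (x - w)) \<in> borel_measurable borel"
      by (intro borel_measurable_continuous_onI continuous_intros continuous_on_bump
          continuous_on_compose2[OF nonexpansive_continuous[OF R, of UNIV]]) auto
    have supp: "y \<in> cbox (-a) a" if "?f x y \<noteq> 0" for y
    proof -
      have "norm (x - y) \<le> 1 / m" using that bump_support[OF _ m] by auto
      also have "\<dots> \<le> 1" using m by simp
      finally have "dist x0 y \<le> 2"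
        using x dist_triangle[of x0 y x] by (auto simp: dist_norm)
      then show ?thesis using a by auto
    qed
    have int: "integrable lborel (?f x)"
    proof (rule integrable_compact_support)
      show "continuous_on UNIV (?f x)"
        by (intro continuous_intros continuous_on_compose2[OF continuous_on_bump[of UNIV]] nonexpansive_continuous[OF R]) auto
      show "norm y \<le> norm x0 + 2" if "?f x y \<noteq> 0" for y
      proof -
        have "norm (x - y) \<le> 1 / m" using that bump_support[OF _ m] by auto
        also have "\<dots> \<le> 1" using m by simp
        finally show ?thesis using x norm_triangle_ineq[of "y - x0" x0] dist_triangle[of x0 y x]
          by (auto simp: dist_norm norm_minus_commute)
      qed
    qed
    have "(\<integral>w. bump m w *\<^sub>R R (x - w) \<partial>lborel) = integral\<^sup>L lborel (?f x)"
      using lborel_integral_affine[OF meas, of "-1" x] by simp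
    also have "\<dots> = integral UNIV (?f x)" using int by (rule integral_lborel[symmetric])
    also have "\<dots> = integral UNIV (\<lambda>y. if y \<in> cbox (-a) a then ?f x y else 0)"
      using supp by (intro arg_cong2[where f=integral] ext refl) auto
    finally show ?thesis by (simp add: integral_restrict_UNIV)
  qed
  have "((\<lambda>x. integral (cbox (-a) a) (?f x)) has_derivative integral (cbox (-a) a) (?fx x0)) (at x0 within ball x0 1)"
  proof (rule leibniz_rule)
    show "((\<lambda>x. ?f x t) has_derivative blinfun_apply (?fx x t)) (at x within ball x0 1)" for x t
    proof -
      have d1: "((\<lambda>u. (max 0 u)\<^sup>2) has_derivative (\<lambda>h. 2 * max 0 u * h)) (at u)" for u :: real
      proof -
        have "((\<lambda>u. (max 0 u)\<^sup>2) has_real_derivative 2 * max 0 u) (at u)"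
        proof (cases u "0::real" rule: linorder_cases)
          case less
          then have "eventually (\<lambda>v. v < 0) (nhds u)" by (intro eventually_nhds_in_open[of "{..<0}", simplified]) auto
          then have "eventually (\<lambda>v. (max 0 v)\<^sup>2 = 0) (nhds u)" by eventually_elim simp
          then show ?thesis using less
            by (subst DERIV_cong_ev[where g="\<lambda>_. 0"]) auto
        next
          \<comment> \<open>At the kink the square matters: the difference quotient at 0 is bounded
            by |h|.\<close>
          case equal
          have "((\<lambda>h::real. (max 0 h)\<^sup>2 / h) \<longlongrightarrow> 0) (at 0)"
          proof (rule Lim_null_comparison)
            show "eventually (\<lambda>h::real. norm ((max 0 h)\<^sup>2 / h) \<le> \<bar>h\<bar>) (at 0)"
              by (intro always_eventually allI) (auto simp: max_def power2_eq_square)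
            show "((\<lambda>h::real. \<bar>h\<bar>) \<longlongrightarrow> 0) (at 0)" by (intro tendsto_rabs_zero tendsto_ident_at)
          qed
          then show ?thesis using equal by (simp add: DERIV_def)
        next
          case greater
          then have "eventually (\<lambda>v. v > 0) (nhds u)" by (intro eventually_nhds_in_open[of "{0<..}", simplified]) auto
          then have "eventually (\<lambda>v. (max 0 v)\<^sup>2 = v\<^sup>2) (nhds u)" by eventually_elim simp
          then show ?thesis using greater
            by (subst DERIV_cong_ev[where g="\<lambda>v. v\<^sup>2"]) (auto intro!: derivative_eq_intros)
        qed
        then show ?thesis by (simp add: has_field_derivative_def)
      qed
      have "((\<lambda>x. bump m (x - t)) has_derivative
        (\<lambda>h. 2 * max 0 (1 - m\<^sup>2 * ((x - t) \<bullet> (x - t))) * (- (m\<^sup>2 * (2 * ((x - t) \<bullet> h)))))) (at x within ball x0 1)"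
        unfolding bump_def
        by (rule has_derivative_compose[where g="\<lambda>u. (max 0 u)\<^sup>2" and f="\<lambda>x. 1 - m\<^sup>2 * ((x - t) \<bullet> (x - t))", OF _ d1])
          (auto intro!: derivative_eq_intros simp: inner_commute)
      then have "((\<lambda>x. ?f x t) has_derivative
        (\<lambda>h. (2 * max 0 (1 - m\<^sup>2 * ((x - t) \<bullet> (x - t))) * (- (m\<^sup>2 * (2 * ((x - t) \<bullet> h))))) *\<^sub>R R t)) (at x within ball x0 1)"
        by (rule has_derivative_scaleR_left)
      then show ?thesis
        by (rule has_derivative_eq_rhs) (simp add: fun_eq_iff)
    qed
    show "?f x integrable_on cbox (-a) a" for x
      by (intro integrable_continuous continuous_intros continuous_on_compose2[OF continuous_on_bump[of UNIV]]
          nonexpansive_continuous[OF R]) auto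
    show "continuous_on (ball x0 1 \<times> cbox (-a) a) (\<lambda>(x, y). ?fx x y)"
      unfolding split_beta
      by (intro continuous_intros bounded_linear.continuous_on[OF bounded_linear_blinfun_scaleR_left]
          bounded_linear.continuous_on[OF bounded_linear_blinfun_inner_right]
          continuous_on_compose2[OF nonexpansive_continuous[OF R, of UNIV]]) auto
  qed auto
  then have "((\<lambda>x. integral (cbox (-a) a) (?f x)) has_derivative integral (cbox (-a) a) (?fx x0)) (at x0)"
    by (simp add: at_within_open[of x0 "ball x0 1"])
  then have "((\<lambda>x. (1 / (\<integral>w. bump m (w :: 'a) \<partial>lborel)) *\<^sub>R integral (cbox (-a) a) (?f x)) has_derivative
    (\<lambda>h. (1 / (\<integral>w. bump m (w :: 'a) \<partial>lborel)) *\<^sub>R integral (cbox (-a) a) (?fx x0) h)) (at x0)"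
    by (rule has_derivative_scaleR_right)
  then have "(mollify m R has_derivative (\<lambda>h. (1 / (\<integral>w. bump m (w :: 'a) \<partial>lborel)) *\<^sub>R integral (cbox (-a) a) (?fx x0) h)) (at x0)"
    by (rule has_derivative_transform_within_open[of _ _ _ _ "ball x0 1"]) (auto simp: mollify_def eq)
  then show thesis by (rule that)
qed

end


section \<open>Densities of the Steiner polynomial\<close>

lemma compact_support_bounded:
  fixes f :: "'a::euclidean_space \<Rightarrow> real"
  assumes "continuous_on UNIV f" "\<And>x. f x \<noteq> 0 \<Longrightarrow> norm x \<le> r"
  obtains M where "M \<ge> 0" "\<And>x. \<bar>f x\<bar> \<le> M"
proof -
  have "compact (f ` cball 0 r)"
    by (intro compact_continuous_image continuous_on_subset[OF assms(1)]) auto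
  then have "bounded (f ` cball 0 r)" by (rule compact_imp_bounded)
  then obtain M where M: "M > 0" "\<And>y. y \<in> f ` cball 0 r \<Longrightarrow> norm y \<le> M"
    by (auto simp: bounded_pos)
  have "\<bar>f x\<bar> \<le> M" for x
  proof (cases "f x = 0")
    case False
    then have "f x \<in> f ` cball 0 r" using assms(2) by simp
    then show ?thesis using M(2) by simp
  qed (use M in simp)
  then show thesis by (rule that[OF less_imp_le[OF M(1)]])
qed

lemma integrable_indicator_cball: "integrable lborel (\<lambda>w. M * indicator (cball (0::'a::euclidean_space) r) w :: real)"
  using emeasure_bounded_finite[of "cball (0::'a) r"]
  by (intro integrable_mult_right integrable_real_indicator) auto

lemma steiner_polynomial_wellorder:
  fixes R :: "real^'m::{finite,wellorder} \<Rightarrow> real^'m::_"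
  assumes R: "nonexpansive R"
    and f: "continuous_on UNIV f" "\<And>x. f x \<noteq> 0 \<Longrightarrow> norm x \<le> r" "\<And>x. f x \<ge> 0"
  shows "nonneg_polynomial CARD('m) (\<lambda>s. \<integral>w. f (parallel_inv R s w) \<partial>lborel)"
proof (rule nonneg_polynomial_LIMSEQ)
  let ?R = "\<lambda>k. mollify (real (Suc k)) R"
  have Rk: "nonexpansive (?R k)" for k by (rule nonexpansive_mollify[OF R]) simp
  show "nonneg_polynomial CARD('m) (\<lambda>s. \<integral>w. f (parallel_inv (?R k) s w) \<partial>lborel)" for k
  proof -
    have "\<exists>D. (?R k has_derivative D) (at z)" for z
      by (rule mollify_differentiable[OF R, of "real (Suc k)" z]) auto
    then obtain D where "\<And>z. (?R k has_derivative D z) (at z)" by metis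
    then show ?thesis by (rule steiner_polynomial_smooth[OF Rk _ f])
  qed
  fix s :: real assume s: "s > 0"
  obtain M where M: "M \<ge> 0" "\<And>x. \<bar>f x\<bar> \<le> M" using compact_support_bounded[OF f(1,2)] by blast
  have approx: "norm (?R k x - R x) \<le> 1 / real (Suc k)" for k x by (rule mollify_approx[OF R]) simp
  \<comment> \<open>One radius for all k: the mollification error at 0 is at most 1, so norm (?R k
    0) <= norm (R 0) + 1.\<close>
  define \<rho> where "\<rho> = max 1 s * r + \<bar>1 - s\<bar> / 2 * (norm (R 0) + 1)"
  have lim: "(\<lambda>k. ?R k x) \<longlonglongrightarrow> R x" for x
  proof (rule Lim_null[THEN iffD2], rule Lim_null_comparison)
    show "eventually (\<lambda>k. norm (?R k x - R x) \<le> 1 / real (Suc k)) sequentially"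
      using approx by (intro always_eventually allI)
    show "(\<lambda>k. 1 / real (Suc k)) \<longlonglongrightarrow> 0"
      using LIMSEQ_inverse_real_of_nat by (simp add: inverse_eq_divide)
  qed
  show "(\<lambda>k. \<integral>w. f (parallel_inv (?R k) s w) \<partial>lborel) \<longlonglongrightarrow> (\<integral>w. f (parallel_inv R s w) \<partial>lborel)"
  proof (rule integral_dominated_convergence[where w="\<lambda>w. M * indicator (cball 0 \<rho>) w"])
    show "(\<lambda>w. f (parallel_inv R s w)) \<in> borel_measurable lborel"
      using continuous_on_compose2[OF f(1) continuous_on_parallel_inv[OF R s, of UNIV]]
      by (auto intro: borel_measurable_continuous_onI)
    show "(\<lambda>w. f (parallel_inv (?R k) s w)) \<in> borel_measurable lborel" for k
      using continuous_on_compose2[OF f(1) continuous_on_parallel_inv[OF Rk s, of UNIV]]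
      by (auto intro: borel_measurable_continuous_onI)
    show "integrable lborel (\<lambda>w. M * indicator (cball 0 \<rho>) w)" by (rule integrable_indicator_cball)
    show "AE w in lborel. (\<lambda>k. f (parallel_inv (?R k) s w)) \<longlonglongrightarrow> f (parallel_inv R s w)"
    proof (rule AE_I2)
      fix w
      have "isCont f (parallel_inv R s w)" using f(1) by (simp add: continuous_on_eq_continuous_at)
      then show "(\<lambda>k. f (parallel_inv (?R k) s w)) \<longlonglongrightarrow> f (parallel_inv R s w)"
        by (rule isCont_tendsto_compose) (rule parallel_inv_LIMSEQ[OF R Rk s lim])
    qed
    show "AE w in lborel. norm (f (parallel_inv (?R k) s w)) \<le> M * indicator (cball 0 \<rho>) w" for k
    proof (rule AE_I2)
      fix w
      show "norm (f (parallel_inv (?R k) s w)) \<le> M * indicator (cball 0 \<rho>) w"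
      proof (cases "f (parallel_inv (?R k) s w) = 0")
        case False
        have "norm (?R k 0) \<le> norm (R 0) + norm (?R k 0 - R 0)"
          by (rule norm_triangle_sub)
        also have "norm (?R k 0 - R 0) \<le> 1"
          by (rule order_trans[OF approx]) simp
        finally have "norm (?R k 0) \<le> norm (R 0) + 1" by simp
        from parallel_inv_norm_bound[OF Rk s f(2)[OF False] this]
        have "w \<in> cball 0 \<rho>" by (simp add: \<rho>_def)
        then show ?thesis using M by simp
      qed (use M in auto)
    qed
  qed
qed

text \<open>\<open>reindex\<close> is a linear isometry that preserves Lebesgue measure, so
  conjugating \<open>R\<close> with it changes neither nonexpansiveness nor the integral.\<close>

lemma steiner_polynomial:
  fixes R :: "real^'n \<Rightarrow> real^'n"
  assumes R: "nonexpansive R"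
    and f: "continuous_on UNIV f" "\<And>x. f x \<noteq> 0 \<Longrightarrow> norm x \<le> r" "\<And>x. f x \<ge> 0"
  shows "nonneg_polynomial CARD('n) (\<lambda>s. \<integral>w. f (parallel_inv R s w) \<partial>lborel)"
proof -
  define R' where "R' = (\<lambda>x. reindex (R (unindex x)))"
  have R': "nonexpansive R'"
    unfolding nonexpansive_def
  proof (intro allI)
    fix x y
    have "R' x - R' y = reindex (R (unindex x) - R (unindex y))"
      by (simp add: R'_def linear_diff[OF linear_reindex(1)])
    then have "norm (R' x - R' y) \<le> norm (unindex x - unindex y)"
      using R[unfolded nonexpansive_def, rule_format, of "unindex x" "unindex y"] by simp
    also have "unindex x - unindex y = unindex (x - y)"
      by (rule linear_diff[OF linear_reindex(2), symmetric])
    finally show "norm (R' x - R' y) \<le> norm (x - y)" by simp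
  qed
  have "nonneg_polynomial CARD('n wellordered_copy) (\<lambda>s. \<integral>w. f (unindex (parallel_inv R' s w)) \<partial>lborel)"
  proof (rule steiner_polynomial_wellorder[OF R'])
    show "continuous_on UNIV (\<lambda>x. f (unindex x))"
      by (rule continuous_on_compose2[OF f(1) continuous_on_reindex(2)]) auto
    show "norm x \<le> r" if "f (unindex x) \<noteq> 0" for x using f(2)[OF that] by simp
    show "f (unindex x) \<ge> 0" for x by (rule f)
  qed
  moreover have "(\<integral>w. f (unindex (parallel_inv R' s w)) \<partial>lborel) = (\<integral>w. f (parallel_inv R s w) \<partial>lborel)"
    if s: "s > 0" for s
  proof -
    have map: "parallel_map R' s (reindex z) = reindex (parallel_map R s z)" for z
      by (simp add: parallel_map_def R'_def linear_add linear_cmul linear_reindex)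
    have "parallel_inv R' s (reindex w) = reindex (parallel_inv R s w)" for w
      using map[of "parallel_inv R s w"] parallel_inv_map[OF R' s, of "reindex (parallel_inv R s w)"] R s by simp
    moreover have "(\<lambda>w. f (unindex (parallel_inv R' s w))) \<in> borel_measurable borel"
      by (intro borel_measurable_continuous_onI continuous_on_compose2[OF f(1)]
         continuous_on_compose2[OF continuous_on_reindex(2)] continuous_on_parallel_inv[OF R' s]) auto
    ultimately show ?thesis
      by (subst lborel_distr_reindex[symmetric], subst integral_distr) auto
  qed
  ultimately show ?thesis
    unfolding nonneg_polynomial_def card_wellordered_copy by auto
qed

text \<open>Inner regularity: up to a null set, {g < 0} is a countable union of compact sets, and on
  each of these a negative function with nonnegative integral forces measure zero.\<close>

lemma AE_nonneg_of_compact_integrals: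
  fixes g :: "'a::euclidean_space \<Rightarrow> real"
  assumes [measurable]: "g \<in> borel_measurable borel"
    and int: "\<And>K. compact K \<Longrightarrow> integrable lborel (\<lambda>x. g x * indicator K x)"
    and nonneg: "\<And>K. compact K \<Longrightarrow> (\<integral>x. g x * indicator K x \<partial>lborel) \<ge> 0"
  shows "AE x in lborel. g x \<ge> 0"
proof -
  let ?N = "{x. g x < 0}"
  have "?N \<in> sets borel" by measurable
  then have "?N \<in> sets lebesgue" by simp
  then obtain C T where CT: "fsigma C" "T \<in> null_sets lebesgue" "C \<union> T = ?N" "disjnt C T"
    by (rule lebesgue_set_almost_fsigma)
  obtain F :: "nat \<Rightarrow> 'a set" where F: "range F \<subseteq> Collect compact" "C = \<Union>(range F)"
    using CT(1) fsigma_Union_compact by metis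
  have "F n \<in> null_sets lebesgue" for n
  proof -
    have K: "compact (F n)" using F by auto
    have neg: "g x < 0" if "x \<in> F n" for x using F CT that by auto
    have "(\<integral>x. - (g x * indicator (F n) x) \<partial>lborel) = 0"
    proof (rule antisym)
      show "(\<integral>x. - (g x * indicator (F n) x) \<partial>lborel) \<le> 0" using nonneg[OF K] by simp
      show "0 \<le> (\<integral>x. - (g x * indicator (F n) x) \<partial>lborel)"
        by (rule Bochner_Integration.integral_nonneg) (use neg in \<open>auto simp: indicator_def less_imp_le\<close>)
    qed
    then have "AE x in lborel. - (g x * indicator (F n) x) = 0"
      by (subst (asm) integral_nonneg_eq_0_iff_AE)
        (use neg int[OF K] in \<open>auto simp: indicator_def less_imp_le\<close>)
    then have "AE x in lborel. x \<notin> F n"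
      by eventually_elim (use neg in \<open>force simp: indicator_def split: if_splits\<close>)
    then have "AE x in lebesgue. x \<notin> F n" by (rule AE_completion)
    then show ?thesis using K by (subst AE_iff_null_sets) (auto simp: borel_compact)
  qed
  then have "C \<in> null_sets lebesgue" unfolding F by (rule null_sets_UN)
  then have "?N \<in> null_sets lebesgue" using CT by (metis null_sets.Un)
  then have "?N \<in> null_sets lborel"
    using \<open>?N \<in> sets borel\<close> by (simp add: null_sets_def)
  then have "AE x in lborel. x \<notin> ?N" by (rule AE_not_in)
  then show ?thesis by eventually_elim auto
qed

section \<open>Image of Lebesgue measure under the inverse parallel map\<close>

context
  fixes R :: "real^'n \<Rightarrow> real^'n"
  assumes R: "nonexpansive R"
begin

lemma measurable_parallel_inv: "s > 0 \<Longrightarrow> parallel_inv R s \<in> borel_measurable borel"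
  by (intro borel_measurable_continuous_onI continuous_on_parallel_inv R)

lemma parallel_inv_vimage: "s > 0 \<Longrightarrow> parallel_inv R s -` A = parallel_map R s ` A"
  by (auto simp: R intro: image_eqI[of _ _ "parallel_inv R s _"])

lemma emeasure_parallel:
  assumes "s > 0" "A \<in> sets borel"
  shows "emeasure (distr lborel borel (parallel_inv R s)) A = emeasure lborel (parallel_map R s ` A)"
  using assms measurable_parallel_inv[OF assms(1)]
  by (subst emeasure_distr) (auto simp: parallel_inv_vimage)

lemma emeasure_parallel_finite:
  assumes s: "s > 0" and "A \<in> sets borel" "bounded A"
  shows "emeasure (distr lborel borel (parallel_inv R s)) A < \<infinity>"
proof -
  obtain r where r: "\<And>x. x \<in> A \<Longrightarrow> norm x \<le> r" using \<open>bounded A\<close> by (auto simp: bounded_iff)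
  have "bounded (parallel_map R s ` A)"
    unfolding bounded_iff
    using parallel_inv_norm_bound[OF R s _ order_refl, of "parallel_map R s _" r] r R s
    by (intro exI[of _ "max 1 s * r + \<bar>1 - s\<bar> / 2 * norm (R 0)"]) auto
  then show ?thesis
    unfolding emeasure_parallel[OF assms(1,2)] by (rule emeasure_bounded_finite)
qed

lemma absolutely_continuous_parallel:
  assumes s: "s > 0"
  shows "absolutely_continuous lborel (distr lborel borel (parallel_inv R s))"
  unfolding absolutely_continuous_def
proof
  fix A :: "(real^'n) set" assume A: "A \<in> null_sets lborel"
  then have Ab: "A \<in> sets borel" by auto
  have "negligible A"
    using A by (simp add: negligible_iff_null_sets null_sets_completionI)
  then have "negligible (parallel_map R s ` A)"
  proof (rule negligible_locally_Lipschitz_image[OF order_refl])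
    fix x :: "real^'n"
    show "\<exists>T B. open T \<and> x \<in> T \<and> (\<forall>y\<in>A \<inter> T. norm (parallel_map R s y - parallel_map R s x) \<le> B * norm (y - x))"
      using parallel_map_upper[OF R s] by (intro exI[of _ UNIV] exI[of _ "max 1 s"]) auto
  qed
  moreover have "parallel_map R s ` A \<in> sets borel"
    using measurable_sets_borel[OF measurable_parallel_inv[OF s] Ab] by (simp add: parallel_inv_vimage s)
  ultimately have "emeasure lborel (parallel_map R s ` A) = 0"
    by (simp add: negligible_iff_emeasure0)
  then show "A \<in> null_sets (distr lborel borel (parallel_inv R s))"
    using Ab emeasure_parallel[OF s Ab] by (intro null_setsI) auto
qed

text \<open>Radon-Nikodym, since Lipschitz maps preserve null sets. The derivative is finite almost
  everywhere because balls have finite image measure.\<close>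

lemma parallel_density:
  assumes s: "s > 0"
  obtains h where "h \<in> borel_measurable borel" "\<And>x. h x \<ge> 0"
    "distr lborel borel (parallel_inv R s) = density lborel (\<lambda>x. ennreal (h x))"
proof -
  let ?N = "distr lborel borel (parallel_inv R s)" and ?D = "RN_deriv lborel (distr lborel borel (parallel_inv R s))"
  have "sigma_finite_measure ?N"
  proof
    show "\<exists>A. countable A \<and> A \<subseteq> sets ?N \<and> \<Union>A = space ?N \<and> (\<forall>a\<in>A. emeasure ?N a \<noteq> \<infinity>)"
    proof (intro exI conjI)
      let ?A = "range (\<lambda>n::nat. cball (0::real^'n) (real n))"
      show "countable ?A" by simp
      show "?A \<subseteq> sets ?N" by auto
      show "\<Union>?A = space ?N" by (auto simp: real_arch_simple)
      show "\<forall>a\<in>?A. emeasure ?N a \<noteq> \<infinity>"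
        using emeasure_parallel_finite[OF s] by (auto simp: less_top[symmetric])
    qed
  qed
  then have fin: "AE x in lborel. ?D x \<noteq> \<infinity>"
    using absolutely_continuous_parallel[OF s] by (intro sigma_finite_measure.RN_deriv_finite[OF sigma_finite_lborel]) auto
  have "?N = density lborel ?D"
    using absolutely_continuous_parallel[OF s] by (intro sigma_finite_measure.density_RN_deriv[OF sigma_finite_lborel, symmetric]) auto
  also have "\<dots> = density lborel (\<lambda>x. ennreal (enn2real (?D x)))"
  proof (rule density_cong)
    show "AE x in lborel. ?D x = ennreal (enn2real (?D x))"
      using fin by eventually_elim (simp add: ennreal_enn2real_if)
  qed auto
  finally have "?N = density lborel (\<lambda>x. ennreal (enn2real (?D x)))" .
  then show thesis by (intro that[of "\<lambda>x. enn2real (?D x)"]) auto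
qed

lemma steiner_polynomial_compact:
  assumes K: "compact K"
  shows "nonneg_polynomial CARD('n) (\<lambda>s. measure (distr lborel borel (parallel_inv R s)) K)"
\<comment> \<open>\<open>infdist\<close> to the empty set is 0 by convention, so the cut-off
  functions below would be constantly 1.\<close>
proof (cases "K = {}")
  case True
  then show ?thesis unfolding nonneg_polynomial_def by (intro exI[of _ "\<lambda>_. 0"]) simp
next
  case False
  obtain r where r: "\<And>x. x \<in> K \<Longrightarrow> norm x \<le> r"
    using compact_imp_bounded[OF K] by (auto simp: bounded_iff)
  \<comment> \<open>Continuous functions decreasing to the indicator of \<open>K\<close>, supported
    within distance 1 of \<open>K\<close>.\<close>
  define f :: "nat \<Rightarrow> real^'n \<Rightarrow> real" where "f k x = max 0 (1 - real (Suc k) * infdist x K)" for k x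
  have cont: "continuous_on UNIV (f k)" for k
    unfolding f_def by (intro continuous_intros)
  have supp: "norm x \<le> r + 1" if "f k x \<noteq> 0" for k x
  proof -
    have "real (Suc k) * infdist x K < 1" using that by (auto simp: f_def max_def split: if_splits)
    moreover have "1 * infdist x K \<le> real (Suc k) * infdist x K"
      by (intro mult_right_mono) (auto simp: infdist_nonneg)
    ultimately have "infdist x K < 1" by simp
    moreover obtain y where "y \<in> K" "infdist x K = dist x y"
      using infdist_attains_inf[OF compact_imp_closed[OF K] False] by blast
    ultimately show ?thesis using r[of y] norm_triangle_ineq[of y "x - y"] by (simp add: dist_norm)
  qed
  have lim: "(\<lambda>k. f k x) \<longlonglongrightarrow> indicator K x" for x
  proof (cases "x \<in> K")
    case True
    then show ?thesis by (simp add: f_def)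
  next
    case x: False
    then have pos: "infdist x K > 0"
      using in_closed_iff_infdist_zero[OF compact_imp_closed[OF K] False, of x] infdist_nonneg[of x K] by auto
    obtain N :: nat where "1 / infdist x K < real N" using reals_Archimedean2 by blast
    then have N: "1 < real N * infdist x K" using pos by (simp add: field_simps)
    have "f k x = 0" if "k \<ge> N" for k
    proof -
      have "real N * infdist x K \<le> real (Suc k) * infdist x K"
        using that pos by (intro mult_right_mono) auto
      then show ?thesis using N by (simp add: f_def)
    qed
    then have "(\<lambda>k. f k x) \<longlonglongrightarrow> 0"
      by (intro tendsto_eventually) (auto simp: eventually_sequentially intro!: exI[of _ N])
    then show ?thesis using x by simp
  qed
  show ?thesis
  proof (rule nonneg_polynomial_LIMSEQ)
    show "nonneg_polynomial CARD('n) (\<lambda>s. \<integral>w. f k (parallel_inv R s w) \<partial>lborel)" for k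
      by (rule steiner_polynomial[OF R cont supp]) (auto simp: f_def)
    fix s :: real assume s: "s > 0"
    let ?N = "distr lborel borel (parallel_inv R s)"
    have eq: "(\<integral>w. f k (parallel_inv R s w) \<partial>lborel) = (\<integral>z. f k z \<partial>?N)" for k
      using measurable_parallel_inv[OF s] cont by (subst integral_distr) (auto intro: borel_measurable_continuous_onI)
    have "(\<lambda>k. \<integral>z. f k z \<partial>?N) \<longlonglongrightarrow> (\<integral>z. indicator K z \<partial>?N)"
    proof (rule integral_dominated_convergence[where w="indicator (cball 0 (r + 1))"])
      show "integrable ?N (indicator (cball 0 (r + 1)) :: _ \<Rightarrow> real)"
        using emeasure_parallel_finite[OF s, of "cball 0 (r + 1)"] by (intro integrable_real_indicator) auto
      show "AE x in ?N. norm (f k x) \<le> indicator (cball 0 (r + 1)) x" for k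
      proof (rule AE_I2)
        fix x
        show "norm (f k x) \<le> indicator (cball 0 (r + 1)) x"
          using supp[of k x] infdist_nonneg[of x K] by (cases "f k x = 0") (auto simp: f_def)
      qed
      show "f k \<in> borel_measurable ?N" for k
        using cont by (auto intro: borel_measurable_continuous_onI)
      show "(indicator K :: _ \<Rightarrow> real) \<in> borel_measurable ?N"
        using K by (auto intro!: borel_measurable_indicator simp: borel_compact)
    qed (use lim in simp)
    then show "(\<lambda>k. \<integral>w. f k (parallel_inv R s w) \<partial>lborel) \<longlonglongrightarrow> measure ?N K"
      using K by (simp add: eq borel_compact)
  qed
qed

text \<open>The polynomial identity is known for the measure of each compact set and has to become
  one for densities. The functions \<open>g i\<close> interpolate the densities at s = 1, ..., n +
  1; sign and identity then follow almost everywhere by testing on compact sets. The exceptional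
  null set may depend on s, which an equality of measures for each single s tolerates.\<close>

lemma steiner_densities:
  obtains g :: "nat \<Rightarrow> real^'n \<Rightarrow> real"
  where "\<And>i. g i \<in> borel_measurable borel" "\<And>i x. g i x \<ge> 0"
    "\<And>s. s > 0 \<Longrightarrow> distr lborel borel (parallel_inv R s) =
       density lborel (\<lambda>z. ennreal (\<Sum>i\<le>CARD('n). g i z * s ^ i))"
proof -
  let ?n = "CARD('n)" and ?N = "\<lambda>s. distr lborel borel (parallel_inv R s)"
  have "\<exists>h. h \<in> borel_measurable borel \<and> (\<forall>x. h x \<ge> 0) \<and> ?N s = density lborel (\<lambda>x. ennreal (h x))"
    if "s > 0" for s
    by (rule parallel_density[OF that]) blast
  then obtain h where h[measurable]: "\<And>s. s > 0 \<Longrightarrow> h s \<in> borel_measurable borel"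
    and h0: "\<And>s x. s > 0 \<Longrightarrow> h s x \<ge> 0" and hN: "\<And>s. s > 0 \<Longrightarrow> ?N s = density lborel (\<lambda>x. ennreal (h s x))"
    by metis
  have hK: "has_bochner_integral lborel (\<lambda>x. h s x * indicator K x) (measure (?N s) K)"
    if s: "s > 0" and K: "compact K" for s K
  proof (rule has_bochner_integral_nn_integral)
    have [measurable]: "h s \<in> borel_measurable borel" "K \<in> sets borel"
      using h s K by (auto simp: borel_compact)
    show "(\<lambda>x. h s x * indicator K x) \<in> borel_measurable lborel" by measurable
    show "AE x in lborel. 0 \<le> h s x * indicator K x" using h0[OF s] by simp
    have "ennreal (measure (?N s) K) = emeasure (?N s) K"
      using emeasure_parallel_finite[OF s, of K] K
      by (intro emeasure_eq_ennreal_measure[symmetric]) (auto simp: borel_compact compact_imp_bounded)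
    also have "\<dots> = (\<integral>\<^sup>+x. ennreal (h s x) * indicator K x \<partial>lborel)"
      unfolding hN[OF s] by (subst emeasure_density) auto
    also have "\<dots> = (\<integral>\<^sup>+x. ennreal (h s x * indicator K x) \<partial>lborel)"
      by (intro nn_integral_cong) (auto simp: indicator_def)
    finally show "(\<integral>\<^sup>+x. ennreal (h s x * indicator K x) \<partial>lborel) = ennreal (measure (?N s) K)" ..
  qed simp
  obtain a :: "nat \<Rightarrow> nat \<Rightarrow> real"
    where a: "\<And>c i. i \<le> ?n \<Longrightarrow> c i = (\<Sum>j\<in>{1..Suc ?n}. a i j * (\<Sum>l\<le>?n. c l * real j ^ l))"
    using interpolation_coefficients by blast
  define g where "g i x = (\<Sum>j\<in>{1..Suc ?n}. a i j * h (real j) x)" for i x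
  have g[measurable]: "g i \<in> borel_measurable borel" for i
    unfolding g_def by (intro borel_measurable_sum borel_measurable_times borel_measurable_const h) auto
  have gK: "has_bochner_integral lborel (\<lambda>x. g i x * indicator K x)
      (\<Sum>j\<in>{1..Suc ?n}. a i j * measure (?N (real j)) K)" if K: "compact K" for i K
    unfolding g_def sum_distrib_right mult.assoc
    by (intro has_bochner_integral_sum has_bochner_integral_mult_right hK K) auto
  have poly: "(\<Sum>j\<in>{1..Suc ?n}. a i j * measure (?N (real j)) K) \<ge> 0" (is ?A)
    "s > 0 \<Longrightarrow> measure (?N s) K = (\<Sum>l\<le>?n. (\<Sum>j\<in>{1..Suc ?n}. a l j * measure (?N (real j)) K) * s ^ l)" (is "_ \<Longrightarrow> ?B")
    if K: "compact K" and i: "i \<le> ?n" for i K s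
  proof -
    obtain c where c: "\<And>i. c i \<ge> 0" "\<And>s. s > 0 \<Longrightarrow> measure (?N s) K = (\<Sum>l\<le>?n. c l * s ^ l)"
      using steiner_polynomial_compact[OF K] unfolding nonneg_polynomial_def by blast
    have ca: "c i = (\<Sum>j\<in>{1..Suc ?n}. a i j * measure (?N (real j)) K)" if "i \<le> ?n" for i
      unfolding a[OF that, of c] by (intro sum.cong refl arg_cong2[where f="(*)"] c(2)[symmetric]) auto
    show ?A using ca[OF i] c(1)[of i] by simp
    show ?B if "s > 0" unfolding c(2)[OF that] by (intro sum.cong refl) (simp add: ca)
  qed
  have g0: "AE x in lborel. g i x \<ge> 0" if "i \<le> ?n" for i
    using poly(1)[OF _ that] gK
    by (intro AE_nonneg_of_compact_integrals) (auto simp: has_bochner_integral_iff)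
  have hg: "AE x in lborel. h s x = (\<Sum>i\<le>?n. g i x * s ^ i)" if s: "s > 0" for s
  proof -
    have [measurable]: "h s \<in> borel_measurable borel" using h s by auto
    have gs: "has_bochner_integral lborel (\<lambda>x. (\<Sum>i\<le>?n. g i x * s ^ i) * indicator K x) (measure (?N s) K)"
      if K: "compact K" for K
    proof -
      have "has_bochner_integral lborel (\<lambda>x. \<Sum>i\<le>?n. (g i x * indicator K x) * s ^ i)
        (\<Sum>l\<le>?n. (\<Sum>j\<in>{1..Suc ?n}. a l j * measure (?N (real j)) K) * s ^ l)"
        by (intro has_bochner_integral_sum has_bochner_integral_mult_left gK K)
      then show ?thesis
        unfolding poly(2)[OF K order_refl s] by (simp add: sum_distrib_right sum_distrib_left mult_ac)
    qed
    have "AE x in lborel. h s x - (\<Sum>i\<le>?n. g i x * s ^ i) \<ge> 0"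
      using has_bochner_integral_diff[OF hK[OF s] gs]
      by (intro AE_nonneg_of_compact_integrals) (auto simp: left_diff_distrib has_bochner_integral_iff)
    moreover have "AE x in lborel. (\<Sum>i\<le>?n. g i x * s ^ i) - h s x \<ge> 0"
      using has_bochner_integral_diff[OF gs hK[OF s]]
      by (intro AE_nonneg_of_compact_integrals) (auto simp: left_diff_distrib has_bochner_integral_iff)
    ultimately show ?thesis by eventually_elim simp
  qed
  show thesis
  \<comment> \<open>Truncation turns nonnegativity almost everywhere into nonnegativity everywhere
    without changing the measures.\<close>
  proof (rule that[of "\<lambda>i x. max 0 (g i x)"])
    fix s :: real assume s: "s > 0"
    have [measurable]: "h s \<in> borel_measurable borel" using h s by auto
    have "AE x in lborel. \<forall>i\<in>{..?n}. g i x \<ge> 0" using g0 by (intro AE_finite_allI) auto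
    then have "AE x in lborel. ennreal (h s x) = ennreal (\<Sum>i\<le>?n. max 0 (g i x) * s ^ i)"
      using hg[OF s] by eventually_elim (auto intro!: arg_cong[where f=ennreal] sum.cong simp: max_def)
    then show "?N s = density lborel (\<lambda>x. ennreal (\<Sum>i\<le>?n. max 0 (g i x) * s ^ i))"
      unfolding hN[OF s] by (intro density_cong) auto
  qed auto
qed

end


section \<open>Subdifferentials and proximal maps\<close>

lemma Conv_continuous: "v \<in> Conv \<Longrightarrow> continuous_on S v"
  using convex_on_continuous[OF open_UNIV, of v] by (auto simp: Conv_def intro: continuous_on_subset)

lemma Conv_ineq:
  assumes "v \<in> Conv" "0 \<le> t" "t \<le> 1"
  shows "v ((1 - t) *\<^sub>R x + t *\<^sub>R y) \<le> (1 - t) * v x + t * v y"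
  using assms convex_onD[of UNIV v t x y] by (simp add: Conv_def)

lemma ConvI:
  assumes "\<And>x y t. 0 < t \<Longrightarrow> t < 1 \<Longrightarrow> v ((1 - t) *\<^sub>R x + t *\<^sub>R y) \<le> (1 - t) * v x + t * v y"
  shows "v \<in> Conv"
  unfolding Conv_def using assms by (auto intro!: convex_onI)

lemma Conv_scale: "v \<in> Conv \<Longrightarrow> c \<ge> 0 \<Longrightarrow> (\<lambda>x. c * v x) \<in> Conv"
  by (auto simp: Conv_def intro: convex_on_cmul)

lemma Conv_add: "u \<in> Conv \<Longrightarrow> v \<in> Conv \<Longrightarrow> (\<lambda>x. u x + v x) \<in> Conv"
  by (auto simp: Conv_def intro: convex_on_add)

lemma Conv_linear: "linear l \<Longrightarrow> l \<in> Conv"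
  by (rule ConvI) (simp add: linear_add linear_cmul)

lemma Conv_const: "(\<lambda>x. c) \<in> Conv"
  by (rule ConvI) (simp add: algebra_simps)

lemma Conv_max: "u \<in> Conv \<Longrightarrow> v \<in> Conv \<Longrightarrow> (\<lambda>x. max (u x) (v x)) \<in> Conv"
proof (rule ConvI)
  fix x y and t :: real assume "u \<in> Conv" "v \<in> Conv" "0 < t" "t < 1"
  then have "u ((1 - t) *\<^sub>R x + t *\<^sub>R y) \<le> (1 - t) * u x + t * u y"
    "v ((1 - t) *\<^sub>R x + t *\<^sub>R y) \<le> (1 - t) * v x + t * v y"
    by (auto intro: Conv_ineq)
  moreover have "(1 - t) * u x \<le> (1 - t) * max (u x) (v x)" "t * u y \<le> t * max (u y) (v y)"
    "(1 - t) * v x \<le> (1 - t) * max (u x) (v x)" "t * v y \<le> t * max (u y) (v y)"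
    using \<open>0 < t\<close> \<open>t < 1\<close> by (auto intro!: mult_left_mono)
  ultimately show "max (u ((1 - t) *\<^sub>R x + t *\<^sub>R y)) (v ((1 - t) *\<^sub>R x + t *\<^sub>R y)) \<le>
      (1 - t) * max (u x) (v x) + t * max (u y) (v y)"
    by linarith
qed

text \<open>Separates the point (x, v x) from the strict epigraph. The separating normal is not
  horizontal because v is finite on the whole space; scaling its vertical component to -1 leaves the
  subgradient.\<close>

lemma subdifferential_nonempty:
  fixes v :: "real^'n \<Rightarrow> real"
  assumes v: "v \<in> Conv"
  shows "\<exists>y. y \<in> subdifferential v x"
proof -
  let ?S = "{p :: (real^'n) \<times> real. v (fst p) < snd p}"
  have "convex ?S"
  proof (rule convexI)
    fix p q :: "(real^'n) \<times> real" and a b :: real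
    assume pq: "p \<in> ?S" "q \<in> ?S" and ab: "0 \<le> a" "0 \<le> b" "a + b = 1"
    then have a: "a = 1 - b" and b: "b \<le> 1" by auto
    have "v (a *\<^sub>R fst p + b *\<^sub>R fst q) \<le> a * v (fst p) + b * v (fst q)"
      unfolding a using v ab(2) b by (rule Conv_ineq)
    also have "\<dots> < a * snd p + b * snd q"
    proof (cases "a = 0")
      case False
      then show ?thesis using pq ab
        by (intro add_less_le_mono mult_strict_left_mono mult_left_mono) auto
    qed (use pq ab in auto)
    finally show "a *\<^sub>R p + b *\<^sub>R q \<in> ?S" by simp
  qed
  moreover have "(x, v x + 1) \<in> ?S" by simp
  then have "?S \<noteq> {}" by blast
  moreover have "?S \<inter> {(x, v x)} = {}" by auto
  ultimately obtain a b where "a \<noteq> 0" "\<forall>p\<in>?S. a \<bullet> p \<le> b" "\<forall>p\<in>{(x, v x)}. a \<bullet> p \<ge> b"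
    using separating_hyperplane_sets[OF _ convex_singleton, of ?S "(x, v x)"] by blast
  then have a: "a \<noteq> 0" "\<And>p. p \<in> ?S \<Longrightarrow> a \<bullet> p \<le> b" "a \<bullet> (x, v x) \<ge> b" by auto
  obtain p q where pq: "a = (p, q)" by (cases a)
  have le: "p \<bullet> z + q * t \<le> p \<bullet> x + q * v x" if "v z < t" for z t
    using a(2)[of "(z, t)"] a(3) that pq by simp
  have "q \<le> 0" using le[of x "v x + 1"] by (simp add: algebra_simps)
  moreover have "q \<noteq> 0"
  proof
    assume "q = 0"
    then have "p \<bullet> p \<le> 0" using le[of "x + p" "v (x + p) + 1"] by (simp add: inner_add_right)
    then have "p = 0" by (metis inner_eq_zero_iff inner_ge_zero order_antisym)
    then show False using a(1) pq \<open>q = 0\<close> by (simp add: zero_prod_def)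
  qed
  ultimately have q: "- q > 0" by simp
  have "v z \<ge> v x + (z - x) \<bullet> (p /\<^sub>R (- q))" for z
  proof (rule field_le_epsilon)
    fix e :: real assume "e > 0"
    then have "p \<bullet> z + q * (v z + e) \<le> p \<bullet> x + q * v x" by (intro le) simp
    then have "(z - x) \<bullet> p \<le> (v z + e - v x) * (- q)"
      by (simp add: algebra_simps inner_diff_left inner_commute)
    then have "((z - x) \<bullet> p) / (- q) \<le> v z + e - v x" by (subst pos_divide_le_eq[OF q])
    then show "v x + (z - x) \<bullet> (p /\<^sub>R (- q)) \<le> v z + e" by (simp add: divide_inverse mult.commute)
  qed
  then show ?thesis unfolding subdifferential_def by blast
qed

lemma subdifferential_monotone:
  assumes "y1 \<in> subdifferential v x1" "y2 \<in> subdifferential v x2"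
  shows "(x1 - x2) \<bullet> (y1 - y2) \<ge> 0"
proof -
  have "v x2 \<ge> v x1 + (x2 - x1) \<bullet> y1" "v x1 \<ge> v x2 + (x1 - x2) \<bullet> y2"
    using assms unfolding subdifferential_def by auto
  then show ?thesis by (simp add: inner_diff_left inner_diff_right)
qed

text \<open>The subgradient inequality is tested at distance 1 from x in the direction of y.\<close>

lemma subdifferential_bounded:
  assumes "y \<in> subdifferential v x" "norm x \<le> r" "\<And>z. norm z \<le> r + 1 \<Longrightarrow> \<bar>v z\<bar> \<le> M"
  shows "norm y \<le> 2 * M"
proof (cases "y = 0")
  case True
  have "\<bar>v x\<bar> \<le> M" using assms by auto
  then show ?thesis using True by auto
next
  case False
  let ?z = "x + y /\<^sub>R norm y"
  have "norm ?z \<le> norm x + norm (y /\<^sub>R norm y)" by (rule norm_triangle_ineq)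
  then have "norm ?z \<le> r + 1" using False assms by simp
  then have "\<bar>v ?z\<bar> \<le> M" "\<bar>v x\<bar> \<le> M" using assms by auto
  moreover have "v ?z \<ge> v x + (?z - x) \<bullet> y" using assms unfolding subdifferential_def by blast
  moreover have "(?z - x) \<bullet> y = norm y"
    using False by (simp add: dot_square_norm power2_eq_square)
  ultimately show ?thesis by linarith
qed

lemma Conv_bounded_on_ball:
  assumes "v \<in> Conv"
  obtains M where "\<And>z. norm z \<le> r \<Longrightarrow> \<bar>v z\<bar> \<le> M"
proof -
  have "compact (v ` cball 0 r)"
    by (intro compact_continuous_image Conv_continuous assms) auto
  then have "bounded (v ` cball 0 r)" by (rule compact_imp_bounded)
  then obtain M where "\<And>y. y \<in> v ` cball 0 r \<Longrightarrow> norm y \<le> M" by (auto simp: bounded_iff)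
  then show thesis by (intro that[of M]) auto
qed

text \<open>The resolvent of the subdifferential rather than a minimiser, because the graph of the
  subdifferential is to be parametrised. The variational description is recovered in
  \<open>prox_strong_minimum\<close>.\<close>

definition prox :: "(real^'n \<Rightarrow> real) \<Rightarrow> real^'n \<Rightarrow> real^'n" where
  "prox v w = (SOME x. w - x \<in> subdifferential v x)"

lemma prox_ex:
  assumes v: "v \<in> Conv"
  shows "\<exists>x. w - x \<in> subdifferential v x"
proof -
  obtain p where p: "p \<in> subdifferential v w" using subdifferential_nonempty[OF v] by blast
  let ?f = "\<lambda>x. v x + (norm (x - w))\<^sup>2 / 2"
  \<comment> \<open>Outside this ball the quadratic term outweighs the affine minorant of v with
    slope p, so \<open>?f\<close> does not fall below its value at w.\<close>
  have "continuous_on (cball w (2 * norm p)) ?f"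
    by (intro continuous_intros Conv_continuous v) auto
  then obtain x where x: "x \<in> cball w (2 * norm p)" "\<And>z. z \<in> cball w (2 * norm p) \<Longrightarrow> ?f x \<le> ?f z"
    using continuous_attains_inf[of "cball w (2 * norm p)" ?f] by auto
  have min: "?f x \<le> ?f z" for z
  proof (cases "z \<in> cball w (2 * norm p)")
    case False
    have "- (norm (z - w) * norm p) \<le> (z - w) \<bullet> p"
      using Cauchy_Schwarz_ineq2[of "z - w" p] by linarith
    moreover have "v z \<ge> v w + (z - w) \<bullet> p" using p unfolding subdifferential_def by blast
    moreover have "norm (z - w) * norm p \<le> norm (z - w) * (norm (z - w) / 2)"
      using False by (intro mult_left_mono) (auto simp: dist_norm norm_minus_commute)
    ultimately have "v w \<le> ?f z" by (simp add: power2_eq_square)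
    moreover have "?f x \<le> ?f w" using x(2)[of w] by simp
    ultimately show ?thesis by simp
  qed (rule x)
  have "v z \<ge> v x + (z - x) \<bullet> (w - x)" for z
  proof (rule field_le_epsilon)
    fix e :: real assume "e > 0"
    \<comment> \<open>Comparing x with the point (1 - t) x + t z leaves the error t |z - x|^2 / 2,
      and this t makes it at most e.\<close>
    define t where "t = min 1 (2 * e / ((norm (z - x))\<^sup>2 + 1))"
    have N: "(norm (z - x))\<^sup>2 + 1 > 0" by (simp add: add_nonneg_pos)
    have t: "t > 0" "t \<le> 1" using \<open>e > 0\<close> N by (auto simp: t_def)
    have "t * ((norm (z - x))\<^sup>2 + 1) \<le> 2 * e / ((norm (z - x))\<^sup>2 + 1) * ((norm (z - x))\<^sup>2 + 1)"
      using N by (intro mult_right_mono) (auto simp: t_def)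
    also have "\<dots> = 2 * e" using N by simp
    finally have te: "t * (norm (z - x))\<^sup>2 \<le> 2 * e" using t by (simp add: algebra_simps)
    have arith: "0 \<le> t * (b - a + i + t * c / 2)"
      if "a + A / 2 \<le> (1 - t) * a + t * b + (A + 2 * t * i + t\<^sup>2 * c) / 2" for a b c i A :: real
      using that by (simp add: field_simps power2_eq_square)
    have "?f x \<le> ?f ((1 - t) *\<^sub>R x + t *\<^sub>R z)" by (rule min)
    also have "\<dots> \<le> (1 - t) * v x + t * v z + (norm ((x - w) + t *\<^sub>R (z - x)))\<^sup>2 / 2"
      using Conv_ineq[OF v, of t x z] t by (simp add: algebra_simps)
    also have "(norm ((x - w) + t *\<^sub>R (z - x)))\<^sup>2 = (norm (x - w))\<^sup>2 + 2 * t * ((x - w) \<bullet> (z - x)) + t\<^sup>2 * (norm (z - x))\<^sup>2"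
      unfolding power2_norm_eq_inner
      by (simp add: inner_add_left inner_add_right inner_commute power2_eq_square algebra_simps)
    finally have "0 \<le> t * (v z - v x + (x - w) \<bullet> (z - x) + t * (norm (z - x))\<^sup>2 / 2)"
      by (rule arith)
    then have "0 \<le> v z - v x + (x - w) \<bullet> (z - x) + t * (norm (z - x))\<^sup>2 / 2"
      using t by (simp add: zero_le_mult_iff)
    then show "v x + (z - x) \<bullet> (w - x) \<le> v z + e"
      using te by (simp add: inner_diff_left inner_diff_right inner_commute)
  qed
  then show ?thesis unfolding subdifferential_def by blast
qed

lemma prox_subdifferential: "v \<in> Conv \<Longrightarrow> w - prox v w \<in> subdifferential v (prox v w)"
  unfolding prox_def by (rule someI_ex) (rule prox_ex)

lemma prox_eqI:
  assumes v: "v \<in> Conv" and x: "w - x \<in> subdifferential v x"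
  shows "prox v w = x"
proof -
  have "(prox v w - x) \<bullet> ((w - prox v w) - (w - x)) \<ge> 0"
    by (rule subdifferential_monotone[OF prox_subdifferential[OF v] x])
  also have "(w - prox v w) - (w - x) = - (prox v w - x)" by simp
  finally have "(prox v w - x) \<bullet> (prox v w - x) \<le> 0" by (simp only: inner_minus_right)
  then have "prox v w - x = 0" by (metis inner_eq_zero_iff inner_ge_zero order_antisym)
  then show ?thesis by simp
qed

definition prox_reflection :: "(real^'n \<Rightarrow> real) \<Rightarrow> real^'n \<Rightarrow> real^'n" where
  "prox_reflection v z = 2 *\<^sub>R prox v z - z"

text \<open>Monotonicity says that the increment x of the resolvent and the increment y of its
  complement have a nonnegative inner product, which is equivalent to |x - y| <= |x + y|.\<close>

lemma nonexpansive_prox_reflection: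
  assumes v: "v \<in> Conv"
  shows "nonexpansive (prox_reflection v)"
  unfolding nonexpansive_def
proof (intro allI)
  fix z1 z2
  define x y where "x = prox v z1 - prox v z2" and "y = (z1 - prox v z1) - (z2 - prox v z2)"
  have "x \<bullet> y \<ge> 0" unfolding x_def y_def
    by (rule subdifferential_monotone[OF prox_subdifferential[OF v] prox_subdifferential[OF v]])
  then have "(norm (x - y))\<^sup>2 \<le> (norm (x + y))\<^sup>2"
    unfolding power2_norm_eq_inner by (simp add: inner_diff_left inner_diff_right inner_add_left inner_add_right inner_commute)
  then have "norm (x - y) \<le> norm (x + y)" by (rule power2_le_imp_le) simp
  moreover have "x - y = prox_reflection v z1 - prox_reflection v z2" "x + y = z1 - z2"
    by (simp_all add: x_def y_def prox_reflection_def scaleR_2)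
  ultimately show "norm (prox_reflection v z1 - prox_reflection v z2) \<le> norm (z1 - z2)" by simp
qed

lemma parallel_map_prox: "parallel_map (prox_reflection v) s z = prox v z + s *\<^sub>R (z - prox v z)"
  by (simp add: parallel_map_def prox_reflection_def vec_eq_iff field_simps)

text \<open>Scaling v by s multiplies a subgradient y at x by s and so moves x + y to x + s y, which
  is what \<open>parallel_map\<close> does. All resolvents of multiples of v are therefore governed
  by the single map \<open>prox_reflection v\<close>.\<close>

lemma prox_scaled:
  assumes v: "v \<in> Conv" and s: "s > 0"
  shows "prox (\<lambda>x. s * v x) w = prox v (parallel_inv (prox_reflection v) s w)"
proof (rule prox_eqI)
  let ?z = "parallel_inv (prox_reflection v) s w"
  show "(\<lambda>x. s * v x) \<in> Conv" using v s by (intro Conv_scale) auto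
  have "w = parallel_map (prox_reflection v) s ?z"
    using nonexpansive_prox_reflection[OF v] s by simp
  then have w: "w - prox v ?z = s *\<^sub>R (?z - prox v ?z)" unfolding parallel_map_prox by (simp add: algebra_simps)
  have "s * v u \<ge> s * v (prox v ?z) + (u - prox v ?z) \<bullet> (s *\<^sub>R (?z - prox v ?z))" for u
  proof -
    have "v u \<ge> v (prox v ?z) + (u - prox v ?z) \<bullet> (?z - prox v ?z)"
      using prox_subdifferential[OF v, of ?z] unfolding subdifferential_def by blast
    then have "s * v u \<ge> s * (v (prox v ?z) + (u - prox v ?z) \<bullet> (?z - prox v ?z))"
      using s by (intro mult_left_mono) auto
    then show ?thesis by (simp add: distrib_left)
  qed
  then show "w - prox v ?z \<in> subdifferential (\<lambda>x. s * v x) (prox v ?z)"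
    unfolding w subdifferential_def by blast
qed

lemma continuous_on_prox:
  assumes "v \<in> Conv"
  shows "continuous_on S (prox v)"
proof -
  have "continuous_on S (\<lambda>z. (1/2) *\<^sub>R (prox_reflection v z + z))"
    by (intro continuous_intros nonexpansive_continuous nonexpansive_prox_reflection assms)
  then show ?thesis by (simp add: prox_reflection_def)
qed

lemma parallel_set_prox:
  assumes v: "v \<in> Conv"
  shows "parallel_set s v \<eta> = parallel_map (prox_reflection v) s ` {z. (prox v z, z - prox v z) \<in> \<eta>}"
proof
  show "parallel_set s v \<eta> \<subseteq> parallel_map (prox_reflection v) s ` {z. (prox v z, z - prox v z) \<in> \<eta>}"
  proof
    fix p assume "p \<in> parallel_set s v \<eta>"
    then obtain x y where xy: "p = x + s *\<^sub>R y" "y \<in> subdifferential v x" "(x, y) \<in> \<eta>"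
      unfolding parallel_set_def subdiff_graph_def by auto
    have "prox v (x + y) = x" using v xy by (intro prox_eqI) auto
    then show "p \<in> parallel_map (prox_reflection v) s ` {z. (prox v z, z - prox v z) \<in> \<eta>}"
      using xy by (intro image_eqI[of _ _ "x + y"]) (auto simp: parallel_map_prox)
  qed
  show "parallel_map (prox_reflection v) s ` {z. (prox v z, z - prox v z) \<in> \<eta>} \<subseteq> parallel_set s v \<eta>"
    using prox_subdifferential[OF v]
    unfolding parallel_set_def subdiff_graph_def parallel_map_prox by blast
qed

text \<open>Subgradients are bounded on bounded sets, so the preimage of a ball under
  \<open>prox v\<close> is bounded. A compactly supported function composed with
  \<open>prox v\<close> thus keeps compact support, with a radius that depends on v only through a
  local bound.\<close>

lemma prox_norm_bound:
  assumes v: "v \<in> Conv" and "norm (prox v w) \<le> r" "\<And>z. norm z \<le> r + 1 \<Longrightarrow> \<bar>v z\<bar> \<le> M"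
  shows "norm w \<le> r + 2 * M"
proof -
  have "norm (w - prox v w) \<le> 2 * M"
    by (rule subdifferential_bounded[OF prox_subdifferential[OF v] assms(2,3)])
  then show ?thesis using assms(2) norm_triangle_ineq[of "prox v w" "w - prox v w"] by simp
qed


section \<open>Hessian measures\<close>

lemma steiner_coefficientsD:
  fixes v :: "real^'n \<Rightarrow> real"
  assumes "steiner_coefficients v \<Theta>" "\<eta> \<in> sets borel" "s > 0"
  shows "emeasure lebesgue (parallel_set s v \<eta>) =
    (\<Sum>i\<le>CARD('n). ennreal (real (CARD('n) choose i) * s ^ i) * emeasure (\<Theta> (CARD('n) - i)) \<eta>)"
  using assms unfolding steiner_coefficients_def by simp

lemma steiner_coefficients_emeasure_eq:
  fixes v :: "real^'n \<Rightarrow> real"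
  assumes \<Theta>: "steiner_coefficients v \<Theta>" "steiner_coefficients v \<Theta>'"
    and \<eta>: "\<eta> \<in> sets borel"
    and fin: "\<And>s. s > 0 \<Longrightarrow> emeasure lebesgue (parallel_set s v \<eta>) < \<infinity>" and k: "k \<le> CARD('n)"
  shows "emeasure (\<Theta> k) \<eta> = emeasure (\<Theta>' k) \<eta>"
proof -
  let ?n = "CARD('n)"
  \<comment> \<open>At s = 1 all coefficients appear with positive weights, so a finite sum bounds
    each of them.\<close>
  have fin\<Theta>: "emeasure (\<Theta> j) \<eta> < \<infinity>" if "steiner_coefficients v \<Theta>" "j \<le> ?n" for \<Theta> j
  proof -
    have "emeasure lebesgue (parallel_set 1 v \<eta>) =
        (\<Sum>i\<le>?n. ennreal (real (?n choose i) * 1 ^ i) * emeasure (\<Theta> (?n - i)) \<eta>)"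
      by (rule steiner_coefficientsD[OF that(1) \<eta> zero_less_one])
    then have "(\<Sum>i\<le>?n. ennreal (real (?n choose i)) * emeasure (\<Theta> (?n - i)) \<eta>) < \<infinity>"
      using fin[of 1] by simp
    moreover have "ennreal (real (?n choose (?n - j))) * emeasure (\<Theta> (?n - (?n - j))) \<eta> \<le>
      (\<Sum>i\<le>?n. ennreal (real (?n choose i)) * emeasure (\<Theta> (?n - i)) \<eta>)"
      by (rule member_le_sum) auto
    ultimately have "ennreal (real (?n choose (?n - j))) * emeasure (\<Theta> j) \<eta> < \<infinity>"
      using \<open>j \<le> ?n\<close> by (simp add: order.strict_trans1)
    moreover have "ennreal (real (?n choose (?n - j))) \<noteq> 0" by (simp add: ennreal_eq_0_iff)
    ultimately show ?thesis by (auto simp: ennreal_mult_less_top)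
  qed
  have m: "measure lebesgue (parallel_set s v \<eta>) = (\<Sum>i\<le>?n. (real (?n choose i) * measure (\<Theta> (?n - i)) \<eta>) * s ^ i)"
    if \<Theta>: "steiner_coefficients v \<Theta>" and s: "s > 0" for \<Theta> s
  proof -
    have "emeasure lebesgue (parallel_set s v \<eta>) =
        (\<Sum>i\<le>?n. ennreal (real (?n choose i) * s ^ i) * emeasure (\<Theta> (?n - i)) \<eta>)"
      by (rule steiner_coefficientsD[OF \<Theta> \<eta> s])
    also have "\<dots> = (\<Sum>i\<le>?n. ennreal ((real (?n choose i) * measure (\<Theta> (?n - i)) \<eta>) * s ^ i))"
    proof (rule sum.cong[OF refl])
      fix i assume "i \<in> {..?n}"
      have "emeasure (\<Theta> (?n - i)) \<eta> = ennreal (measure (\<Theta> (?n - i)) \<eta>)"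
        using fin\<Theta>[OF \<Theta>, of "?n - i"] by (intro emeasure_eq_ennreal_measure) auto
      then show "ennreal (real (?n choose i) * s ^ i) * emeasure (\<Theta> (?n - i)) \<eta> =
        ennreal ((real (?n choose i) * measure (\<Theta> (?n - i)) \<eta>) * s ^ i)"
        using s by (simp add: ennreal_mult'[symmetric] mult_ac)
    qed
    also have "\<dots> = ennreal (\<Sum>i\<le>?n. (real (?n choose i) * measure (\<Theta> (?n - i)) \<eta>) * s ^ i)"
      using s by (intro sum_ennreal) auto
    finally show ?thesis
      using s by (simp add: measure_def sum_nonneg)
  qed
  have "real (?n choose (?n - k)) * measure (\<Theta> (?n - (?n - k))) \<eta> =
      real (?n choose (?n - k)) * measure (\<Theta>' (?n - (?n - k))) \<eta>"
    by (rule coefficients_unique[where n="?n" and c="\<lambda>i. real (?n choose i) * measure (\<Theta> (?n - i)) \<eta>"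
          and d="\<lambda>i. real (?n choose i) * measure (\<Theta>' (?n - i)) \<eta>" and i="?n - k"])
      (simp_all add: m[OF \<Theta>(1), symmetric] m[OF \<Theta>(2), symmetric])
  then have "measure (\<Theta> k) \<eta> = measure (\<Theta>' k) \<eta>" using k by (auto simp: binomial_eq_0_iff)
  then show ?thesis
    using fin\<Theta>[OF \<Theta>(1) k] fin\<Theta>[OF \<Theta>(2) k] by (simp add: emeasure_eq_ennreal_measure)
qed

lemma steiner_coefficients_unique:
  fixes v :: "real^'n \<Rightarrow> real"
  assumes v: "v \<in> Conv" and \<Theta>: "steiner_coefficients v \<Theta>" "steiner_coefficients v \<Theta>'" and k: "k \<le> CARD('n)"
  shows "\<Theta> k = \<Theta>' k"
proof (rule measure_eqI)
  have sets: "sets (\<Theta> k) = sets borel" "sets (\<Theta>' k) = sets borel"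
    using \<Theta> k unfolding steiner_coefficients_def by auto
  then show "sets (\<Theta> k) = sets (\<Theta>' k)" by simp
  fix A assume "A \<in> sets (\<Theta> k)"
  then have A: "A \<in> sets borel" using sets by simp
  let ?B = "\<lambda>i::nat. A \<inter> cball 0 (real i)"
  have B: "range ?B \<subseteq> sets borel" using A by auto
  have inc: "incseq ?B" by (auto simp: incseq_def intro: order_trans)
  have un: "(\<Union>i. ?B i) = A" by (auto simp: real_arch_simple)
  have eq: "emeasure (\<Theta> k) (?B i) = emeasure (\<Theta>' k) (?B i)" for i
  proof (rule steiner_coefficients_emeasure_eq[OF \<Theta> _ _ k])
    show "?B i \<in> sets borel" using A by auto
    fix s :: real assume "s > 0"
    have "norm p \<le> real i + s * real i" if p: "p \<in> parallel_set s v (?B i)" for p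
    proof -
      obtain x y where xy: "p = x + s *\<^sub>R y" "(x, y) \<in> cball 0 (real i)"
        using p unfolding parallel_set_def by blast
      then have "norm x \<le> real i" "norm y \<le> real i"
        using norm_fst_le[of x y] norm_snd_le[of y x] by auto
      then show ?thesis unfolding xy(1) using \<open>s > 0\<close>
        by (intro norm_triangle_le add_mono) (auto intro: mult_left_mono)
    qed
    then have "parallel_set s v (?B i) \<subseteq> cball 0 (real i + s * real i)" by auto
    then have "emeasure lebesgue (parallel_set s v (?B i)) \<le> emeasure lebesgue (cball 0 (real i + s * real i) :: (real^'n) set)"
      by (rule emeasure_mono) auto
    also have "\<dots> < \<infinity>" using emeasure_bounded_finite[of "cball 0 (real i + s * real i) :: (real^'n) set"] by simp
    finally show "emeasure lebesgue (parallel_set s v (?B i)) < \<infinity>" .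
  qed
  show "emeasure (\<Theta> k) A = emeasure (\<Theta>' k) A"
    using SUP_emeasure_incseq[of ?B "\<Theta> k"] SUP_emeasure_incseq[of ?B "\<Theta>' k"] B inc eq
    unfolding un sets by simp
qed

lemma hessian_measure_eq:
  fixes v :: "real^'n \<Rightarrow> real"
  assumes v: "v \<in> Conv" and \<Theta>: "steiner_coefficients v \<Theta>" and k: "k \<le> CARD('n)"
  shows "hessian_measure k v = \<Theta> k"
  unfolding hessian_measure_def
proof (rule the_equality)
  show "\<exists>\<Theta>'. steiner_coefficients v \<Theta>' \<and> \<Theta> k = \<Theta>' k" using \<Theta> by blast
  fix M assume "\<exists>\<Theta>'. steiner_coefficients v \<Theta>' \<and> M = \<Theta>' k"
  then show "M = \<Theta> k" using steiner_coefficients_unique[OF v _ \<Theta> k] by auto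
qed

definition minty :: "(real^'n \<Rightarrow> real) \<Rightarrow> real^'n \<Rightarrow> (real^'n) \<times> (real^'n)" where
  "minty v z = (prox v z, z - prox v z)"

lemma measurable_minty: "v \<in> Conv \<Longrightarrow> minty v \<in> borel_measurable borel"
  unfolding minty_def by (intro borel_measurable_continuous_onI continuous_intros continuous_on_prox)

text \<open>The Minty map pushes the densities forward to the graph. The index is reversed and a
  binomial coefficient divided out because the power s^i comes with weight n choose i and the
  measure of index n - i.\<close>

lemma steiner_formula:
  fixes v :: "real^'n \<Rightarrow> real"
  assumes v: "v \<in> Conv"
    and g: "\<And>i. g i \<in> borel_measurable borel" "\<And>i x. g i x \<ge> 0"
      "\<And>s. s > 0 \<Longrightarrow> distr lborel borel (parallel_inv (prox_reflection v) s) =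
        density lborel (\<lambda>z. ennreal (\<Sum>i\<le>CARD('n). g i z * s ^ i))"
  shows "steiner_coefficients v (\<lambda>k. distr (density lborel (\<lambda>z. ennreal (g (CARD('n) - k) z / real (CARD('n) choose k)))) borel (minty v))"
  unfolding steiner_coefficients_def
proof (intro conjI ballI allI impI)
  let ?n = "CARD('n)"
  fix \<eta> :: "((real^'n) \<times> (real^'n)) set" and s :: real
  assume \<eta>: "\<eta> \<in> sets borel" and s: "s > 0"
  note [measurable] = g(1) measurable_minty[OF v] \<eta>
  note R = nonexpansive_prox_reflection[OF v]
  let ?E = "minty v -` \<eta>"
  have E[measurable]: "?E \<in> sets borel" using measurable_sets_borel[OF measurable_minty[OF v] \<eta>] .
  have ps: "parallel_set s v \<eta> = parallel_map (prox_reflection v) s ` ?E"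
    unfolding parallel_set_prox[OF v] minty_def by (simp add: vimage_def)
  have "parallel_map (prox_reflection v) s ` ?E \<in> sets borel"
    using measurable_sets_borel[OF measurable_parallel_inv[OF R s] E] by (simp add: parallel_inv_vimage R s)
  then have "emeasure lebesgue (parallel_set s v \<eta>) = emeasure (distr lborel borel (parallel_inv (prox_reflection v) s)) ?E"
    unfolding ps emeasure_parallel[OF R s E] by simp
  also have "\<dots> = (\<integral>\<^sup>+z. ennreal (\<Sum>i\<le>?n. g i z * s ^ i) * indicator ?E z \<partial>lborel)"
    unfolding g(3)[OF s] by (subst emeasure_density) auto
  also have "\<dots> = (\<integral>\<^sup>+z. (\<Sum>i\<le>?n. ennreal (real (?n choose i) * s ^ i) * (ennreal (g i z / real (?n choose (?n - i))) * indicator ?E z)) \<partial>lborel)"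
  proof (rule nn_integral_cong)
    fix z
    have "ennreal (\<Sum>i\<le>?n. g i z * s ^ i) = (\<Sum>i\<le>?n. ennreal (g i z * s ^ i))"
      using g(2) s by (intro sum_ennreal[symmetric]) auto
    also have "\<dots> = (\<Sum>i\<le>?n. ennreal (real (?n choose i) * s ^ i) * ennreal (g i z / real (?n choose (?n - i))))"
    proof (rule sum.cong[OF refl])
      fix i assume "i \<in> {..?n}"
      then have "?n choose (?n - i) = ?n choose i" "?n choose i \<noteq> 0"
        using binomial_symmetric[of i ?n] by auto
      then show "ennreal (g i z * s ^ i) = ennreal (real (?n choose i) * s ^ i) * ennreal (g i z / real (?n choose (?n - i)))"
        using s g(2)[of i z] by (subst ennreal_mult[symmetric]) (auto simp: field_simps)
    qed
    finally show "ennreal (\<Sum>i\<le>?n. g i z * s ^ i) * indicator ?E z =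
      (\<Sum>i\<le>?n. ennreal (real (?n choose i) * s ^ i) * (ennreal (g i z / real (?n choose (?n - i))) * indicator ?E z))"
      by (simp add: sum_distrib_right mult.assoc)
  qed
  also have "\<dots> = (\<Sum>i\<le>?n. ennreal (real (?n choose i) * s ^ i) * (\<integral>\<^sup>+z. ennreal (g i z / real (?n choose (?n - i))) * indicator ?E z \<partial>lborel))"
    by (subst nn_integral_sum) (auto simp: nn_integral_cmult)
  also have "\<dots> = (\<Sum>i\<le>?n. ennreal (real (?n choose i) * s ^ i) *
      emeasure (distr (density lborel (\<lambda>z. ennreal (g (?n - (?n - i)) z / real (?n choose (?n - i))))) borel (minty v)) \<eta>)"
    by (intro sum.cong refl arg_cong2[where f="(*)"]) (simp add: emeasure_distr emeasure_density)
  finally show "emeasure lebesgue (parallel_set s v \<eta>) = \<dots>" .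
qed simp

text \<open>By \<open>prox_scaled\<close> the integrand is a fixed function of
  \<open>parallel_inv (prox_reflection v) s w\<close>, whose distribution has a density polynomial
  in s. The coefficient of s^n is the integral against the density that belongs to index 0.\<close>

lemma hessian_integral_steiner:
  fixes v :: "real^'n \<Rightarrow> real"
  assumes v: "v \<in> Conv" and \<zeta>: "continuous_on UNIV \<zeta>" "\<And>x. \<zeta> x \<noteq> 0 \<Longrightarrow> norm x \<le> r"
  obtains c where "c CARD('n) = integral\<^sup>L (hessian_measure 0 v) (\<lambda>(x, y). \<zeta> x)"
    "\<And>s. s > 0 \<Longrightarrow> (\<integral>w. \<zeta> (prox (\<lambda>x. s * v x) w) \<partial>lborel) = (\<Sum>i\<le>CARD('n). c i * s ^ i)"
proof -
  let ?n = "CARD('n)"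
  note R = nonexpansive_prox_reflection[OF v]
  obtain g where g[measurable]: "\<And>i. g i \<in> borel_measurable borel" and g0: "\<And>i x. g i x \<ge> 0"
    and gd: "\<And>s. s > 0 \<Longrightarrow> distr lborel borel (parallel_inv (prox_reflection v) s) =
        density lborel (\<lambda>z. ennreal (\<Sum>i\<le>?n. g i z * s ^ i))"
    using steiner_densities[OF R] by blast
  let ?\<phi> = "\<lambda>z. \<zeta> (prox v z)"
  have cont: "continuous_on UNIV ?\<phi>"
    by (intro continuous_on_compose2[OF \<zeta>(1)] continuous_on_prox v) auto
  then have [measurable]: "?\<phi> \<in> borel_measurable borel" by (rule borel_measurable_continuous_onI)
  obtain M where M: "\<And>z. norm z \<le> r + 1 \<Longrightarrow> \<bar>v z\<bar> \<le> M" using Conv_bounded_on_ball[OF v] by blast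
  have supp: "norm z \<le> r + 2 * M" if "?\<phi> z \<noteq> 0" for z
    using prox_norm_bound[OF v \<zeta>(2)[OF that] M] .
  have int: "integrable lborel (\<lambda>w. ?\<phi> (parallel_inv (prox_reflection v) s w))" if s: "s > 0" for s
    by (rule integrable_compact_support)
      (auto intro!: continuous_on_compose2[OF cont] continuous_on_parallel_inv R s
         parallel_inv_norm_bound[OF R s supp])
  have id: "parallel_inv (prox_reflection v) 1 w = w" for w
    using parallel_inv_map[OF R, of 1 w] by (simp add: parallel_map_def)
  have "integrable (distr lborel borel (parallel_inv (prox_reflection v) 1)) ?\<phi>"
    using int[of 1] measurable_parallel_inv[OF R, of 1] by (subst integrable_distr_eq) auto
  \<comment> \<open>At s = 1 the density is the plain sum of the nonnegative \<open>g i\<close>,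
    which dominates each of them.\<close>
  then have "integrable lborel (\<lambda>z. (\<Sum>i\<le>?n. g i z) * ?\<phi> z)"
    unfolding gd[OF zero_less_one] by (subst (asm) integrable_density) (auto simp: sum_nonneg g0)
  then have gi: "integrable lborel (\<lambda>z. g i z * ?\<phi> z)" if "i \<le> ?n" for i
  proof (rule Bochner_Integration.integrable_bound)
    show "AE z in lborel. norm (g i z * ?\<phi> z) \<le> norm ((\<Sum>i\<le>?n. g i z) * ?\<phi> z)"
    proof (rule AE_I2)
      fix z
      have "g i z \<le> (\<Sum>i\<le>?n. g i z)" using that g0 by (intro member_le_sum) auto
      then have "\<bar>g i z\<bar> \<le> \<bar>\<Sum>i\<le>?n. g i z\<bar>" using g0[of i z] by simp
      then show "norm (g i z * ?\<phi> z) \<le> norm ((\<Sum>i\<le>?n. g i z) * ?\<phi> z)"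
        by (simp add: abs_mult mult_right_mono)
    qed
  qed auto
  define c where "c i = (\<integral>z. g i z * ?\<phi> z \<partial>lborel)" for i
  have "(\<integral>w. \<zeta> (prox (\<lambda>x. s * v x) w) \<partial>lborel) = (\<Sum>i\<le>?n. c i * s ^ i)" if s: "s > 0" for s
  proof -
    have "(\<integral>w. \<zeta> (prox (\<lambda>x. s * v x) w) \<partial>lborel) = (\<integral>z. ?\<phi> z \<partial>distr lborel borel (parallel_inv (prox_reflection v) s))"
      using measurable_parallel_inv[OF R s] by (subst integral_distr) (auto simp: prox_scaled[OF v s])
    also have "\<dots> = (\<integral>z. (\<Sum>i\<le>?n. g i z * s ^ i) * ?\<phi> z \<partial>lborel)"
      unfolding gd[OF s] using s by (subst integral_density) (auto intro!: sum_nonneg simp: g0)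
    also have "\<dots> = (\<integral>z. (\<Sum>i\<le>?n. (g i z * ?\<phi> z) * s ^ i) \<partial>lborel)"
      by (simp add: sum_distrib_right sum_distrib_left mult_ac)
    also have "\<dots> = (\<Sum>i\<le>?n. c i * s ^ i)"
      unfolding c_def using gi by (subst Bochner_Integration.integral_sum) auto
    finally show ?thesis .
  qed
  moreover have "c ?n = integral\<^sup>L (hessian_measure 0 v) (\<lambda>(x, y). \<zeta> x)"
  proof -
    have "hessian_measure 0 v = distr (density lborel (\<lambda>z. ennreal (g ?n z))) borel (minty v)"
      using hessian_measure_eq[OF v steiner_formula[OF v g g0 gd], of 0] by simp
    moreover have "(\<lambda>(x, y). \<zeta> x) \<in> borel_measurable (borel :: ((real^'n) \<times> (real^'n)) measure)"
      unfolding split_beta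
      by (intro borel_measurable_continuous_onI continuous_on_compose2[OF \<zeta>(1)] continuous_intros) auto
    ultimately have "integral\<^sup>L (hessian_measure 0 v) (\<lambda>(x, y). \<zeta> x) = (\<integral>z. ?\<phi> z \<partial>density lborel (\<lambda>z. ennreal (g ?n z)))"
      using measurable_minty[OF v] by (simp add: integral_distr minty_def)
    also have "\<dots> = c ?n"
      unfolding c_def by (subst integral_density) (auto simp: g0)
    finally show ?thesis ..
  qed
  ultimately show thesis by (rule that[rotated])
qed


section \<open>Integrals over proximal maps\<close>

lemma half_square_convex:
  fixes a b w :: "'a::real_inner"
  assumes "0 \<le> t" "t \<le> 1"
  shows "(norm ((1 - t) *\<^sub>R a + t *\<^sub>R b - w))\<^sup>2 \<le> (1 - t) * (norm (a - w))\<^sup>2 + t * (norm (b - w))\<^sup>2"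
proof -
  have "(1 - t) * (norm (a - w))\<^sup>2 + t * (norm (b - w))\<^sup>2 - (norm ((1 - t) *\<^sub>R (a - w) + t *\<^sub>R (b - w)))\<^sup>2
    = t * (1 - t) * (norm ((a - w) - (b - w)))\<^sup>2"
    unfolding power2_norm_eq_inner
    by (simp only: inner_add_left inner_add_right inner_diff_left inner_diff_right inner_scaleR_left inner_scaleR_right)
      (simp add: inner_commute algebra_simps)
  also have "\<dots> \<ge> 0" using assms by simp
  finally show ?thesis by (simp add: algebra_simps)
qed

text \<open>The subgradient inequality at \<open>prox v w\<close>, with |x - w|^2 expanded about
  that point. The quadratic excess gives uniqueness and stability of the minimiser.\<close>

lemma prox_strong_minimum:
  assumes v: "v \<in> Conv"
  shows "v (prox v w) + (norm (prox v w - w))\<^sup>2 / 2 + (norm (x - prox v w))\<^sup>2 / 2 \<le> v x + (norm (x - w))\<^sup>2 / 2"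
proof -
  let ?p = "prox v w"
  have "v x \<ge> v ?p + (x - ?p) \<bullet> (w - ?p)"
    using prox_subdifferential[OF v, of w] unfolding subdifferential_def by blast
  moreover have "(norm (x - w))\<^sup>2 = (norm (x - ?p))\<^sup>2 + (norm (?p - w))\<^sup>2 - 2 * ((x - ?p) \<bullet> (w - ?p))"
    unfolding power2_norm_eq_inner by (simp add: inner_diff_left inner_diff_right inner_commute)
  ultimately show ?thesis by (simp add: field_simps)
qed

lemma prox_minimizerI:
  assumes v: "v \<in> Conv" and "\<And>x. v q + (norm (q - w))\<^sup>2 / 2 \<le> v x + (norm (x - w))\<^sup>2 / 2"
  shows "prox v w = q"
proof -
  have "(norm (q - prox v w))\<^sup>2 / 2 \<le> 0"
    using prox_strong_minimum[OF v, of w q] assms(2)[of "prox v w"] by linarith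
  then show ?thesis by simp
qed

text \<open>If u + Q has the smaller minimum, its minimiser p also minimises min u v + Q. For the
  maximum the point is that u q <= v q at the minimiser q of v + Q. Otherwise u > v near q, so the
  convex function min u v equals v at points just off q towards p, and convexity makes v + Q there
  no larger than at q, against strict minimality.\<close>

lemma prox_min_max_aux:
  assumes u: "u \<in> Conv" and v: "v \<in> Conv"
    and M: "(\<lambda>x. max (u x) (v x)) \<in> Conv" and m: "(\<lambda>x. min (u x) (v x)) \<in> Conv"
    and le: "u (prox u w) + (norm (prox u w - w))\<^sup>2 / 2 \<le> v (prox v w) + (norm (prox v w - w))\<^sup>2 / 2"
  shows "prox (\<lambda>x. min (u x) (v x)) w = prox u w" "prox (\<lambda>x. max (u x) (v x)) w = prox v w"
proof -
  define p q where "p = prox u w" and "q = prox v w"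
  define Q where "Q x = (norm (x - w))\<^sup>2 / 2" for x
  have le': "u p + Q p \<le> v q + Q q" using le by (simp add: p_def q_def Q_def)
  have up: "u p + Q p + (norm (x - p))\<^sup>2 / 2 \<le> u x + Q x" for x
    unfolding p_def Q_def by (rule prox_strong_minimum[OF u])
  have vq: "v q + Q q + (norm (x - q))\<^sup>2 / 2 \<le> v x + Q x" for x
    unfolding q_def Q_def by (rule prox_strong_minimum[OF v])
  have up': "u p + Q p \<le> u x + Q x" and vq': "v q + Q q \<le> v x + Q x" for x
    using up[of x] vq[of x] zero_le_power2[of "norm (x - p)"] zero_le_power2[of "norm (x - q)"] by linarith+
  have "min (u p) (v p) + Q p \<le> min (u x) (v x) + Q x" for x
    using up'[of x] vq'[of x] vq'[of p] le' by (auto simp: min_def)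
  then have "prox (\<lambda>x. min (u x) (v x)) w = p"
    unfolding Q_def by (rule prox_minimizerI[OF m])
  then show "prox (\<lambda>x. min (u x) (v x)) w = prox u w" by (simp add: p_def)
  have "u q \<le> v q"
  proof (rule ccontr)
    assume uv: "\<not> u q \<le> v q"
    have "p \<noteq> q" using uv le' by auto
    have "isCont (\<lambda>t. u ((1 - t) *\<^sub>R q + t *\<^sub>R p) - v ((1 - t) *\<^sub>R q + t *\<^sub>R p)) (0::real)"
    proof -
      have "continuous_on UNIV (\<lambda>t::real. u ((1 - t) *\<^sub>R q + t *\<^sub>R p) - v ((1 - t) *\<^sub>R q + t *\<^sub>R p))"
        by (intro continuous_intros continuous_on_compose2[OF Conv_continuous[OF u, of UNIV]]
            continuous_on_compose2[OF Conv_continuous[OF v, of UNIV]]) auto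
      then show ?thesis by (simp add: continuous_on_eq_continuous_at)
    qed
    then have "eventually (\<lambda>t. u ((1 - t) *\<^sub>R q + t *\<^sub>R p) - v ((1 - t) *\<^sub>R q + t *\<^sub>R p) > 0) (at (0::real))"
      unfolding isCont_def using uv by (intro order_tendstoD(1)) auto
    then obtain d where d: "d > 0"
      "\<And>t. t \<noteq> 0 \<Longrightarrow> dist t 0 < d \<Longrightarrow> u ((1 - t) *\<^sub>R q + t *\<^sub>R p) - v ((1 - t) *\<^sub>R q + t *\<^sub>R p) > 0"
      unfolding eventually_at by auto
    define t where "t = min (d / 2) (1 / 2)"
    have t: "0 < t" "t \<le> 1" "dist t 0 < d" "t \<noteq> 0" using d(1) by (auto simp: t_def)
    define y where "y = (1 - t) *\<^sub>R q + t *\<^sub>R p"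
    have uvy: "v y < u y" using d(2)[OF t(4,3)] by (simp add: y_def)
    have "y - q = t *\<^sub>R (p - q)" by (simp add: y_def algebra_simps)
    then have "norm (y - q) > 0" using t \<open>p \<noteq> q\<close> by simp
    then have "(norm (y - q))\<^sup>2 / 2 > 0" by simp
    then have 1: "v q + Q q < v y + Q y" using vq[of y] by linarith
    have "min (u y) (v y) \<le> (1 - t) * min (u q) (v q) + t * min (u p) (v p)"
      unfolding y_def using m t by (intro Conv_ineq[of "\<lambda>x. min (u x) (v x)"]) auto
    also have "\<dots> \<le> (1 - t) * v q + t * u p"
      using t by (intro add_mono mult_left_mono) auto
    finally have "v y \<le> (1 - t) * v q + t * u p" using uvy by (simp add: min_def split: if_splits)
    moreover have "Q y \<le> (1 - t) * Q q + t * Q p"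
      using half_square_convex[of t q p w] t unfolding Q_def y_def by simp
    moreover have "t * (u p + Q p) \<le> t * (v q + Q q)" using le' t by (intro mult_left_mono) auto
    ultimately have "v y + Q y \<le> v q + Q q" by (simp add: algebra_simps)
    then show False using 1 by simp
  qed
  then have "max (u q) (v q) + Q q \<le> max (u x) (v x) + Q x" for x
    using vq'[of x] by auto
  then have "prox (\<lambda>x. max (u x) (v x)) w = q"
    unfolding Q_def by (rule prox_minimizerI[OF M])
  then show "prox (\<lambda>x. max (u x) (v x)) w = prox v w" by (simp add: q_def)
qed

text \<open>At each w the proximal points of the maximum and the minimum are those of u and v in
  some order. The valuation property thus holds already under the integral sign.\<close>

lemma prox_min_max:
  fixes f :: "real^'n \<Rightarrow> 'b::ab_semigroup_add"
  assumes u: "u \<in> Conv" and v: "v \<in> Conv"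
    and M: "(\<lambda>x. max (u x) (v x)) \<in> Conv" and m: "(\<lambda>x. min (u x) (v x)) \<in> Conv"
  shows "f (prox (\<lambda>x. max (u x) (v x)) w) + f (prox (\<lambda>x. min (u x) (v x)) w) = f (prox u w) + f (prox v w)"
proof (cases "u (prox u w) + (norm (prox u w - w))\<^sup>2 / 2 \<le> v (prox v w) + (norm (prox v w - w))\<^sup>2 / 2")
  case True
  then show ?thesis using prox_min_max_aux[OF u v M m] by (simp add: add.commute)
next
  case False
  have "prox (\<lambda>x. min (v x) (u x)) w = prox v w" "prox (\<lambda>x. max (v x) (u x)) w = prox u w"
    using prox_min_max_aux[OF v u, of w] M m False by (simp_all add: max.commute min.commute)
  then show ?thesis by (simp add: max.commute min.commute)
qed

lemma linear_functional_inner: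
  fixes l :: "real^'n \<Rightarrow> real"
  assumes "linear l"
  obtains a where "\<And>x. l x = x \<bullet> a"
proof
  fix x
  have "l x = l (\<Sum>b\<in>Basis. (x \<bullet> b) *\<^sub>R b)" by (simp add: euclidean_representation)
  also have "\<dots> = (\<Sum>b\<in>Basis. (x \<bullet> b) * l b)" using assms by (simp add: linear_sum linear_cmul)
  also have "\<dots> = x \<bullet> (\<Sum>b\<in>Basis. l b *\<^sub>R b)" by (simp add: inner_sum_right mult.commute)
  finally show "l x = x \<bullet> (\<Sum>b\<in>Basis. l b *\<^sub>R b)" .
qed

lemma Conv_add_inner: "v \<in> Conv \<Longrightarrow> (\<lambda>x. v x + x \<bullet> a) \<in> Conv"
  by (rule Conv_add[OF _ Conv_linear]) (auto intro: linearI simp: inner_add_left)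

lemma prox_add_affine:
  assumes v: "v \<in> Conv"
  shows "prox (\<lambda>x. v x + x \<bullet> a + \<alpha>) w = prox v (w - a)"
proof (rule prox_eqI)
  show "(\<lambda>x. v x + x \<bullet> a + \<alpha>) \<in> Conv" by (intro Conv_add Conv_add_inner Conv_const v)
  have "v z \<ge> v (prox v (w - a)) + (z - prox v (w - a)) \<bullet> (w - a - prox v (w - a))" for z
    using prox_subdifferential[OF v, of "w - a"] unfolding subdifferential_def by blast
  then show "w - prox v (w - a) \<in> subdifferential (\<lambda>x. v x + x \<bullet> a + \<alpha>) (prox v (w - a))"
    unfolding subdifferential_def by (simp add: inner_diff_left inner_diff_right algebra_simps)
qed

definition prox_integral :: "(real^'n \<Rightarrow> real) \<Rightarrow> (real^'n \<Rightarrow> real) \<Rightarrow> real" where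
  "prox_integral \<zeta> v = (\<integral>w. \<zeta> (prox v w) \<partial>lborel)"

context
  fixes \<zeta> :: "real^'n \<Rightarrow> real" and r :: real
  assumes \<zeta>: "continuous_on UNIV \<zeta>" "\<And>x. \<zeta> x \<noteq> 0 \<Longrightarrow> norm x \<le> r"
begin

lemma continuous_on_prox_integrand: "v \<in> Conv \<Longrightarrow> continuous_on S (\<lambda>w. \<zeta> (prox v w))"
  by (intro continuous_on_compose2[OF \<zeta>(1)] continuous_on_prox) auto

lemma integrable_prox:
  assumes "v \<in> Conv"
  shows "integrable lborel (\<lambda>w. \<zeta> (prox v w))"
proof -
  obtain M where "\<And>z. norm z \<le> r + 1 \<Longrightarrow> \<bar>v z\<bar> \<le> M" using Conv_bounded_on_ball[OF assms] by blast
  then show ?thesis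
    by (intro integrable_compact_support[where r="r + 2 * M"] continuous_on_prox_integrand assms)
      (auto intro: prox_norm_bound[OF assms \<zeta>(2)])
qed

lemma prox_integral_valuation:
  assumes "u \<in> Conv" "v \<in> Conv" "(\<lambda>x. max (u x) (v x)) \<in> Conv" "(\<lambda>x. min (u x) (v x)) \<in> Conv"
  shows "prox_integral \<zeta> (\<lambda>x. max (u x) (v x)) + prox_integral \<zeta> (\<lambda>x. min (u x) (v x)) =
    prox_integral \<zeta> u + prox_integral \<zeta> v"
  unfolding prox_integral_def
  using prox_min_max[OF assms, of \<zeta>]
  by (simp add: integrable_prox assms flip: Bochner_Integration.integral_add)

lemma prox_integral_add_affine:
  assumes v: "v \<in> Conv"
  shows "prox_integral \<zeta> (\<lambda>x. v x + x \<bullet> a + \<alpha>) = prox_integral \<zeta> v"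
proof -
  have "(\<lambda>w. \<zeta> (prox v w)) \<in> borel_measurable borel"
    by (intro borel_measurable_continuous_onI continuous_on_prox_integrand v)
  from lborel_integral_affine[OF this, of 1 "-a"] show ?thesis
    unfolding prox_integral_def prox_add_affine[OF v] by (simp add: algebra_simps)
qed

end


section \<open>Epi-convergence\<close>

text \<open>If z were outside the hull, a separating direction a would satisfy \<delta> |a . b| < 2
  e |a| for every basis vector b; summing over the basis contradicts the choice of e. Recovery
  points near the vertices of a cross-polytope therefore still enclose a neighbourhood of its
  centre.\<close>

lemma mem_convex_hull_perturbed_cross:
  fixes x z :: "'a::euclidean_space" and p :: "real \<Rightarrow> 'a \<Rightarrow> 'a"
  assumes "\<delta> > 0" and e: "2 * real DIM('a) * e \<le> \<delta>"
    and p: "\<And>s b. s \<in> {-1, 1} \<Longrightarrow> b \<in> Basis \<Longrightarrow> norm (p s b - (x + (s * \<delta>) *\<^sub>R b)) < e"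
    and z: "norm (z - x) < e"
  shows "z \<in> convex hull (case_prod p ` ({-1, 1} \<times> Basis))"
proof (rule ccontr)
  let ?C = "convex hull (case_prod p ` ({-1, 1} \<times> Basis))"
  assume "z \<notin> ?C"
  moreover have "convex ?C" by simp
  moreover have "closed ?C"
    by (rule compact_imp_closed, rule compact_convex_hull, rule finite_imp_compact) simp
  ultimately obtain a c where ac: "a \<bullet> z < c" "\<And>y. y \<in> ?C \<Longrightarrow> a \<bullet> y > c"
    using separating_hyperplane_closed_point[of ?C z] by blast
  have ap: "a \<bullet> z < a \<bullet> p s b" if "s \<in> {-1, 1}" "b \<in> Basis" for s b
  proof -
    have "p s b \<in> ?C" by (rule hull_inc) (use that in \<open>auto intro!: image_eqI[of _ _ "(s, b)"]\<close>)
    then show ?thesis using ac by fastforce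
  qed
  obtain b0 :: 'a where b0: "b0 \<in> Basis" using nonempty_Basis by blast
  have "a \<noteq> 0" using ap[of 1 b0] b0 by auto
  have e0: "e > 0" using z by (meson norm_ge_zero order.strict_trans1)
  have step: "\<delta> * \<bar>a \<bullet> b\<bar> < 2 * (norm a * e)" if b: "b \<in> Basis" for b
  proof -
    \<comment> \<open>Selects the vertex in the direction in which the inner product with
      \<open>a\<close> decreases.\<close>
    define s :: real where "s = (if a \<bullet> b \<ge> 0 then -1 else 1)"
    have s: "s \<in> {-1, 1}" by (simp add: s_def)
    have "a \<bullet> z < a \<bullet> p s b" by (rule ap[OF s b])
    also have "\<dots> = a \<bullet> x + s * \<delta> * (a \<bullet> b) + a \<bullet> (p s b - (x + (s * \<delta>) *\<^sub>R b))"
      by (simp add: inner_diff_right inner_add_right)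
    also have "a \<bullet> (p s b - (x + (s * \<delta>) *\<^sub>R b)) \<le> norm a * norm (p s b - (x + (s * \<delta>) *\<^sub>R b))"
      by (rule norm_cauchy_schwarz)
    also have "\<dots> \<le> norm a * e" using p[OF s b] by (intro mult_left_mono) auto
    also have "s * \<delta> * (a \<bullet> b) = - (\<delta> * \<bar>a \<bullet> b\<bar>)" by (simp add: s_def)
    finally have "\<delta> * \<bar>a \<bullet> b\<bar> < a \<bullet> (x - z) + norm a * e" by (simp add: inner_diff_right)
    also have "a \<bullet> (x - z) \<le> norm a * norm (x - z)" by (rule norm_cauchy_schwarz)
    also have "\<dots> \<le> norm a * e" using z by (intro mult_left_mono) (auto simp: norm_minus_commute)
    finally show ?thesis by (simp add: mult.commute)
  qed
  have "\<delta> * norm a \<le> \<delta> * (\<Sum>b\<in>Basis. \<bar>a \<bullet> b\<bar>)"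
    using \<open>\<delta> > 0\<close> norm_le_l1[of a] by (intro mult_left_mono) auto
  also have "\<dots> = (\<Sum>b\<in>Basis. \<delta> * \<bar>a \<bullet> b\<bar>)" by (simp add: sum_distrib_left)
  also have "\<dots> < (\<Sum>b\<in>(Basis :: 'a set). 2 * (norm a * e))"
    by (rule sum_strict_mono) (auto intro: step)
  also have "\<dots> = norm a * (2 * real DIM('a) * e)" by simp
  also have "\<dots> \<le> norm a * \<delta>" using e by (intro mult_left_mono) auto
  finally show False by (simp add: mult.commute)
qed

text \<open>The lower bound is part of epi-convergence. For the upper bound, recovery sequences at
  the 2n points x +- \<delta> b, where v < c, eventually have \<open>xs k\<close> in their convex
  hull, and convexity of \<open>vs k\<close> bounds its value there by the largest value at the
  recovery points.\<close>

lemma epi_converges_continuously: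
  fixes v :: "real^'n \<Rightarrow> real"
  assumes vs: "\<And>k. vs k \<in> Conv" and v: "v \<in> Conv" and epi: "epi_converges vs v" and xs: "xs \<longlonglongrightarrow> x"
  shows "(\<lambda>k. vs k (xs k)) \<longlonglongrightarrow> v x"
proof (rule order_tendstoI)
  fix c assume "c < v x"
  have "ereal (v x) \<le> liminf (\<lambda>k. ereal (vs k (xs k)))"
    using epi xs unfolding epi_converges_def by blast
  then have "ereal c < liminf (\<lambda>k. ereal (vs k (xs k)))" 
    by (rule order.strict_trans2[rotated]) (use \<open>c < v x\<close> in simp)
  then have "eventually (\<lambda>k. ereal c < ereal (vs k (xs k))) sequentially" by (rule less_LiminfD)
  then show "eventually (\<lambda>k. c < vs k (xs k)) sequentially" by simp
next
  fix c assume c: "v x < c"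
  have "isCont v x" using Conv_continuous[OF v, of UNIV] by (simp add: continuous_on_eq_continuous_at)
  then have "eventually (\<lambda>z. v z < c) (nhds x)"
    using c by (intro order_tendstoD(2)[of v "v x"]) (auto simp: continuous_at_imp_continuous_at_within isCont_def tendsto_nhds_iff)
  then obtain d where d: "d > 0" "\<And>z. dist z x < d \<Longrightarrow> v z < c" unfolding eventually_nhds_metric by blast
  define \<delta> where "\<delta> = d / 2"
  have \<delta>: "\<delta> > 0" using d by (simp add: \<delta>_def)
  define e where "e = \<delta> / (2 * real DIM(real^'n))"
  have e: "e > 0" using \<delta> by (simp add: e_def)
  have e\<delta>: "2 * real DIM(real^'n) * e \<le> \<delta>" by (simp add: e_def)
  obtain p where p: "\<And>z. p z \<longlonglongrightarrow> z" "\<And>z. (\<lambda>k. vs k (p z k)) \<longlonglongrightarrow> v z"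
    using epi unfolding epi_converges_def by metis
  let ?P = "{-1, 1::real} \<times> (Basis :: (real^'n) set)" and ?q = "\<lambda>(s, b). x + (s * \<delta>) *\<^sub>R b"
  have "eventually (\<lambda>k. norm (p (?q i) k - ?q i) < e \<and> vs k (p (?q i) k) < c) sequentially"
    if i: "i \<in> ?P" for i
  proof (rule eventually_conj)
    show "eventually (\<lambda>k. norm (p (?q i) k - ?q i) < e) sequentially"
      using tendstoD[OF p(1) e, of "?q i"] by (simp add: dist_norm)
    have "norm (snd i) = 1" "\<bar>fst i\<bar> = 1" using i by auto
    then have "dist (?q i) x < d" using d by (auto simp: dist_norm \<delta>_def split_beta abs_mult)
    then have "v (?q i) < c" by (rule d)
    then show "eventually (\<lambda>k. vs k (p (?q i) k) < c) sequentially"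
      using p(2)[of "?q i"] by (rule order_tendstoD(2)[rotated])
  qed
  then have "eventually (\<lambda>k. \<forall>i\<in>?P. norm (p (?q i) k - ?q i) < e \<and> vs k (p (?q i) k) < c) sequentially"
    by (intro eventually_ball_finite) auto
  moreover have "eventually (\<lambda>k. norm (xs k - x) < e) sequentially"
    using tendstoD[OF xs e] by (simp add: dist_norm)
  ultimately show "eventually (\<lambda>k. vs k (xs k) < c) sequentially"
  proof eventually_elim
    case (elim k)
    let ?p = "\<lambda>s b. p (x + (s * \<delta>) *\<^sub>R b) k"
    let ?V = "case_prod ?p ` ?P"
    have "xs k \<in> convex hull ?V"
      using elim by (intro mem_convex_hull_perturbed_cross[OF \<delta> e\<delta>]) auto
    moreover have "\<exists>b<c. \<forall>y\<in>?V. vs k y \<le> b"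
    proof -
      have fin: "finite (vs k ` ?V)" "vs k ` ?V \<noteq> {}" by auto
      have "Max (vs k ` ?V) < c" using elim fin by (subst Max_less_iff) auto
      then show ?thesis using fin by (intro exI[of _ "Max (vs k ` ?V)"]) auto
    qed
    ultimately obtain b where b: "b < c" "\<forall>y\<in>?V. vs k y \<le> b" "xs k \<in> convex hull ?V" by blast
    have "convex_on (convex hull ?V) (vs k)"
      using vs[of k] by (auto simp: Conv_def intro: convex_on_subset)
    then have "vs k (xs k) \<le> b"
      by (rule bspec[OF convex_on_convex_hull_bound[OF _ b(2)] b(3)])
    then show ?case using b(1) by simp
  qed
qed

lemma epi_converges_uniform_limit:
  fixes v :: "real^'n \<Rightarrow> real"
  assumes vs: "\<And>k. vs k \<in> Conv" and v: "v \<in> Conv" and epi: "epi_converges vs v"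
  shows "uniform_limit (cball 0 r) vs v sequentially"
proof (rule ccontr)
  assume "\<not> ?thesis"
  then obtain e where e: "e > 0" "\<not> eventually (\<lambda>k. \<forall>x\<in>cball 0 r. dist (vs k x) (v x) < e) sequentially"
    unfolding uniform_limit_iff by blast
  then have "\<exists>\<^sub>\<infinity>k. \<exists>x\<in>cball 0 r. dist (vs k x) (v x) \<ge> e"
    by (auto simp: frequently_def cofinite_eq_sequentially not_le)
  then have inf: "infinite {k. \<exists>x\<in>cball 0 r. dist (vs k x) (v x) \<ge> e}" by (simp add: INFM_iff_infinite)
  obtain \<sigma> :: "nat \<Rightarrow> nat" where \<sigma>: "strict_mono \<sigma>" "\<And>j. \<sigma> j \<in> {k. \<exists>x\<in>cball 0 r. dist (vs k x) (v x) \<ge> e}"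
    using infinite_enumerate[OF inf] by blast
  then have "\<forall>j. \<exists>x. x \<in> cball 0 r \<and> dist (vs (\<sigma> j) x) (v x) \<ge> e" by blast
  then obtain y where y: "\<And>j. y j \<in> cball 0 r" "\<And>j. dist (vs (\<sigma> j) (y j)) (v (y j)) \<ge> e"
    unfolding choice_iff by blast
  obtain x \<rho> where \<rho>: "strict_mono (\<rho> :: nat \<Rightarrow> nat)" "(y \<circ> \<rho>) \<longlonglongrightarrow> x"
    using compact_cball[of "0::real^'n" r] y(1) unfolding compact_def by blast
  define \<tau> where "\<tau> = \<sigma> \<circ> \<rho>"
  have \<tau>: "strict_mono \<tau>" unfolding \<tau>_def using \<sigma>(1) \<rho>(1) by (rule strict_mono_o)
  \<comment> \<open>The bad points exist only along a subsequence of indices. Filling the other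
    indices with the limit x gives a sequence over all k, to which
    \<open>epi_converges_continuously\<close> applies.\<close>
  define xs where "xs i = (if i \<in> range \<tau> then (y \<circ> \<rho>) (inv \<tau> i) else x)" for i
  have inv: "inv \<tau> (\<tau> j) = j" for j using strict_mono_imp_inj_on[OF \<tau>] by simp
  have "xs \<longlonglongrightarrow> x"
  proof (rule tendstoI)
    fix \<epsilon> :: real assume "\<epsilon> > 0"
    then obtain N where N: "\<And>j. j \<ge> N \<Longrightarrow> dist ((y \<circ> \<rho>) j) x < \<epsilon>"
      using tendstoD[OF \<rho>(2)] unfolding eventually_sequentially by blast
    have "dist (xs i) x < \<epsilon>" if i: "i \<ge> \<tau> N" for i
    proof (cases "i \<in> range \<tau>")
      case True
      then obtain j where j: "i = \<tau> j" by blast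
      then have "j \<ge> N" using i strict_mono_less_eq[OF \<tau>] by simp
      then show ?thesis using N True by (simp add: xs_def j inv)
    qed (use \<open>\<epsilon> > 0\<close> in \<open>simp add: xs_def\<close>)
    then show "eventually (\<lambda>i. dist (xs i) x < \<epsilon>) sequentially"
      unfolding eventually_sequentially by blast
  qed
  then have "(\<lambda>k. vs k (xs k)) \<longlonglongrightarrow> v x" by (rule epi_converges_continuously[OF vs v epi])
  then have "((\<lambda>k. vs k (xs k)) \<circ> \<tau>) \<longlonglongrightarrow> v x" using \<tau> by (rule LIMSEQ_subseq_LIMSEQ)
  moreover have "((\<lambda>k. vs k (xs k)) \<circ> \<tau>) = (\<lambda>j. vs (\<sigma> (\<rho> j)) (y (\<rho> j)))"
    by (auto simp: fun_eq_iff xs_def inv) (simp add: \<tau>_def)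
  moreover have "(\<lambda>j. v (y (\<rho> j))) \<longlonglongrightarrow> v x"
    using Conv_continuous[OF v, of UNIV] \<rho>(2)
    by (intro isCont_tendsto_compose[of x v]) (auto simp: continuous_on_eq_continuous_at o_def)
  ultimately have "(\<lambda>j. dist (vs (\<sigma> (\<rho> j)) (y (\<rho> j))) (v (y (\<rho> j)))) \<longlonglongrightarrow> dist (v x) (v x)"
    by (intro tendsto_dist) auto
  then have "e \<le> dist (v x) (v x)" by (rule LIMSEQ_le_const) (use y(2) in auto)
  then show False using e by simp
qed

lemma uniform_limit_epi_converges:
  fixes v :: "real^'n \<Rightarrow> real"
  assumes v: "continuous_on UNIV v" and lim: "\<And>r. uniform_limit (cball 0 r) vs v sequentially"
  shows "epi_converges vs v"
proof -
  have conv: "(\<lambda>k. vs k (xs k)) \<longlonglongrightarrow> v x" if xs: "xs \<longlonglongrightarrow> x" for xs x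
  proof -
    have "Bseq xs" by (rule convergent_imp_Bseq[OF convergentI[OF xs]])
    then obtain r where "\<forall>k. norm (xs k) \<le> r" by (auto simp: Bseq_def)
    then have "\<And>k. xs k \<in> cball 0 r" by simp
    have "(\<lambda>k. vs k (xs k) - v (xs k)) \<longlonglongrightarrow> 0"
    proof (rule tendstoI)
      fix e :: real assume "e > 0"
      then have "eventually (\<lambda>k. \<forall>x\<in>cball 0 r. dist (vs k x) (v x) < e) sequentially"
        using lim[of r] unfolding uniform_limit_iff by blast
      then show "eventually (\<lambda>k. dist (vs k (xs k) - v (xs k)) 0 < e) sequentially"
        by eventually_elim (use \<open>\<And>k. xs k \<in> cball 0 r\<close> in \<open>auto simp: dist_norm\<close>)
    qed
    moreover have "(\<lambda>k. v (xs k)) \<longlonglongrightarrow> v x"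
      using v xs by (intro isCont_tendsto_compose[of x v]) (auto simp: continuous_on_eq_continuous_at)
    ultimately show ?thesis using tendsto_add by fastforce
  qed
  show ?thesis
    unfolding epi_converges_def
  proof (intro allI conjI impI)
    fix x and xs :: "nat \<Rightarrow> real^'n"
    show "ereal (v x) \<le> liminf (\<lambda>k. ereal (vs k (xs k)))" if "xs \<longlonglongrightarrow> x"
    proof -
      have "(\<lambda>k. ereal (vs k (xs k))) \<longlonglongrightarrow> ereal (v x)" using conv[OF that] by simp
      from lim_imp_Liminf[OF trivial_limit_sequentially this] show ?thesis by simp
    qed
    show "\<exists>xs. xs \<longlonglongrightarrow> x \<and> (\<lambda>k. vs k (xs k)) \<longlonglongrightarrow> v x"
      by (intro exI[of _ "\<lambda>_. x"] conjI conv) auto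
  qed
qed

text \<open>If the k-th minimiser q is at least e away from p, the point y of the segment at
  distance e/2 from p lies where convergence is uniform. By convexity the k-th objective at y is not
  above that at p, while strong minimality puts the limit objective at y at least e^2/8 above that
  at p. Two errors below e^2/32 cannot bridge this.\<close>

lemma prox_LIMSEQ:
  fixes v :: "real^'n \<Rightarrow> real"
  assumes vs: "\<And>k. vs k \<in> Conv" and v: "v \<in> Conv"
    and lim: "\<And>r. uniform_limit (cball 0 r) vs v sequentially"
  shows "(\<lambda>k. prox (vs k) w) \<longlonglongrightarrow> prox v w"
proof (rule tendstoI)
  fix e :: real assume e: "e > 0"
  define p where "p = prox v w"
  define Q where "Q x = (norm (x - w))\<^sup>2 / 2" for x
  have "eventually (\<lambda>k. \<forall>x\<in>cball 0 (norm p + e). dist (vs k x) (v x) < e\<^sup>2 / 32) sequentially"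
    using e by (intro uniform_limitD[OF lim]) simp
  then show "eventually (\<lambda>k. dist (prox (vs k) w) (prox v w) < e) sequentially"
  proof eventually_elim
    case (elim k)
    define q where "q = prox (vs k) w"
    show ?case
    proof (rule ccontr)
      assume "\<not> ?thesis"
      then have far: "norm (q - p) \<ge> e" by (simp add: p_def q_def dist_norm)
      then have "q \<noteq> p" using e by auto
      define t where "t = (e / 2) / norm (q - p)"
      have t: "0 \<le> t" "t \<le> 1" using far e by (auto simp: t_def divide_simps)
      define y where "y = (1 - t) *\<^sub>R p + t *\<^sub>R q"
      have "y - p = t *\<^sub>R (q - p)" by (simp add: y_def algebra_simps)
      then have yp: "norm (y - p) = e / 2" using far e \<open>q \<noteq> p\<close> by (simp add: t_def)
      have "norm y \<le> norm p + e" using norm_triangle_ineq[of "y - p" p] yp e by simp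
      then have d: "\<bar>vs k y - v y\<bar> < e\<^sup>2 / 32" "\<bar>vs k p - v p\<bar> < e\<^sup>2 / 32"
        using elim e by (auto simp: dist_real_def)
      have "vs k q + Q q \<le> vs k p + Q p"
        using prox_strong_minimum[OF vs[of k], of w p] zero_le_power2[of "norm (p - q)"]
        unfolding q_def Q_def by linarith
      then have "t * (vs k q + Q q) \<le> t * (vs k p + Q p)" using t by (intro mult_left_mono) auto
      moreover have "vs k y \<le> (1 - t) * vs k p + t * vs k q" unfolding y_def by (rule Conv_ineq[OF vs t])
      moreover have "Q y \<le> (1 - t) * Q p + t * Q q"
        using half_square_convex[OF t, of p q w] unfolding Q_def y_def by simp
      ultimately have "vs k y + Q y \<le> vs k p + Q p" by (simp add: algebra_simps)
      moreover have "v p + Q p + (e / 2)\<^sup>2 / 2 \<le> v y + Q y"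
        using prox_strong_minimum[OF v, of w y] yp unfolding p_def Q_def by simp
      ultimately have "(e / 2)\<^sup>2 / 2 < e\<^sup>2 / 32 + e\<^sup>2 / 32" using d by linarith
      then have "e\<^sup>2 / 8 < e\<^sup>2 / 16" by (simp add: power_divide)
      then show False using e by simp
    qed
  qed
qed

lemma prox_integral_LIMSEQ:
  fixes v :: "real^'n \<Rightarrow> real"
  assumes \<zeta>: "continuous_on UNIV \<zeta>" "\<And>x. \<zeta> x \<noteq> 0 \<Longrightarrow> norm x \<le> r"
    and vs: "\<And>k. vs k \<in> Conv" and v: "v \<in> Conv"
    and lim: "\<And>r. uniform_limit (cball 0 r) vs v sequentially"
  shows "(\<lambda>k. prox_integral \<zeta> (vs k)) \<longlonglongrightarrow> prox_integral \<zeta> v"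
proof -
  obtain B where B: "B \<ge> 0" "\<And>x. \<bar>\<zeta> x\<bar> \<le> B" using compact_support_bounded[OF \<zeta>] by blast
  obtain M where M: "\<And>z. norm z \<le> r + 1 \<Longrightarrow> \<bar>v z\<bar> \<le> M" using Conv_bounded_on_ball[OF v] by blast
  have "eventually (\<lambda>k. \<forall>x\<in>cball 0 (r + 1). dist (vs k x) (v x) < 1) sequentially"
    using lim[of "r + 1"] unfolding uniform_limit_iff by simp
  then obtain N where N: "\<And>k x. k \<ge> N \<Longrightarrow> x \<in> cball 0 (r + 1) \<Longrightarrow> dist (vs k x) (v x) < 1"
    unfolding eventually_sequentially by blast
  \<comment> \<open>This bound, valid from index N on, confines the supports of the integrands to
    one ball.\<close>
  have M': "\<bar>vs (k + N) z\<bar> \<le> M + 1" if "norm z \<le> r + 1" for k z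
    using N[of "k + N" z] M[OF that] that by (simp add: dist_real_def)
  have "(\<lambda>k. prox_integral \<zeta> (vs (k + N))) \<longlonglongrightarrow> prox_integral \<zeta> v"
    unfolding prox_integral_def
  proof (rule integral_dominated_convergence[where w="\<lambda>w. B * indicator (cball 0 (r + 2 * (M + 1))) w"])
    show "(\<lambda>w. \<zeta> (prox v w)) \<in> borel_measurable lborel"
      "(\<lambda>w. \<zeta> (prox (vs (k + N)) w)) \<in> borel_measurable lborel" for k
      using continuous_on_prox_integrand[OF \<zeta> v, of UNIV] continuous_on_prox_integrand[OF \<zeta> vs, of UNIV]
      by (auto intro: borel_measurable_continuous_onI)
    show "integrable lborel (\<lambda>w. B * indicator (cball 0 (r + 2 * (M + 1))) w)"
      by (rule integrable_indicator_cball)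
    show "AE w in lborel. (\<lambda>k. \<zeta> (prox (vs (k + N)) w)) \<longlonglongrightarrow> \<zeta> (prox v w)"
    proof (rule AE_I2)
      fix w
      have "(\<lambda>k. \<zeta> (prox (vs k) w)) \<longlonglongrightarrow> \<zeta> (prox v w)"
        using \<zeta>(1) by (intro isCont_tendsto_compose[of _ \<zeta>] prox_LIMSEQ vs v lim) (auto simp: continuous_on_eq_continuous_at)
      then show "(\<lambda>k. \<zeta> (prox (vs (k + N)) w)) \<longlonglongrightarrow> \<zeta> (prox v w)" by (rule LIMSEQ_ignore_initial_segment)
    qed
    show "AE w in lborel. norm (\<zeta> (prox (vs (k + N)) w)) \<le> B * indicator (cball 0 (r + 2 * (M + 1))) w" for k
    proof (rule AE_I2)
      fix w
      show "norm (\<zeta> (prox (vs (k + N)) w)) \<le> B * indicator (cball 0 (r + 2 * (M + 1))) w"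
        using prox_norm_bound[OF vs[of "k + N"] \<zeta>(2) M', of w] B
        by (cases "\<zeta> (prox (vs (k + N)) w) = 0") (auto simp: mem_cball)
    qed
  qed
  then show ?thesis by (rule LIMSEQ_offset)
qed


section \<open>The functional of a density\<close>

definition hessian_functional :: "(real^'n \<Rightarrow> real) \<Rightarrow> (real^'n \<Rightarrow> real) \<Rightarrow> real" where
  "hessian_functional \<zeta> v = integral\<^sup>L (hessian_measure 0 v) (\<lambda>(x, y). \<zeta> x)"

text \<open>The support function of [0,1]^n at x - c. Its subdifferential at c is the whole cube and
  elsewhere lies in the boundary of the cube, so the Hessian measure of index 0 sees only the
  apex.\<close>

definition corner :: "real^'n \<Rightarrow> real^'n \<Rightarrow> real" where
  "corner c x = (\<Sum>i\<in>UNIV. max 0 (x $ i - c $ i))"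

lemma Conv_sum: "finite I \<Longrightarrow> (\<And>i. i \<in> I \<Longrightarrow> f i \<in> Conv) \<Longrightarrow> (\<lambda>x. \<Sum>i\<in>I. f i x) \<in> Conv"
proof (induction I rule: finite_induct)
  case empty
  show ?case using Conv_const[of 0] by simp
next
  case (insert i I)
  then have "(\<lambda>x. f i x + (\<Sum>i\<in>I. f i x)) \<in> Conv" by (intro Conv_add) simp_all
  then show ?case using insert by simp
qed

lemma Conv_positive_part: "c \<ge> 0 \<Longrightarrow> (\<lambda>x. c * max 0 (x $ i - a)) \<in> Conv"
proof (intro Conv_scale Conv_max Conv_const)
  have "(\<lambda>x. x $ i + (- a)) \<in> Conv"
    by (intro Conv_add Conv_linear Conv_const) (auto intro: linearI)
  then show "(\<lambda>x. x $ i - a) \<in> Conv" by simp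
qed

lemma Conv_corner: "corner c \<in> Conv"
  unfolding corner_def[abs_def]
proof (rule Conv_sum)
  show "(\<lambda>x. max 0 (x $ i - c $ i)) \<in> Conv" for i
    using Conv_positive_part[of 1 i "c $ i"] by simp
qed simp

lemma C_c_support:
  assumes "\<zeta> \<in> C_c"
  obtains r where "continuous_on UNIV \<zeta>" "\<And>x. \<zeta> x \<noteq> 0 \<Longrightarrow> norm x \<le> r"
proof -
  have "bounded (closure {x. \<zeta> x \<noteq> 0})" using assms by (auto simp: C_c_def compact_imp_bounded)
  then obtain r where "\<And>x. x \<in> closure {x. \<zeta> x \<noteq> 0} \<Longrightarrow> norm x \<le> r" by (auto simp: bounded_iff)
  then have "norm x \<le> r" if "\<zeta> x \<noteq> 0" for x
    using subsetD[OF closure_subset, of x "{x. \<zeta> x \<noteq> 0}"] that by simp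
  moreover have "continuous_on UNIV \<zeta>" using assms by (simp add: C_c_def)
  ultimately show thesis by (intro that[of r])
qed

lemma hessian_functional_coefficients:
  fixes \<zeta> :: "real^'n \<Rightarrow> real"
  assumes "\<zeta> \<in> C_c" "v \<in> Conv"
  obtains c where "c CARD('n) = hessian_functional \<zeta> v"
    "\<And>s. s > 0 \<Longrightarrow> prox_integral \<zeta> (\<lambda>x. s * v x) = (\<Sum>i\<le>CARD('n). c i * s ^ i)"
proof -
  obtain r where \<zeta>: "continuous_on UNIV \<zeta>" "\<And>x. \<zeta> x \<noteq> 0 \<Longrightarrow> norm x \<le> r"
    by (rule C_c_support[OF assms(1)]) blast
  show thesis
  proof (rule hessian_integral_steiner[OF assms(2) \<zeta>])
    fix c :: "nat \<Rightarrow> real"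
    assume "c CARD('n) = integral\<^sup>L (hessian_measure 0 v) (\<lambda>(x, y). \<zeta> x)"
      "\<And>s. s > 0 \<Longrightarrow> (\<integral>w. \<zeta> (prox (\<lambda>x. s * v x) w) \<partial>lborel) = (\<Sum>i\<le>CARD('n). c i * s ^ i)"
    then show thesis
      by (intro that[of c]) (simp_all add: hessian_functional_def prox_integral_def)
  qed
qed

text \<open>One set of weights serves all v, so whatever holds linearly for the proximal integrals
  of the multiples j v holds for the functional.\<close>

lemma hessian_functional_interpolation:
  fixes \<zeta> :: "real^'n \<Rightarrow> real"
  assumes "\<zeta> \<in> C_c"
  obtains a :: "nat \<Rightarrow> real" where "\<And>v. v \<in> Conv \<Longrightarrow>
    hessian_functional \<zeta> v = (\<Sum>j\<in>{1..Suc CARD('n)}. a j * prox_integral \<zeta> (\<lambda>x. real j * v x))"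
proof -
  obtain a :: "nat \<Rightarrow> nat \<Rightarrow> real" where a: "\<And>c i. i \<le> CARD('n) \<Longrightarrow>
      c i = (\<Sum>j\<in>{1..Suc CARD('n)}. a i j * (\<Sum>l\<le>CARD('n). c l * real j ^ l))"
    using interpolation_coefficients by blast
  show thesis
  proof (rule that[of "a CARD('n)"])
    fix v :: "real^'n \<Rightarrow> real" assume v: "v \<in> Conv"
    obtain c where c: "c CARD('n) = hessian_functional \<zeta> v"
      "\<And>s. s > 0 \<Longrightarrow> prox_integral \<zeta> (\<lambda>x. s * v x) = (\<Sum>i\<le>CARD('n). c i * s ^ i)"
      by (rule hessian_functional_coefficients[OF assms v]) blast
    show "hessian_functional \<zeta> v = (\<Sum>j\<in>{1..Suc CARD('n)}. a CARD('n) j * prox_integral \<zeta> (\<lambda>x. real j * v x))"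
      unfolding c(1)[symmetric] a[OF order_refl, of c]
      by (intro sum.cong refl arg_cong2[where f="(*)"] c(2)[symmetric]) auto
  qed
qed

section \<open>Properties inherited from proximal integrals\<close>

lemma hessian_functional_add_affine:
  fixes \<zeta> :: "real^'n \<Rightarrow> real"
  assumes "\<zeta> \<in> C_c" "v \<in> Conv"
  shows "hessian_functional \<zeta> (\<lambda>x. v x + x \<bullet> a + \<alpha>) = hessian_functional \<zeta> v"
proof -
  obtain r where \<zeta>: "continuous_on UNIV \<zeta>" "\<And>x. \<zeta> x \<noteq> 0 \<Longrightarrow> norm x \<le> r"
    by (rule C_c_support[OF assms(1)]) blast
  obtain b where b: "\<And>v. v \<in> Conv \<Longrightarrow>
      hessian_functional \<zeta> v = (\<Sum>j\<in>{1..Suc CARD('n)}. b j * prox_integral \<zeta> (\<lambda>x. real j * v x))"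
    using hessian_functional_interpolation[OF assms(1)] by blast
  have "prox_integral \<zeta> (\<lambda>x. s * (v x + x \<bullet> a + \<alpha>)) = prox_integral \<zeta> (\<lambda>x. s * v x)" if "s \<ge> 0" for s
    using prox_integral_add_affine[OF \<zeta> Conv_scale[OF assms(2) that], of "s *\<^sub>R a" "s * \<alpha>"]
    by (simp add: distrib_left)
  moreover have "(\<lambda>x. v x + x \<bullet> a + \<alpha>) \<in> Conv" by (intro Conv_add Conv_add_inner Conv_const assms)
  ultimately show ?thesis by (simp add: b assms)
qed

lemma hessian_functional_invariant:
  fixes \<zeta> :: "real^'n \<Rightarrow> real"
  assumes "\<zeta> \<in> C_c"
  shows "dually_epi_translation_invariant_on Conv (hessian_functional \<zeta>)"
  unfolding dually_epi_translation_invariant_on_def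
proof (intro ballI conjI allI impI)
  fix v :: "real^'n \<Rightarrow> real" and l :: "real^'n \<Rightarrow> real" and \<alpha> :: real
  assume v: "v \<in> Conv"
  note * = assms v
  show "hessian_functional \<zeta> (\<lambda>x. v x + \<alpha>) = hessian_functional \<zeta> v"
    using hessian_functional_add_affine[OF *, of 0 \<alpha>] by simp
  assume "linear l"
  obtain a where "\<And>x. l x = x \<bullet> a" using linear_functional_inner[OF \<open>linear l\<close>] by blast
  then show "hessian_functional \<zeta> (\<lambda>x. v x + l x) = hessian_functional \<zeta> v"
    using hessian_functional_add_affine[OF *, of a 0] by simp
qed

lemma hessian_functional_valuation:
  fixes \<zeta> :: "real^'n \<Rightarrow> real"
  assumes "\<zeta> \<in> C_c"
  shows "valuation_on Conv (hessian_functional \<zeta>)"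
  unfolding valuation_on_def
proof (intro ballI impI)
  fix u v :: "real^'n \<Rightarrow> real"
  assume u: "u \<in> Conv" and v: "v \<in> Conv" and M: "(\<lambda>x. max (u x) (v x)) \<in> Conv" and m: "(\<lambda>x. min (u x) (v x)) \<in> Conv"
  obtain r where \<zeta>: "continuous_on UNIV \<zeta>" "\<And>x. \<zeta> x \<noteq> 0 \<Longrightarrow> norm x \<le> r"
    by (rule C_c_support[OF assms]) blast
  obtain b where b: "\<And>v. v \<in> Conv \<Longrightarrow>
      hessian_functional \<zeta> v = (\<Sum>j\<in>{1..Suc CARD('n)}. b j * prox_integral \<zeta> (\<lambda>x. real j * v x))"
    using hessian_functional_interpolation[OF assms] by blast
  have "prox_integral \<zeta> (\<lambda>x. s * max (u x) (v x)) + prox_integral \<zeta> (\<lambda>x. s * min (u x) (v x)) =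
      prox_integral \<zeta> (\<lambda>x. s * u x) + prox_integral \<zeta> (\<lambda>x. s * v x)" if s: "s \<ge> 0" for s
  proof -
    have mm: "s * max (u x) (v x) = max (s * u x) (s * v x)" "s * min (u x) (v x) = min (s * u x) (s * v x)" for x
      using s by (simp_all add: max_mult_distrib_left min_mult_distrib_left)
    show ?thesis
      using Conv_scale[OF u s] Conv_scale[OF v s] Conv_scale[OF M s] Conv_scale[OF m s] unfolding mm
      by (intro prox_integral_valuation[OF \<zeta>])
  qed
  then have "b j * prox_integral \<zeta> (\<lambda>x. real j * max (u x) (v x)) + b j * prox_integral \<zeta> (\<lambda>x. real j * min (u x) (v x)) =
      b j * prox_integral \<zeta> (\<lambda>x. real j * u x) + b j * prox_integral \<zeta> (\<lambda>x. real j * v x)" for j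
    by (simp flip: distrib_left)
  then show "hessian_functional \<zeta> (\<lambda>x. max (u x) (v x)) + hessian_functional \<zeta> (\<lambda>x. min (u x) (v x)) =
      hessian_functional \<zeta> u + hessian_functional \<zeta> v"
    unfolding b[OF u] b[OF v] b[OF M] b[OF m] sum.distrib[symmetric] by (intro sum.cong refl)
qed

lemma hessian_functional_homogeneous:
  fixes \<zeta> :: "real^'n \<Rightarrow> real"
  assumes "\<zeta> \<in> C_c"
  shows "homogeneous_on Conv CARD('n) (hessian_functional \<zeta>)"
  unfolding homogeneous_on_def
proof (intro ballI allI impI)
  fix v :: "real^'n \<Rightarrow> real" and t :: real assume v: "v \<in> Conv" and t: "t \<ge> 0"
  obtain c where c: "c CARD('n) = hessian_functional \<zeta> v"
    "\<And>s. s > 0 \<Longrightarrow> prox_integral \<zeta> (\<lambda>x. s * v x) = (\<Sum>i\<le>CARD('n). c i * s ^ i)"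
    by (rule hessian_functional_coefficients[OF assms v]) blast
  obtain d where d: "d CARD('n) = hessian_functional \<zeta> (\<lambda>x. t * v x)"
    "\<And>s. s > 0 \<Longrightarrow> prox_integral \<zeta> (\<lambda>x. s * (t * v x)) = (\<Sum>i\<le>CARD('n). d i * s ^ i)"
    by (rule hessian_functional_coefficients[OF assms Conv_scale[OF v t]]) blast
  show "hessian_functional \<zeta> (\<lambda>x. t * v x) = t ^ CARD('n) * hessian_functional \<zeta> v"
  proof (cases "t = 0")
    case True
    \<comment> \<open>For t = 0 the proximal integral is constant in s, and its coefficient of s^n
      vanishes because n >= 1.\<close>
    have "d CARD('n) = (\<lambda>i. if i = 0 then prox_integral \<zeta> (\<lambda>_. 0) else 0) CARD('n)"
    proof (rule coefficients_unique[where n="CARD('n)" and d="\<lambda>i. if i = 0 then prox_integral \<zeta> (\<lambda>_. 0) else 0"])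
      fix s :: real assume "s > 0"
      have "(\<Sum>i\<le>CARD('n). (if i = 0 then prox_integral \<zeta> (\<lambda>_. 0) else 0) * s ^ i) = prox_integral \<zeta> (\<lambda>_. 0)"
        by (simp add: if_distrib[of "\<lambda>x. x * _"] sum.delta cong: if_cong)
      then show "(\<Sum>i\<le>CARD('n). d i * s ^ i) = (\<Sum>i\<le>CARD('n). (if i = 0 then prox_integral \<zeta> (\<lambda>_. 0) else 0) * s ^ i)"
        using d(2)[OF \<open>s > 0\<close>] True by simp
    qed simp
    then show ?thesis using True by (simp add: d(1))
  next
    case False
    then have t: "t > 0" using t by simp
    have "d CARD('n) = (\<lambda>i. c i * t ^ i) CARD('n)"
    proof (rule coefficients_unique[where n="CARD('n)"])
      fix s :: real assume s: "s > 0"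
      then show "(\<Sum>i\<le>CARD('n). d i * s ^ i) = (\<Sum>i\<le>CARD('n). c i * t ^ i * s ^ i)"
        using d(2)[OF s] c(2)[of "s * t"] t by (simp add: mult.assoc power_mult_distrib mult.left_commute mult.commute[of "t ^ _"])
    qed simp
    then show ?thesis by (simp add: c(1) d(1) mult.commute)
  qed
qed

lemma hessian_functional_continuous:
  fixes \<zeta> :: "real^'n \<Rightarrow> real"
  assumes "\<zeta> \<in> C_c"
  shows "epi_continuous_on Conv (hessian_functional \<zeta>)"
  unfolding epi_continuous_on_def
proof (intro allI impI)
  fix vs and v :: "real^'n \<Rightarrow> real"
  assume vs: "\<forall>k. vs k \<in> Conv" and v: "v \<in> Conv" and epi: "epi_converges vs v"
  obtain r where \<zeta>: "continuous_on UNIV \<zeta>" "\<And>x. \<zeta> x \<noteq> 0 \<Longrightarrow> norm x \<le> r"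
    by (rule C_c_support[OF assms]) blast
  obtain b where b: "\<And>v. v \<in> Conv \<Longrightarrow>
      hessian_functional \<zeta> v = (\<Sum>j\<in>{1..Suc CARD('n)}. b j * prox_integral \<zeta> (\<lambda>x. real j * v x))"
    using hessian_functional_interpolation[OF assms] by blast
  have vsC: "vs k \<in> Conv" for k using vs by blast
  have "(\<lambda>k. prox_integral \<zeta> (\<lambda>x. real j * vs k x)) \<longlonglongrightarrow> prox_integral \<zeta> (\<lambda>x. real j * v x)" for j
  proof (rule prox_integral_LIMSEQ[OF \<zeta>])
    show "uniform_limit (cball 0 r) (\<lambda>k x. real j * vs k x) (\<lambda>x. real j * v x) sequentially" for r
      by (rule bounded_linear.uniform_limit[OF bounded_linear_mult_right epi_converges_uniform_limit[OF vsC v epi]])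
  qed (auto intro: Conv_scale vsC v)
  then show "(\<lambda>k. hessian_functional \<zeta> (vs k)) \<longlonglongrightarrow> hessian_functional \<zeta> v"
    unfolding b[OF v] b[OF vsC] by (intro tendsto_intros)
qed

text \<open>The residual t - P t of the projection P onto the unit cube. By Moreau's decomposition
  this is the proximal map of the support function of the cube.\<close>

definition shrink :: "real^'n \<Rightarrow> real^'n" where
  "shrink t = (\<chi> i. min (t $ i) 0 + max (t $ i - 1) 0)"

lemma prox_corner:
  assumes s: "s > 0"
  shows "prox (\<lambda>x. s * corner c x) (c + s *\<^sub>R t) = c + s *\<^sub>R shrink t"
proof (rule prox_eqI)
  show "(\<lambda>x. s * corner c x) \<in> Conv" using s by (intro Conv_scale Conv_corner) auto
  \<comment> \<open>One coordinate: with \<sigma> the shrunk \<tau>, the difference \<tau> -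
    \<sigma> lies in [0,1] and is a subgradient of max 0 at s \<sigma>.\<close>
  have 1: "max 0 a \<ge> max 0 (s * (min \<tau> 0 + max (\<tau> - 1) 0)) + (a - s * (min \<tau> 0 + max (\<tau> - 1) 0)) * (\<tau> - (min \<tau> 0 + max (\<tau> - 1) 0))"
    for a \<tau> :: real
  proof -
    consider "\<tau> < 0" | "0 \<le> \<tau>" "\<tau> \<le> 1" | "\<tau> > 1" by linarith
    then show ?thesis
    proof cases
      case 1
      then show ?thesis using mult_pos_neg[OF s 1] by simp
    next
      case 2
      have "a * \<tau> \<le> max 0 a"
      proof (cases "a \<ge> 0")
        case True
        then show ?thesis using 2 mult_left_le[of \<tau> a] by simp
      next
        case False
        then show ?thesis using 2 by (simp add: mult_nonpos_nonneg)
      qed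
      then show ?thesis using 2 by simp
    next
      case 3
      then show ?thesis using s by simp
    qed
  qed
  have "s * corner c z \<ge> s * corner c (c + s *\<^sub>R shrink t) + (z - (c + s *\<^sub>R shrink t)) \<bullet> (s *\<^sub>R (t - shrink t))" for z
  proof -
    have "corner c (c + s *\<^sub>R shrink t) + (z - (c + s *\<^sub>R shrink t)) \<bullet> (t - shrink t) \<le> corner c z"
      unfolding corner_def inner_vec_def sum.distrib[symmetric]
      using 1[of "t $ _" "z $ _ - c $ _"] by (intro sum_mono) (simp add: shrink_def algebra_simps)
    then have "s * (corner c (c + s *\<^sub>R shrink t) + (z - (c + s *\<^sub>R shrink t)) \<bullet> (t - shrink t)) \<le> s * corner c z"
      using s by (intro mult_left_mono) auto
    then show ?thesis by (simp add: distrib_left)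
  qed
  moreover have "c + s *\<^sub>R t - (c + s *\<^sub>R shrink t) = s *\<^sub>R (t - shrink t)" by (simp add: scaleR_right_diff_distrib)
  ultimately show "c + s *\<^sub>R t - (c + s *\<^sub>R shrink t) \<in> subdifferential (\<lambda>x. s * corner c x) (c + s *\<^sub>R shrink t)"
    unfolding subdifferential_def by simp
qed

lemma continuous_on_shrink: "continuous_on S shrink"
  unfolding shrink_def by (intro continuous_intros continuous_on_vec_lambda)

lemma shrink_eq_0_iff: "shrink t = 0 \<longleftrightarrow> t \<in> cbox 0 1"
proof -
  have "min a 0 + max (a - 1) 0 = 0 \<longleftrightarrow> 0 \<le> a \<and> a \<le> 1" for a :: real by (auto simp: min_def max_def)
  then show ?thesis by (simp add: shrink_def vec_eq_iff mem_box_cart)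
qed

lemma norm_shrink_bound:
  fixes t :: "real^'n"
  shows "norm t \<le> norm (shrink t) + real CARD('n)"
proof -
  have "norm (t - shrink t) \<le> (\<Sum>i\<in>UNIV. \<bar>(t - shrink t) $ i\<bar>)" by (rule norm_le_l1_cart)
  also have "\<dots> \<le> (\<Sum>i\<in>(UNIV :: 'n set). 1)"
    by (intro sum_mono) (auto simp: shrink_def min_def max_def)
  finally have "norm (t - shrink t) \<le> real CARD('n)" by simp
  then show ?thesis using norm_triangle_ineq[of "shrink t" "t - shrink t"] by simp
qed

text \<open>The substitution w = c + s t gives s^n times the integral of \<zeta> (c + s shrink t).
  Divided by s^n the polynomial tends to its coefficient of s^n, whereas compact support kills the
  integrand in the limit except where shrink t = 0, that is on the unit cube, whose volume is
  1.\<close>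

lemma hessian_functional_corner:
  fixes \<zeta> :: "real^'n \<Rightarrow> real"
  assumes "\<zeta> \<in> C_c"
  shows "hessian_functional \<zeta> (corner c) = \<zeta> c"
proof -
  let ?n = "CARD('n)"
  obtain r where \<zeta>: "continuous_on UNIV \<zeta>" "\<And>x. \<zeta> x \<noteq> 0 \<Longrightarrow> norm x \<le> r"
    by (rule C_c_support[OF assms]) blast
  obtain B where B: "B \<ge> 0" "\<And>x. \<bar>\<zeta> x\<bar> \<le> B" using compact_support_bounded[OF \<zeta>] by blast
  obtain d where d: "d ?n = hessian_functional \<zeta> (corner c)"
    "\<And>s. s > 0 \<Longrightarrow> prox_integral \<zeta> (\<lambda>x. s * corner c x) = (\<Sum>i\<le>?n. d i * s ^ i)"
    by (rule hessian_functional_coefficients[OF assms Conv_corner]) blast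
  have scale: "prox_integral \<zeta> (\<lambda>x. s * corner c x) = s ^ ?n * (\<integral>t. \<zeta> (c + s *\<^sub>R shrink t) \<partial>lborel)" if s: "s > 0" for s
  proof -
    have "(\<lambda>x. s * corner c x) \<in> Conv" using s by (intro Conv_scale Conv_corner) auto
    then have "(\<lambda>w. \<zeta> (prox (\<lambda>x. s * corner c x) w)) \<in> borel_measurable borel"
      by (intro borel_measurable_continuous_onI continuous_on_prox_integrand[OF \<zeta>])
    from lborel_integral_affine[OF this, of s c] show ?thesis
      using s by (simp add: prox_integral_def prox_corner)
  qed
  have lim: "(\<lambda>k. \<integral>t. \<zeta> (c + real (Suc k) *\<^sub>R shrink t) \<partial>lborel) \<longlonglongrightarrow> (\<integral>t. \<zeta> c * indicator (cbox 0 (1 :: real^'n)) t \<partial>lborel)"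
  \<comment> \<open>Since k + 1 >= 1, a nonzero integrand forces norm (shrink t) <= r + norm c, and
    t differs from shrink t by at most n in norm.\<close>
  proof (rule integral_dominated_convergence[where w="\<lambda>t. B * indicator (cball 0 (r + norm c + real ?n)) t"])
    show "(\<lambda>t. \<zeta> c * indicator (cbox 0 (1 :: real^'n)) t) \<in> borel_measurable lborel" by measurable
    show "(\<lambda>t. \<zeta> (c + real (Suc k) *\<^sub>R shrink t)) \<in> borel_measurable lborel" for k
    proof -
      have "continuous_on UNIV (\<lambda>t. c + real (Suc k) *\<^sub>R shrink t)"
        by (intro continuous_intros continuous_on_shrink)
      then have "continuous_on UNIV (\<lambda>t. \<zeta> (c + real (Suc k) *\<^sub>R shrink t))"
        by (rule continuous_on_compose2[OF \<zeta>(1)]) simp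
      then show ?thesis by (simp add: borel_measurable_continuous_onI)
    qed
    show "integrable lborel (\<lambda>t. B * indicator (cball 0 (r + norm c + real ?n)) t)"
      by (rule integrable_indicator_cball)
    show "AE t in lborel. (\<lambda>k. \<zeta> (c + real (Suc k) *\<^sub>R shrink t)) \<longlonglongrightarrow> \<zeta> c * indicator (cbox 0 (1 :: real^'n)) t"
    proof (rule AE_I2)
      fix t
      show "(\<lambda>k. \<zeta> (c + real (Suc k) *\<^sub>R shrink t)) \<longlonglongrightarrow> \<zeta> c * indicator (cbox 0 (1 :: real^'n)) t"
      proof (cases "shrink t = 0")
        case True
        then show ?thesis using shrink_eq_0_iff[of t] by simp
      next
        case False
        obtain N :: nat where N: "(r + norm c) / norm (shrink t) < real N" using reals_Archimedean2 by blast
        have "\<zeta> (c + real (Suc k) *\<^sub>R shrink t) = 0" if "k \<ge> N" for k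
        proof (rule ccontr)
          assume "\<zeta> (c + real (Suc k) *\<^sub>R shrink t) \<noteq> 0"
          then have "norm (c + real (Suc k) *\<^sub>R shrink t) \<le> r" by (rule \<zeta>(2))
          then have "real (Suc k) * norm (shrink t) \<le> r + norm c"
            using norm_triangle_ineq4[of "c + real (Suc k) *\<^sub>R shrink t" c] by simp
          moreover have "real N * norm (shrink t) \<le> real (Suc k) * norm (shrink t)"
            using that by (intro mult_right_mono) auto
          moreover have "r + norm c < real N * norm (shrink t)"
            using N False by (simp add: pos_divide_less_eq)
          ultimately show False by linarith
        qed
        then have "(\<lambda>k. \<zeta> (c + real (Suc k) *\<^sub>R shrink t)) \<longlonglongrightarrow> 0"
          by (intro tendsto_eventually) (auto simp: eventually_sequentially intro!: exI[of _ N])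
        then show ?thesis using False shrink_eq_0_iff[of t] by simp
      qed
    qed
    show "AE t in lborel. norm (\<zeta> (c + real (Suc k) *\<^sub>R shrink t)) \<le> B * indicator (cball 0 (r + norm c + real ?n)) t" for k
    proof (rule AE_I2)
      fix t
      show "norm (\<zeta> (c + real (Suc k) *\<^sub>R shrink t)) \<le> B * indicator (cball 0 (r + norm c + real ?n)) t"
      proof (cases "\<zeta> (c + real (Suc k) *\<^sub>R shrink t) = 0")
        case False
        then have "norm (c + real (Suc k) *\<^sub>R shrink t) \<le> r" by (rule \<zeta>(2))
        then have "real (Suc k) * norm (shrink t) \<le> r + norm c"
          using norm_triangle_ineq4[of "c + real (Suc k) *\<^sub>R shrink t" c] by simp
        moreover have "1 * norm (shrink t) \<le> real (Suc k) * norm (shrink t)" by (intro mult_right_mono) auto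
        ultimately have "norm t \<le> r + norm c + real ?n" using norm_shrink_bound[of t] by linarith
        then show ?thesis using B by simp
      qed (use B in simp)
    qed
  qed
  have unit: "(\<integral>t. \<zeta> c * indicator (cbox 0 (1 :: real^'n)) t \<partial>lborel) = \<zeta> c"
  proof -
    have "measure lborel (cbox 0 (1 :: real^'n)) = 1"
      using content_cbox_cart[of 0 "1 :: real^'n"] interval_ne_empty_cart(1)[of 0 "1 :: real^'n"] by simp
    then show ?thesis by simp
  qed
  have poly: "(\<integral>t. \<zeta> (c + real (Suc k) *\<^sub>R shrink t) \<partial>lborel) = (\<Sum>i\<le>?n. d i * (1 / real (Suc k)) ^ (?n - i))" for k
  proof -
    have "real (Suc k) ^ ?n * (\<integral>t. \<zeta> (c + real (Suc k) *\<^sub>R shrink t) \<partial>lborel) = (\<Sum>i\<le>?n. d i * real (Suc k) ^ i)"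
      using scale[of "real (Suc k)"] d(2)[of "real (Suc k)"] by simp
    also have "\<dots> = real (Suc k) ^ ?n * (\<Sum>i\<le>?n. d i * (1 / real (Suc k)) ^ (?n - i))"
      unfolding sum_distrib_left
    proof (rule sum.cong[OF refl])
      fix i assume "i \<in> {..?n}"
      then have "real (Suc k) ^ ?n = real (Suc k) ^ i * real (Suc k) ^ (?n - i)" by (simp flip: power_add)
      then show "d i * real (Suc k) ^ i = real (Suc k) ^ ?n * (d i * (1 / real (Suc k)) ^ (?n - i))"
        by (simp add: power_one_over)
    qed
    finally show ?thesis by simp
  qed
  have "(\<lambda>k. \<Sum>i\<le>?n. d i * (1 / real (Suc k)) ^ (?n - i)) \<longlonglongrightarrow> (\<Sum>i\<le>?n. d i * 0 ^ (?n - i))"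
    using LIMSEQ_inverse_real_of_nat by (intro tendsto_intros) (simp add: inverse_eq_divide)
  moreover have "(\<Sum>i\<le>?n. d i * 0 ^ (?n - i)) = d ?n"
  proof -
    have "(\<Sum>i\<le>?n. d i * 0 ^ (?n - i)) = (\<Sum>i\<le>?n. if i = ?n then d i else 0)"
      by (intro sum.cong refl) (auto simp: power_0_left)
    then show ?thesis by simp
  qed
  ultimately have "(\<lambda>k. \<Sum>i\<le>?n. d i * (1 / real (Suc k)) ^ (?n - i)) \<longlonglongrightarrow> d ?n" by (simp only:)
  then have "d ?n = \<zeta> c" using lim unfolding poly unit by (rule LIMSEQ_unique)
  then show ?thesis by (simp add: d(1))
qed


section \<open>Conjugates of restrictions to boxes\<close>

definition regular_valuation :: "((real^'n \<Rightarrow> real) \<Rightarrow> real) \<Rightarrow> bool" where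
  "regular_valuation Z \<longleftrightarrow> epi_continuous_on Conv Z \<and> dually_epi_translation_invariant_on Conv Z \<and>
     valuation_on Conv Z \<and> homogeneous_on Conv CARD('n) Z"

text \<open>The convex conjugate of u + I_K, finite everywhere for continuous \<open>u\<close> and
  nonempty compact \<open>K\<close>.\<close>

definition conjugate_on :: "(real^'n \<Rightarrow> real) \<Rightarrow> (real^'n) set \<Rightarrow> real^'n \<Rightarrow> real" where
  "conjugate_on u K x = (SUP y\<in>K. x \<bullet> y - u y)"

text \<open>Convexity together with a curvature bound, phrased without derivatives: \<open>p\<close>
  is the slope of the tangent at \<open>q\<close>. Conjugates of strongly convex functions are of
  this kind.\<close>

definition quadratic_above :: "real \<Rightarrow> (real^'n \<Rightarrow> real) \<Rightarrow> bool" where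
  "quadratic_above C u \<longleftrightarrow> (\<forall>q. \<exists>p. \<forall>y. u q + p \<bullet> y \<le> u (q + y) \<and> u (q + y) \<le> u q + p \<bullet> y + C * (norm y)\<^sup>2)"

definition set_coord :: "'n \<Rightarrow> real \<Rightarrow> real^'n \<Rightarrow> real^'n" where
  "set_coord i c x = (\<chi> j. if j = i then c else x $ j)"

lemma set_coord_nth [simp]: "set_coord i c x $ j = (if j = i then c else x $ j)"
  by (simp add: set_coord_def)

lemma conjugate_on_attained:
  assumes "continuous_on UNIV u" "compact K" "K \<noteq> {}"
  obtains y where "y \<in> K" "conjugate_on u K x = x \<bullet> y - u y" "\<And>z. z \<in> K \<Longrightarrow> x \<bullet> z - u z \<le> conjugate_on u K x"
proof -
  have "continuous_on K (\<lambda>y. x \<bullet> y - u y)"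
    by (intro continuous_intros continuous_on_subset[OF assms(1)]) auto
  then obtain y where y: "y \<in> K" "\<And>z. z \<in> K \<Longrightarrow> x \<bullet> z - u z \<le> x \<bullet> y - u y"
    using continuous_attains_sup[OF assms(2,3)] by blast
  have "conjugate_on u K x = x \<bullet> y - u y"
    unfolding conjugate_on_def by (rule cSup_eq_maximum) (use y in auto)
  then show thesis using y by (intro that[of y]) auto
qed

lemma conjugate_on_upper:
  assumes "continuous_on UNIV u" "compact K" "z \<in> K"
  shows "x \<bullet> z - u z \<le> conjugate_on u K x"
proof -
  have "K \<noteq> {}" using assms by auto
  show ?thesis using conjugate_on_attained[OF assms(1,2) \<open>K \<noteq> {}\<close>] assms(3) by metis
qed

lemma conjugate_on_eqI:
  assumes "y \<in> K" "x \<bullet> y - u y = c" "\<And>z. z \<in> K \<Longrightarrow> x \<bullet> z - u z \<le> c"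
  shows "conjugate_on u K x = c"
  unfolding conjugate_on_def using assms by (intro cSup_eq_maximum) auto

lemma Conv_conjugate_on:
  assumes u: "continuous_on UNIV u" and K: "compact K" "K \<noteq> {}"
  shows "conjugate_on u K \<in> Conv"
proof (rule ConvI)
  fix x y and t :: real assume t: "0 < t" "t < 1"
  obtain z where z: "z \<in> K" "conjugate_on u K ((1 - t) *\<^sub>R x + t *\<^sub>R y) = ((1 - t) *\<^sub>R x + t *\<^sub>R y) \<bullet> z - u z"
    using conjugate_on_attained[OF u K] by metis
  have "((1 - t) *\<^sub>R x + t *\<^sub>R y) \<bullet> z - u z = (1 - t) * (x \<bullet> z - u z) + t * (y \<bullet> z - u z)"
    by (simp add: inner_add_left algebra_simps)
  also have "\<dots> \<le> (1 - t) * conjugate_on u K x + t * conjugate_on u K y"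
    using t by (intro add_mono mult_left_mono conjugate_on_upper[OF u K(1) z(1)]) auto
  finally show "conjugate_on u K ((1 - t) *\<^sub>R x + t *\<^sub>R y) \<le> (1 - t) * conjugate_on u K x + t * conjugate_on u K y"
    using z(2) by simp
qed

lemma mem_cbox_set_coord:
  fixes a b y :: "real^'n"
  shows "c \<le> b $ i \<Longrightarrow> y \<in> cbox a (set_coord i c b) \<longleftrightarrow> y \<in> cbox a b \<and> y $ i \<le> c"
    "a $ i \<le> c \<Longrightarrow> y \<in> cbox (set_coord i c a) b \<longleftrightarrow> y \<in> cbox a b \<and> c \<le> y $ i"
proof -
  assume c: "c \<le> b $ i"
  have "y $ j \<le> set_coord i c b $ j \<longleftrightarrow> y $ j \<le> b $ j \<and> (j = i \<longrightarrow> y $ i \<le> c)" for j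
    using c by auto
  then show "y \<in> cbox a (set_coord i c b) \<longleftrightarrow> y \<in> cbox a b \<and> y $ i \<le> c"
    unfolding mem_box_cart by blast
next
  assume c: "a $ i \<le> c"
  have "set_coord i c a $ j \<le> y $ j \<longleftrightarrow> a $ j \<le> y $ j \<and> (j = i \<longrightarrow> c \<le> y $ i)" for j
    using c by auto
  then show "y \<in> cbox (set_coord i c a) b \<longleftrightarrow> y \<in> cbox a b \<and> c \<le> y $ i"
    unfolding mem_box_cart by blast
qed

text \<open>The first identity is a supremum over a union. The second rests on convexity of
  \<open>u\<close>: maximisers over the two halves lie on different sides of the cutting hyperplane,
  their segment meets it in a point m of the common face, and the concave objective at m is at least
  the smaller of the two maxima.\<close>

lemma conjugate_on_cut:
  fixes a b :: "real^'n"
  assumes u: "u \<in> Conv" and ab: "\<And>j. a $ j \<le> b $ j" and c: "a $ i \<le> c" "c \<le> b $ i"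
  shows "conjugate_on u (cbox a b) x =
      max (conjugate_on u (cbox a (set_coord i c b)) x) (conjugate_on u (cbox (set_coord i c a) b) x)"
    "conjugate_on u (cbox (set_coord i c a) (set_coord i c b)) x =
      min (conjugate_on u (cbox a (set_coord i c b)) x) (conjugate_on u (cbox (set_coord i c a) b) x)"
proof -
  let ?K = "cbox a (set_coord i c b)" and ?L = "cbox (set_coord i c a) b" and ?M = "cbox (set_coord i c a) (set_coord i c b)"
  note cu = Conv_continuous[OF u, of UNIV]
  have ne: "?K \<noteq> {}" "?L \<noteq> {}" "?M \<noteq> {}" using ab c by (auto simp: interval_ne_empty_cart)
  have mem: "y \<in> ?K \<longleftrightarrow> y \<in> cbox a b \<and> y $ i \<le> c" "y \<in> ?L \<longleftrightarrow> y \<in> cbox a b \<and> c \<le> y $ i"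
     "y \<in> ?M \<longleftrightarrow> y \<in> cbox a b \<and> y $ i = c" for y
    using mem_cbox_set_coord(1)[OF c(2), of y a] mem_cbox_set_coord(2)[OF c(1), of y b]
      mem_cbox_set_coord(1)[of c b i y "set_coord i c a"] c(2) by auto
  obtain k where k: "k \<in> ?K" "conjugate_on u ?K x = x \<bullet> k - u k" "\<And>z. z \<in> ?K \<Longrightarrow> x \<bullet> z - u z \<le> conjugate_on u ?K x"
    using conjugate_on_attained[OF cu compact_cbox ne(1)] by blast
  obtain l where l: "l \<in> ?L" "conjugate_on u ?L x = x \<bullet> l - u l" "\<And>z. z \<in> ?L \<Longrightarrow> x \<bullet> z - u z \<le> conjugate_on u ?L x"
    using conjugate_on_attained[OF cu compact_cbox ne(2)] by blast
  show "conjugate_on u (cbox a b) x = max (conjugate_on u ?K x) (conjugate_on u ?L x)"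
  proof (rule conjugate_on_eqI[of "if conjugate_on u ?L x \<le> conjugate_on u ?K x then k else l"])
    show "x \<bullet> z - u z \<le> max (conjugate_on u ?K x) (conjugate_on u ?L x)" if "z \<in> cbox a b" for z
      using k(3)[of z] l(3)[of z] that mem[of z] by (auto simp: le_max_iff_disj)
  qed (use k(1,2) l(1,2) mem[of k] mem[of l] in \<open>auto simp: max_def\<close>)
  \<comment> \<open>Chosen so that \<open>m $ i = c\<close>; if \<open>k $ i = l $ i\<close>, both
    already equal c.\<close>
  define t where "t = (if k $ i = l $ i then 0 else (c - k $ i) / (l $ i - k $ i))"
  have kl: "k $ i \<le> c" "c \<le> l $ i" using k(1) l(1) mem by auto
  then have t: "0 \<le> t" "t \<le> 1" by (auto simp: t_def divide_simps)
  define m where "m = (1 - t) *\<^sub>R k + t *\<^sub>R l"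
  have "m $ i = k $ i + t * (l $ i - k $ i)" by (simp add: m_def algebra_simps)
  then have "m $ i = c" using kl by (auto simp: t_def)
  moreover have "m \<in> cbox a b"
    unfolding m_def using k(1) l(1) mem t by (intro convexD_alt[OF convex_box(1)]) auto
  ultimately have m: "m \<in> ?M" using mem by simp
  have "min (x \<bullet> k - u k) (x \<bullet> l - u l) = (1 - t) * min (x \<bullet> k - u k) (x \<bullet> l - u l) + t * min (x \<bullet> k - u k) (x \<bullet> l - u l)"
    by (simp add: algebra_simps)
  also have "\<dots> \<le> (1 - t) * (x \<bullet> k - u k) + t * (x \<bullet> l - u l)"
    using t by (intro add_mono mult_left_mono) auto
  also have "\<dots> \<le> x \<bullet> m - u m"
    using Conv_ineq[OF u t, of k l] unfolding m_def by (simp add: inner_add_right algebra_simps)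
  also have "\<dots> \<le> conjugate_on u ?M x" by (rule conjugate_on_upper[OF cu compact_cbox m])
  finally have "min (conjugate_on u ?K x) (conjugate_on u ?L x) \<le> conjugate_on u ?M x" by (simp add: k(2) l(2))
  moreover obtain y where "y \<in> ?M" "conjugate_on u ?M x = x \<bullet> y - u y"
    using conjugate_on_attained[OF cu compact_cbox ne(3)] by metis
  ultimately show "conjugate_on u ?M x = min (conjugate_on u ?K x) (conjugate_on u ?L x)"
    using k(3)[of y] l(3)[of y] mem[of y] by auto
qed

lemma quadratic_above_Conv:
  fixes u :: "real^'n \<Rightarrow> real"
  assumes "quadratic_above C u"
  shows "u \<in> Conv"
proof (rule ConvI)
  fix x y :: "real^'n" and t :: real assume t: "0 < t" "t < 1"
  let ?q = "(1 - t) *\<^sub>R x + t *\<^sub>R y"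
  obtain p where p: "\<And>z. u ?q + p \<bullet> z \<le> u (?q + z)"
    using assms unfolding quadratic_above_def by blast
  have "(1 - t) * (u ?q + p \<bullet> (x - ?q)) + t * (u ?q + p \<bullet> (y - ?q)) \<le> (1 - t) * u x + t * u y"
    using p[of "x - ?q"] p[of "y - ?q"] t by (intro add_mono mult_left_mono) auto
  moreover have "(1 - t) * (u ?q + p \<bullet> (x - ?q)) + t * (u ?q + p \<bullet> (y - ?q)) = u ?q"
    by (simp add: inner_diff_right inner_add_right algebra_simps)
  ultimately show "u ?q \<le> (1 - t) * u x + t * u y" by simp
qed

lemma conjugate_on_zero_box:
  assumes "\<And>j. (0::real) \<le> e $ j"
  shows "conjugate_on (\<lambda>_. 0) (cbox 0 e) z = (\<Sum>j\<in>UNIV. e $ j * max 0 (z $ j))"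
proof (rule conjugate_on_eqI[of "\<chi> j. if z $ j > 0 then e $ j else 0"])
  show "(\<chi> j. if z $ j > 0 then e $ j else 0) \<in> cbox 0 e" using assms by (simp add: mem_box_cart)
  show "z \<bullet> (\<chi> j. if z $ j > 0 then e $ j else 0) - 0 = (\<Sum>j\<in>UNIV. e $ j * max 0 (z $ j))"
    by (auto simp: inner_vec_def max_def mult.commute intro!: sum.cong)
  fix y assume y: "y \<in> cbox 0 e"
  have "z $ j * y $ j \<le> e $ j * max 0 (z $ j)" for j
  proof (cases "z $ j > 0")
    case True
    then show ?thesis using y by (simp add: mem_box_cart mult.commute mult_right_mono)
  next
    case False
    then show ?thesis using y by (simp add: mem_box_cart mult_nonpos_nonneg)
  qed
  then show "z \<bullet> y - 0 \<le> (\<Sum>j\<in>UNIV. e $ j * max 0 (z $ j))"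
    by (simp add: inner_vec_def sum_mono)
qed

text \<open>Rescaling a small box of side \<open>h\<close> around \<open>q\<close> to unit size turns \<open>u\<close> into an affine function
  up to an error of order \<open>h\<close>, and its conjugate into the support function of the box \<open>[0, e]\<close>.\<close>

lemma conjugate_on_rescaled:
  assumes u: "quadratic_above C u" and C: "C \<ge> 0" and h: "h > 0" and e: "\<And>j. 0 \<le> e $ j"
    and q: "q \<in> cbox a (a + h *\<^sub>R e)"
    and p: "\<And>y. u q + p \<bullet> y \<le> u (q + y) \<and> u (q + y) \<le> u q + p \<bullet> y + C * (norm y)\<^sup>2"
  shows "\<bar>(conjugate_on u (cbox a (a + h *\<^sub>R e)) x + x \<bullet> (- a) + (u q + p \<bullet> (a - q))) / h -
      conjugate_on (\<lambda>_. 0) (cbox 0 e) (x - p)\<bar> \<le> C * h * (norm e)\<^sup>2"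
proof -
  let ?K = "cbox a (a + h *\<^sub>R e)" and ?E = "cbox 0 e"
  note cu = Conv_continuous[OF quadratic_above_Conv[OF u], of UNIV]
  have c0: "continuous_on UNIV (\<lambda>_::real^'a. 0::real)" by simp
  have K0: "?K \<noteq> {}" using q by blast
  have E0: "?E \<noteq> {}" using e by (auto simp: interval_ne_empty_cart)
  have KE: "a + h *\<^sub>R t \<in> ?K \<longleftrightarrow> t \<in> ?E" for t
    using h by (simp add: mem_box_cart zero_le_mult_iff)
  \<comment> \<open>The gap between u and its tangent at q. Both \<open>q\<close> and
    \<open>a + h *\<^sub>R t\<close> lie in the box, so they differ by at most h e in each
    coordinate and the gap is at most C h^2 |e|^2.\<close>
  define \<rho> where "\<rho> t = u (a + h *\<^sub>R t) - u q - p \<bullet> (a + h *\<^sub>R t - q)" for t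
  have \<rho>0: "\<rho> t \<ge> 0" for t using p[of "a + h *\<^sub>R t - q"] by (simp add: \<rho>_def)
  have \<rho>1: "\<rho> t \<le> C * (h\<^sup>2 * (norm e)\<^sup>2)" if t: "t \<in> ?E" for t
  proof -
    have "norm (a + h *\<^sub>R t - q) \<le> norm (h *\<^sub>R e)"
    proof (rule norm_le_componentwise_cart)
      fix j
      have "a $ j \<le> (a + h *\<^sub>R t) $ j" "(a + h *\<^sub>R t) $ j \<le> a $ j + h * e $ j" "a $ j \<le> q $ j" "q $ j \<le> a $ j + h * e $ j"
        using t q h KE[of t] by (auto simp: mem_box_cart)
      then show "norm ((a + h *\<^sub>R t - q) $ j) \<le> norm ((h *\<^sub>R e) $ j)" by auto
    qed
    then have "(norm (a + h *\<^sub>R t - q))\<^sup>2 \<le> (h * norm e)\<^sup>2" using h by (intro power_mono) auto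
    then have "C * (norm (a + h *\<^sub>R t - q))\<^sup>2 \<le> C * (h\<^sup>2 * (norm e)\<^sup>2)"
      using C by (intro mult_left_mono) (auto simp: power_mult_distrib)
    then show ?thesis using p[of "a + h *\<^sub>R t - q"] by (simp add: \<rho>_def)
  qed
  have val: "x \<bullet> (a + h *\<^sub>R t) - u (a + h *\<^sub>R t) + x \<bullet> (- a) + (u q + p \<bullet> (a - q)) = h * ((x - p) \<bullet> t) - \<rho> t" for t
    by (simp add: \<rho>_def inner_diff_left inner_diff_right inner_add_right algebra_simps)
  define A where "A = conjugate_on u ?K x + x \<bullet> (- a) + (u q + p \<bullet> (a - q))"
  define B where "B = conjugate_on (\<lambda>_. 0) ?E (x - p)"
  obtain y where y: "y \<in> ?K" "conjugate_on u ?K x = x \<bullet> y - u y"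
    using conjugate_on_attained[OF cu compact_cbox K0] by metis
  define t where "t = (y - a) /\<^sub>R h"
  have yt: "y = a + h *\<^sub>R t" using h by (simp add: t_def)
  then have t: "t \<in> ?E" using y(1) KE by simp
  have "A = h * ((x - p) \<bullet> t) - \<rho> t" unfolding A_def y(2) yt by (rule val)
  also have "\<dots> \<le> h * B"
  proof -
    have "(x - p) \<bullet> t \<le> B" using conjugate_on_upper[OF c0 compact_cbox t, of "x - p"] by (simp add: B_def)
    then have "h * ((x - p) \<bullet> t) \<le> h * B" using h by (intro mult_left_mono) auto
    then show ?thesis using \<rho>0[of t] by linarith
  qed
  finally have 1: "A \<le> h * B" .
  obtain s where s: "s \<in> ?E" "B = (x - p) \<bullet> s - 0"
    using conjugate_on_attained[OF c0 compact_cbox E0] unfolding B_def by metis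
  have "h * B - \<rho> s = x \<bullet> (a + h *\<^sub>R s) - u (a + h *\<^sub>R s) + x \<bullet> (- a) + (u q + p \<bullet> (a - q))"
    unfolding val s(2) by simp
  also have "\<dots> \<le> A"
    using conjugate_on_upper[OF cu compact_cbox, of "a + h *\<^sub>R s" a "a + h *\<^sub>R e" x] s(1) KE unfolding A_def by simp
  finally have 2: "h * B - C * (h\<^sup>2 * (norm e)\<^sup>2) \<le> A" using \<rho>1[OF s(1)] by simp
  have "A / h \<le> B" using 1 h by (simp add: divide_le_eq mult.commute)
  moreover have "B - C * h * (norm e)\<^sup>2 \<le> A / h"
    using 2 h by (simp add: le_divide_eq algebra_simps power2_eq_square)
  moreover have "C * h * (norm e)\<^sup>2 \<ge> 0" using C h by simp
  ultimately show ?thesis unfolding A_def[symmetric] B_def[symmetric] by linarith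
qed

context
  fixes Z :: "(real^'n \<Rightarrow> real) \<Rightarrow> real"
  assumes Z: "regular_valuation Z"
begin

lemma valuation_add_affine:
  assumes v: "v \<in> Conv"
  shows "Z (\<lambda>x. v x + x \<bullet> a + \<alpha>) = Z v"
proof -
  have "linear (\<lambda>x::real^'n. x \<bullet> a)" by (auto intro: linearI simp: inner_add_left)
  then have "Z (\<lambda>x. v x + x \<bullet> a) = Z v"
    using Z v unfolding regular_valuation_def dually_epi_translation_invariant_on_def by blast
  moreover have "Z (\<lambda>x. v x + x \<bullet> a + \<alpha>) = Z (\<lambda>x. v x + x \<bullet> a)"
  proof -
    have "\<forall>w\<in>Conv. Z (\<lambda>x. w x + \<alpha>) = Z w"
      using Z unfolding regular_valuation_def dually_epi_translation_invariant_on_def by blast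
    then show ?thesis using Conv_add_inner[OF v] by (rule bspec)
  qed
  ultimately show ?thesis by simp
qed

lemma valuation_scale: "v \<in> Conv \<Longrightarrow> c \<ge> 0 \<Longrightarrow> Z (\<lambda>x. c * v x) = c ^ CARD('n) * Z v"
  using Z unfolding regular_valuation_def homogeneous_on_def by blast

lemma valuation_zero: "Z (\<lambda>_. 0) = 0"
  using valuation_scale[OF Conv_const, of 0 0] by (simp add: power_0_left)

lemma valuation_LIMSEQ:
  assumes "\<And>k. vs k \<in> Conv" "v \<in> Conv" "\<And>r. uniform_limit (cball 0 r) vs v sequentially"
  shows "(\<lambda>k. Z (vs k)) \<longlonglongrightarrow> Z v"
  using Z uniform_limit_epi_converges[OF Conv_continuous[OF assms(2)] assms(3)] assms(1,2)
  unfolding regular_valuation_def epi_continuous_on_def by blast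

lemma valuation_LIMSEQ_bound:
  assumes "\<And>k. vs k \<in> Conv" "v \<in> Conv"
    and bound: "\<And>k x. \<bar>vs k x - v x\<bar> \<le> \<delta> k" and \<delta>: "\<delta> \<longlonglongrightarrow> 0"
  shows "(\<lambda>k. Z (vs k)) \<longlonglongrightarrow> Z v"
proof (rule valuation_LIMSEQ[OF assms(1,2)])
  show "uniform_limit (cball 0 r) vs v sequentially" for r
    unfolding uniform_limit_iff
  proof (intro allI impI)
    fix e :: real assume "e > 0"
    from order_tendstoD(2)[OF \<delta> this] show "eventually (\<lambda>k. \<forall>x\<in>cball 0 r. dist (vs k x) (v x) < e) sequentially"
      by eventually_elim (use bound in \<open>auto simp: dist_real_def intro: le_less_trans\<close>)
  qed
qed

lemma valuation_cut:
  assumes u: "u \<in> Conv" and ab: "\<And>j. a $ j \<le> b $ j" and c: "a $ i \<le> c" "c \<le> b $ i"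
  shows "Z (conjugate_on u (cbox a b)) + Z (conjugate_on u (cbox (set_coord i c a) (set_coord i c b))) =
    Z (conjugate_on u (cbox a (set_coord i c b))) + Z (conjugate_on u (cbox (set_coord i c a) b))"
proof -
  note cu = Conv_continuous[OF u, of UNIV]
  have Cv: "conjugate_on u (cbox a' b') \<in> Conv" if "\<And>j. a' $ j \<le> b' $ j" for a' b'
    using that by (intro Conv_conjugate_on[OF cu]) (auto simp: interval_ne_empty_cart)
  have eq: "conjugate_on u (cbox a b) = (\<lambda>x. max (conjugate_on u (cbox a (set_coord i c b)) x) (conjugate_on u (cbox (set_coord i c a) b) x))"
    "conjugate_on u (cbox (set_coord i c a) (set_coord i c b)) =
      (\<lambda>x. min (conjugate_on u (cbox a (set_coord i c b)) x) (conjugate_on u (cbox (set_coord i c a) b) x))"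
    using conjugate_on_cut[OF u ab c] by auto
  have "valuation_on Conv Z" using Z by (simp add: regular_valuation_def)
  moreover have "conjugate_on u (cbox a (set_coord i c b)) \<in> Conv" "conjugate_on u (cbox (set_coord i c a) b) \<in> Conv"
    "conjugate_on u (cbox a b) \<in> Conv" "conjugate_on u (cbox (set_coord i c a) (set_coord i c b)) \<in> Conv"
    using ab c by (auto intro!: Cv)
  ultimately show ?thesis unfolding valuation_on_def eq by blast
qed

end


section \<open>Vanishing on conjugates of boxes\<close>

lemma nested_boxes:
  fixes a b :: "nat \<Rightarrow> real^'n"
  assumes "\<And>m j. a m $ j \<le> b m $ j" "\<And>m. cbox (a (Suc m)) (b (Suc m)) \<subseteq> cbox (a m) (b m)"
  obtains q where "\<And>m. q \<in> cbox (a m) (b m)"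
proof -
  have "(\<Inter>m. cbox (a m) (b m)) \<noteq> {}"
  proof (rule compact_nest)
    show "cbox (a m) (b m) \<noteq> {}" for m using assms(1) by (auto simp: interval_ne_empty_cart)
    show "cbox (a n) (b n) \<subseteq> cbox (a m) (b m)" if "m \<le> n" for m n
      using that by (rule lift_Suc_antimono_le[of "\<lambda>m. cbox (a m) (b m)", OF assms(2)])
  qed simp
  then show thesis using that by auto
qed

context
  fixes Z :: "(real^'n \<Rightarrow> real) \<Rightarrow> real" and u :: "real^'n \<Rightarrow> real" and C :: real
  assumes Z: "regular_valuation Z" and u: "quadratic_above C u" and C: "C \<ge> 0"
begin

text \<open>Affine terms do not change Z, and homogeneity undoes the division by h, which is the
  source of the factor h^n. \<open>F\<close> is within O(h) of a function that does not depend on h,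
  so \<open>Z F\<close> can be controlled by continuity.\<close>

lemma valuation_rescaled:
  assumes h: "h > 0" and e: "\<And>j. 0 \<le> e $ j" and q: "q \<in> cbox a (a + h *\<^sub>R e)"
    and p: "\<And>y. u q + p \<bullet> y \<le> u (q + y) \<and> u (q + y) \<le> u q + p \<bullet> y + C * (norm y)\<^sup>2"
  obtains F where "F \<in> Conv" "Z (conjugate_on u (cbox a (a + h *\<^sub>R e))) = h ^ CARD('n) * Z F"
    "\<And>x. \<bar>F x - conjugate_on (\<lambda>_. 0) (cbox 0 e) (x - p)\<bar> \<le> C * h * (norm e)\<^sup>2"
proof -
  let ?L = "conjugate_on u (cbox a (a + h *\<^sub>R e))"
  define G where "G x = ?L x + x \<bullet> (- a) + (u q + p \<bullet> (a - q))" for x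
  define F where "F x = (1 / h) * G x" for x
  have K: "cbox a (a + h *\<^sub>R e) \<noteq> {}" using q by blast
  have L: "?L \<in> Conv"
    by (rule Conv_conjugate_on[OF Conv_continuous[OF quadratic_above_Conv[OF u]] compact_cbox K])
  have "G \<in> Conv"
    unfolding G_def[abs_def] by (intro Conv_add[OF Conv_add_inner Conv_const] L)
  then have F: "F \<in> Conv" unfolding F_def[abs_def] using h by (intro Conv_scale) auto
  have "Z ?L = Z G"
    unfolding G_def[abs_def] by (rule valuation_add_affine[OF Z L, symmetric])
  also have "G = (\<lambda>x. h * F x)" using h by (simp add: F_def)
  also have "Z (\<lambda>x. h * F x) = h ^ CARD('n) * Z F" using valuation_scale[OF Z F] h by simp
  finally have "Z ?L = h ^ CARD('n) * Z F" .
  moreover have "\<bar>F x - conjugate_on (\<lambda>_. 0) (cbox 0 e) (x - p)\<bar> \<le> C * h * (norm e)\<^sup>2" for x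
    using conjugate_on_rescaled[OF u C h e q p, of x] by (simp add: F_def G_def)
  ultimately show thesis using F that by blast
qed

text \<open>Halving one coordinate splits Z additively up to the common face, which has lower
  dimension and contributes 0 by \<open>low\<close>. The half with the larger absolute value keeps
  at least half of it, so each bisected coordinate costs a factor 2.\<close>

lemma valuation_bisect_coords:
  assumes ab: "\<And>j. a $ j \<le> b $ j" and J: "J \<subseteq> {j. a $ j < b $ j}"
    and low: "\<And>a' b'. (\<And>j. a' $ j \<le> b' $ j) \<Longrightarrow> card {j. a' $ j < b' $ j} < card {j. a $ j < b $ j} \<Longrightarrow>
      Z (conjugate_on u (cbox a' b')) = 0"
  shows "\<exists>a' b'. cbox a' b' \<subseteq> cbox a b \<and> (\<forall>j. a' $ j \<le> b' $ j) \<and>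
    (\<forall>j. b' $ j - a' $ j = (if j \<in> J then (b $ j - a $ j) / 2 else b $ j - a $ j)) \<and>
    \<bar>Z (conjugate_on u (cbox a b))\<bar> \<le> 2 ^ card J * \<bar>Z (conjugate_on u (cbox a' b'))\<bar>"
proof -
  have "finite J" by simp
  then show ?thesis using J
  proof (induction J rule: finite_induct)
    case empty
    show ?case by (intro exI[of _ a] exI[of _ b]) (use ab in auto)
  next
    case (insert i J)
    then obtain a' b' where sub: "cbox a' b' \<subseteq> cbox a b" and le: "\<And>j. a' $ j \<le> b' $ j"
      and len: "\<And>j. b' $ j - a' $ j = (if j \<in> J then (b $ j - a $ j) / 2 else b $ j - a $ j)"
      and Zle: "\<bar>Z (conjugate_on u (cbox a b))\<bar> \<le> 2 ^ card J * \<bar>Z (conjugate_on u (cbox a' b'))\<bar>"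
      by auto
    define c where "c = (a' $ i + b' $ i) / 2"
    have c: "a' $ i \<le> c" "c \<le> b' $ i" using le[of i] by (auto simp: c_def)
    let ?K = "cbox a' (set_coord i c b')" and ?L = "cbox (set_coord i c a') b'" and ?M = "cbox (set_coord i c a') (set_coord i c b')"
    have pos: "a' $ j < b' $ j \<longleftrightarrow> a $ j < b $ j" for j
      using len[of j] by (auto split: if_splits)
    have "{j. set_coord i c a' $ j < set_coord i c b' $ j} = {j. a $ j < b $ j} - {i}"
      using pos by auto
    then have "card {j. set_coord i c a' $ j < set_coord i c b' $ j} < card {j. a $ j < b $ j}"
      using insert by (intro psubset_card_mono) auto
    then have "Z (conjugate_on u ?M) = 0"
      using le by (intro low) auto
    then have Zsum: "Z (conjugate_on u (cbox a' b')) = Z (conjugate_on u ?K) + Z (conjugate_on u ?L)"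
      using valuation_cut[OF Z quadratic_above_Conv[OF u] le c] by simp
    have KL: "?K \<subseteq> cbox a b" "?L \<subseteq> cbox a b"
      using sub mem_cbox_set_coord(1)[OF c(2), of _ a'] mem_cbox_set_coord(2)[OF c(1), of _ b'] by auto
    have lenK: "set_coord i c b' $ j - a' $ j = (if j \<in> insert i J then (b $ j - a $ j) / 2 else b $ j - a $ j)"
      and lenL: "b' $ j - set_coord i c a' $ j = (if j \<in> insert i J then (b $ j - a $ j) / 2 else b $ j - a $ j)" for j
      using len[of j] insert(2) by (auto simp: c_def field_simps)
    have card: "(2::real) ^ card (insert i J) = 2 * 2 ^ card J" using insert by simp
    consider "\<bar>Z (conjugate_on u (cbox a' b'))\<bar> \<le> 2 * \<bar>Z (conjugate_on u ?K)\<bar>"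
      | "\<bar>Z (conjugate_on u (cbox a' b'))\<bar> \<le> 2 * \<bar>Z (conjugate_on u ?L)\<bar>"
      using Zsum by linarith
    then show ?case
    proof cases
      case 1
      then have "2 ^ card J * \<bar>Z (conjugate_on u (cbox a' b'))\<bar> \<le> 2 ^ card J * (2 * \<bar>Z (conjugate_on u ?K)\<bar>)"
        by (intro mult_left_mono) auto
      then have "\<bar>Z (conjugate_on u (cbox a b))\<bar> \<le> 2 ^ card (insert i J) * \<bar>Z (conjugate_on u ?K)\<bar>"
        by (intro order_trans[OF Zle]) (simp only: card mult_ac)
      then show ?thesis
        using KL lenK le c by (intro exI[of _ a'] exI[of _ "set_coord i c b'"]) auto
    next
      case 2
      then have "2 ^ card J * \<bar>Z (conjugate_on u (cbox a' b'))\<bar> \<le> 2 ^ card J * (2 * \<bar>Z (conjugate_on u ?L)\<bar>)"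
        by (intro mult_left_mono) auto
      then have "\<bar>Z (conjugate_on u (cbox a b))\<bar> \<le> 2 ^ card (insert i J) * \<bar>Z (conjugate_on u ?L)\<bar>"
        by (intro order_trans[OF Zle]) (simp only: card mult_ac)
      then show ?thesis
        using KL lenL le c by (intro exI[of _ "set_coord i c a'"] exI[of _ b']) auto
    qed
  qed
qed

text \<open>Bisection as in Goursat's lemma: some nested sequence of boxes of relative size \<open>2 ^ (-m)\<close> and
  dimension \<open>d\<close> loses at most a factor \<open>2 ^ (-d)\<close> per step, while homogeneity gives a factor
  \<open>2 ^ (-n)\<close> times the value on the rescaled box, which converges.\<close>

lemma valuation_box_zero_step:
  fixes a b :: "real^'n"
  defines "d \<equiv> card {j. a $ j < b $ j}"
  assumes ab: "\<And>j. a $ j \<le> b $ j"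
    and low: "\<And>a' b'. (\<And>j. a' $ j \<le> b' $ j) \<Longrightarrow> card {j. a' $ j < b' $ j} < d \<Longrightarrow>
      Z (conjugate_on u (cbox a' b')) = 0"
    and limit: "d < CARD('n) \<or> (\<forall>p. Z (\<lambda>x. conjugate_on (\<lambda>_. 0) (cbox 0 (b - a)) (x - p)) = 0)"
  shows "Z (conjugate_on u (cbox a b)) = 0"
proof -
  define e where "e = b - a"
  have e: "0 \<le> e $ j" for j using ab[of j] by (simp add: e_def)
  \<comment> \<open>After m rounds the box is a translate of the original one scaled by 2^(-m); each
    round bisects all d nondegenerate coordinates.\<close>
  define P where "P m ab' \<longleftrightarrow> (case ab' of (a', b') \<Rightarrow> b' = a' + (1 / 2 ^ m) *\<^sub>R e \<and>
      \<bar>Z (conjugate_on u (cbox a b))\<bar> \<le> (2 ^ d) ^ m * \<bar>Z (conjugate_on u (cbox a' b'))\<bar>)" for m :: nat and ab'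
  define Q where "Q x y \<longleftrightarrow> (case (x, y) of ((a', b'), (a'', b'')) \<Rightarrow> cbox a'' b'' \<subseteq> cbox a' (b' :: real^'n))" for x y
  have "\<exists>f. \<forall>m. P m (f m) \<and> Q (f m) (f (Suc m))"
  proof (rule dependent_nat_choice)
    show "\<exists>x. P 0 x" by (intro exI[of _ "(a, b)"]) (simp add: P_def e_def)
    fix x m assume "P m x"
    then obtain a' b' where x: "x = (a', b')" and b': "b' = a' + (1 / 2 ^ m) *\<^sub>R e"
      and Zle: "\<bar>Z (conjugate_on u (cbox a b))\<bar> \<le> (2 ^ d) ^ m * \<bar>Z (conjugate_on u (cbox a' b'))\<bar>"
      by (auto simp: P_def split: prod.splits)
    have le: "a' $ j \<le> b' $ j" for j using e[of j] by (simp add: b')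
    have pos: "{j. a' $ j < b' $ j} = {j. a $ j < b $ j}"
      by (auto simp: b' e_def zero_less_divide_iff)
    obtain a'' b'' where sub: "cbox a'' b'' \<subseteq> cbox a' b'"
      and len: "\<And>j. b'' $ j - a'' $ j = (if j \<in> {j. a' $ j < b' $ j} then (b' $ j - a' $ j) / 2 else b' $ j - a' $ j)"
      and Z'': "\<bar>Z (conjugate_on u (cbox a' b'))\<bar> \<le> 2 ^ card {j. a' $ j < b' $ j} * \<bar>Z (conjugate_on u (cbox a'' b''))\<bar>"
      using valuation_bisect_coords[OF le order_refl] low unfolding pos d_def by blast
    have "b'' $ j = (a'' + (1 / 2 ^ Suc m) *\<^sub>R e) $ j" for j
      using len[of j] le[of j] by (auto simp: b' field_simps split: if_splits)
    then have b'': "b'' = a'' + (1 / 2 ^ Suc m) *\<^sub>R e" by (simp add: vec_eq_iff)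
    have "(2 ^ d) ^ m * \<bar>Z (conjugate_on u (cbox a' b'))\<bar> \<le> (2 ^ d) ^ m * (2 ^ d * \<bar>Z (conjugate_on u (cbox a'' b''))\<bar>)"
      using Z'' unfolding pos d_def by (intro mult_left_mono) auto
    then have "\<bar>Z (conjugate_on u (cbox a b))\<bar> \<le> (2 ^ d) ^ m * (2 ^ d * \<bar>Z (conjugate_on u (cbox a'' b''))\<bar>)"
      by (rule order_trans[OF Zle])
    then have "\<bar>Z (conjugate_on u (cbox a b))\<bar> \<le> (2 ^ d) ^ Suc m * \<bar>Z (conjugate_on u (cbox a'' b''))\<bar>"
      by (simp only: power_Suc mult_ac)
    then have "P (Suc m) (a'', b'')" unfolding P_def prod.case using b'' by blast
    moreover have "Q x (a'', b'')" using sub by (simp add: Q_def x)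
    ultimately show "\<exists>y. P (Suc m) y \<and> Q x y" by blast
  qed
  then obtain f where f: "\<And>m. P m (f m)" "\<And>m. Q (f m) (f (Suc m))" by blast
  define A where "A m = fst (f m)" for m
  have fB: "snd (f m) = A m + (1 / 2 ^ m) *\<^sub>R e"
    and Zle: "\<bar>Z (conjugate_on u (cbox a b))\<bar> \<le> (2 ^ d) ^ m * \<bar>Z (conjugate_on u (cbox (A m) (A m + (1 / 2 ^ m) *\<^sub>R e)))\<bar>" for m
    using f(1)[of m] by (auto simp: P_def A_def split: prod.splits)
  have nest: "cbox (A (Suc m)) (A (Suc m) + (1 / 2 ^ Suc m) *\<^sub>R e) \<subseteq> cbox (A m) (A m + (1 / 2 ^ m) *\<^sub>R e)" for m
    using f(2)[of m] unfolding fB[symmetric] by (simp add: Q_def A_def split: prod.splits)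
  obtain q where q: "\<And>m. q \<in> cbox (A m) (A m + (1 / 2 ^ m) *\<^sub>R e)"
    using nested_boxes[of A "\<lambda>m. A m + (1 / 2 ^ m) *\<^sub>R e"] e nest by auto
  \<comment> \<open>The tangent is taken at a common point of all the boxes, so one slope p, and
    hence one limit function, serves every m.\<close>
  obtain p where p: "\<And>y. u q + p \<bullet> y \<le> u (q + y) \<and> u (q + y) \<le> u q + p \<bullet> y + C * (norm y)\<^sup>2"
    using u unfolding quadratic_above_def by blast
  let ?S = "\<lambda>x. conjugate_on (\<lambda>_. 0) (cbox 0 e) (x - p)"
  have "\<exists>F. F \<in> Conv \<and> Z (conjugate_on u (cbox (A m) (A m + (1 / 2 ^ m) *\<^sub>R e))) = (1 / 2 ^ m) ^ CARD('n) * Z F \<and>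
     (\<forall>x. \<bar>F x - ?S x\<bar> \<le> C * (1 / 2 ^ m) * (norm e)\<^sup>2)" for m
    using valuation_rescaled[of "1 / 2 ^ m" e q "A m" p] e q[of m] p by (metis zero_less_divide_1_iff zero_less_numeral zero_less_power)
  then obtain F where F: "\<And>m. F m \<in> Conv"
    "\<And>m. Z (conjugate_on u (cbox (A m) (A m + (1 / 2 ^ m) *\<^sub>R e))) = (1 / 2 ^ m) ^ CARD('n) * Z (F m)"
    "\<And>m x. \<bar>F m x - ?S x\<bar> \<le> C * (1 / 2 ^ m) * (norm e)\<^sup>2"
    by metis
  have S: "?S \<in> Conv"
  proof -
    have eq: "?S = (\<lambda>x. \<Sum>j\<in>UNIV. e $ j * max 0 (x $ j - p $ j))"
      using e by (simp add: conjugate_on_zero_box)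
    show ?thesis unfolding eq by (intro Conv_sum Conv_positive_part e) auto
  qed
  have half: "(\<lambda>m. 1 / 2 ^ m :: real) \<longlonglongrightarrow> 0"
    using LIMSEQ_power_zero[of "1 / 2 :: real"] by (simp add: power_one_over)
  have ZF: "(\<lambda>m. Z (F m)) \<longlonglongrightarrow> Z ?S"
  proof (rule valuation_LIMSEQ_bound[OF Z F(1) S F(3)])
    show "(\<lambda>m. C * (1 / 2 ^ m) * (norm e)\<^sup>2) \<longlonglongrightarrow> 0"
      using tendsto_mult_left_zero[OF tendsto_mult_right_zero[OF half, of C], of "(norm e)\<^sup>2"] by simp
  qed
  have dn: "d \<le> CARD('n)" unfolding d_def by (intro card_mono) auto
  \<comment> \<open>The bisections contribute 2^(d m) and homogeneity contributes 2^(-n m).\<close>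
  have bound: "\<bar>Z (conjugate_on u (cbox a b))\<bar> \<le> (1 / 2 ^ m) ^ (CARD('n) - d) * \<bar>Z (F m)\<bar>" for m
  proof -
    have "(2 ^ d) ^ m * (1 / 2 ^ m :: real) ^ CARD('n) = (2 ^ d) ^ m * ((1 / 2 ^ m) ^ d * (1 / 2 ^ m) ^ (CARD('n) - d))"
      using dn by (simp flip: power_add)
    also have "\<dots> = (1 / 2 ^ m) ^ (CARD('n) - d)"
      by (simp add: power_one_over mult.commute flip: power_mult)
    finally have eq: "(2 ^ d) ^ m * ((1 / 2 ^ m :: real) ^ CARD('n) * \<bar>Z (F m)\<bar>) = (1 / 2 ^ m) ^ (CARD('n) - d) * \<bar>Z (F m)\<bar>"
      by (simp only: mult.assoc[symmetric])
    have "\<bar>Z (conjugate_on u (cbox a b))\<bar> \<le> (2 ^ d) ^ m * ((1 / 2 ^ m) ^ CARD('n) * \<bar>Z (F m)\<bar>)"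
      using Zle[of m] unfolding F(2) by (simp add: abs_mult)
    then show ?thesis by (simp only: eq)
  qed
  have "(\<lambda>m. (1 / 2 ^ m) ^ (CARD('n) - d) * \<bar>Z (F m)\<bar>) \<longlonglongrightarrow> 0 ^ (CARD('n) - d) * \<bar>Z ?S\<bar>"
    by (intro tendsto_intros half ZF)
  \<comment> \<open>For d < n the power of 0 vanishes. For d = n it is 0^0 = 1, and
    \<open>limit\<close> makes the value at the support function vanish.\<close>
  moreover have "0 ^ (CARD('n) - d) * \<bar>Z ?S\<bar> = 0"
    using limit by (auto simp: e_def power_0_left)
  ultimately have "(\<lambda>m. (1 / 2 ^ m) ^ (CARD('n) - d) * \<bar>Z (F m)\<bar>) \<longlonglongrightarrow> 0" by (simp only:)
  then have "\<bar>Z (conjugate_on u (cbox a b))\<bar> \<le> 0"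
    using bound by (intro LIMSEQ_le_const) auto
  then show ?thesis by simp
qed

text \<open>Below full dimension the power of 1/2 left over from homogeneity tends to 0 by itself.
  Induction on the dimension supplies the vanishing on the faces produced by the cuts.\<close>

lemma valuation_degenerate_box:
  assumes "\<And>j. a $ j \<le> b $ j" "card {j. a $ j < b $ j} < CARD('n)"
  shows "Z (conjugate_on u (cbox a b)) = 0"
  using assms
proof (induction "card {j. a $ j < b $ j}" arbitrary: a b rule: less_induct)
  case less
  show ?case
  proof (rule valuation_box_zero_step)
    show "Z (conjugate_on u (cbox a' b')) = 0"
      if "\<And>j. a' $ j \<le> b' $ j" "card {j. a' $ j < b' $ j} < card {j. a $ j < b $ j}" for a' b'
      using less.hyps[of a' b'] less.prems(2) that by simp
  qed (use less.prems in auto)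
qed

text \<open>For a cube the limit of the rescaled conjugates is \<open>r\<close> times a corner,
  where Z vanishes by assumption; the faces are degenerate boxes.\<close>

lemma valuation_cube_zero:
  assumes corner: "\<And>p. Z (corner p) = 0" and r: "r > 0"
  shows "Z (conjugate_on u (cbox a (\<chi> j. a $ j + r))) = 0"
proof (rule valuation_box_zero_step)
  show "Z (conjugate_on u (cbox a' b')) = 0"
    if "\<And>j. a' $ j \<le> b' $ j" "card {j. a' $ j < b' $ j} < card {j. a $ j < (\<chi> j. a $ j + r) $ j}" for a' b'
    using that r by (intro valuation_degenerate_box) auto
  have "Z (\<lambda>x. conjugate_on (\<lambda>_. 0) (cbox 0 ((\<chi> j. a $ j + r) - a)) (x - p)) = 0" for p
  proof -
    have "(\<lambda>x. conjugate_on (\<lambda>_. 0) (cbox 0 ((\<chi> j. a $ j + r) - a)) (x - p)) = (\<lambda>x. r * corner p x)"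
      using r by (subst conjugate_on_zero_box) (auto simp: corner_def sum_distrib_left)
    then show ?thesis using valuation_scale[OF Z Conv_corner, of r p] r corner by simp
  qed
  then show "card {j. a $ j < (\<chi> j. a $ j + r) $ j} < CARD('n) \<or>
    (\<forall>p. Z (\<lambda>x. conjugate_on (\<lambda>_. 0) (cbox 0 ((\<chi> j. a $ j + r) - a)) (x - p)) = 0)" by blast
qed (use r in auto)

end


section \<open>Characterization\<close>

context
  fixes Z :: "(real^'n \<Rightarrow> real) \<Rightarrow> real"
  assumes Z: "regular_valuation Z"
begin

text \<open>The conjugate u of the strongly convex w lies below its tangents plus a quadratic, so Z
  vanishes at the conjugates \<open>L k\<close> of u restricted to growing cubes. These lie below w
  by the Fenchel inequality and agree with w at x as soon as the cube contains a subgradient of w at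
  x; on a bounded set this happens for all x from some k on.\<close>

lemma valuation_strongly_convex_zero:
  assumes corner: "\<And>p. Z (corner p) = 0" and v: "v \<in> Conv" and \<epsilon>: "\<epsilon> > 0"
  shows "Z (\<lambda>x. v x + \<epsilon> / 2 * (norm x)\<^sup>2) = 0"
proof -
  define w where "w x = v x + \<epsilon> / 2 * (norm x)\<^sup>2" for x
  have sq: "(\<lambda>x::real^'n. (norm x)\<^sup>2) \<in> Conv"
    by (rule ConvI) (use half_square_convex[where w="0::real^'n"] in simp)
  have w: "w \<in> Conv"
    unfolding w_def[abs_def] using \<epsilon> by (intro Conv_add v Conv_scale sq) auto
  \<comment> \<open>The maximiser of x . q - w x, and so the gradient of u at q: a vector q is a
    subgradient of w at x exactly if q/\<epsilon> - x is a subgradient of v/\<epsilon> at x.\<close>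
  define p where "p q = prox (\<lambda>x. (1 / \<epsilon>) * v x) (q /\<^sub>R \<epsilon>)" for q
  have v\<epsilon>: "(\<lambda>x. (1 / \<epsilon>) * v x) \<in> Conv" using v \<epsilon> by (intro Conv_scale) auto
  define u where "u q = p q \<bullet> q - w (p q)" for q
  have strong: "w (p q) + q \<bullet> (x - p q) + \<epsilon> / 2 * (norm (x - p q))\<^sup>2 \<le> w x" for q x
  proof -
    have "(1 / \<epsilon>) * v x \<ge> (1 / \<epsilon>) * v (p q) + (x - p q) \<bullet> (q /\<^sub>R \<epsilon> - p q)"
      using prox_subdifferential[OF v\<epsilon>, of "q /\<^sub>R \<epsilon>"] unfolding p_def subdifferential_def by blast
    then have "\<epsilon> * ((1 / \<epsilon>) * v (p q) + (x - p q) \<bullet> (q /\<^sub>R \<epsilon> - p q)) \<le> \<epsilon> * ((1 / \<epsilon>) * v x)"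
      using \<epsilon> by (intro mult_left_mono) auto
    then have le: "v (p q) + (x - p q) \<bullet> (q - \<epsilon> *\<^sub>R p q) \<le> v x"
      using \<epsilon> by (simp add: distrib_left inner_diff_right right_diff_distrib mult.assoc[symmetric])
    have eq: "(norm x)\<^sup>2 = (norm (p q))\<^sup>2 + 2 * (p q \<bullet> (x - p q)) + (norm (x - p q))\<^sup>2"
      unfolding power2_norm_eq_inner by (simp add: inner_diff_left inner_diff_right inner_commute)
    have "(x - p q) \<bullet> (q - \<epsilon> *\<^sub>R p q) = q \<bullet> (x - p q) - \<epsilon> * (p q \<bullet> (x - p q))"
      by (simp add: inner_diff_left inner_diff_right inner_commute)
    note le[unfolded this]
    moreover have "a + \<epsilon> / 2 * P + s + \<epsilon> / 2 * D \<le> b + \<epsilon> / 2 * A"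
      if "A = P + 2 * m + D" "a + (s - \<epsilon> * m) \<le> b" for a b A P D s m :: real
      unfolding that(1) using that(2) by (simp add: algebra_simps)
    ultimately show ?thesis unfolding w_def using eq by blast
  qed
  have fenchel: "x \<bullet> q - u q \<le> w x" for x q
  proof -
    have "\<epsilon> / 2 * (norm (x - p q))\<^sup>2 \<ge> 0" using \<epsilon> by simp
    then have "w (p q) + q \<bullet> (x - p q) \<le> w x" using strong[of q x] by linarith
    then show ?thesis by (simp add: u_def inner_diff_right inner_commute)
  qed
  have smooth: "quadratic_above (1 / (2 * \<epsilon>)) u"
    unfolding quadratic_above_def
  proof (intro allI exI conjI)
    fix q y
    show "u q + p q \<bullet> y \<le> u (q + y)"
      using fenchel[of "p q" "q + y"] by (simp add: u_def inner_add_right)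
    let ?z = "p (q + y) - p q"
    have "u (q + y) = p (q + y) \<bullet> q + p (q + y) \<bullet> y - w (p (q + y))" by (simp add: u_def inner_add_right)
    also have "\<dots> \<le> p (q + y) \<bullet> q + p (q + y) \<bullet> y - (w (p q) + q \<bullet> ?z + \<epsilon> / 2 * (norm ?z)\<^sup>2)"
      using strong[of q "p (q + y)"] by simp
    also have "\<dots> = u q + p q \<bullet> y + (?z \<bullet> y - \<epsilon> / 2 * (norm ?z)\<^sup>2)"
      by (simp add: u_def inner_diff_left inner_diff_right inner_commute)
    also have "?z \<bullet> y - \<epsilon> / 2 * (norm ?z)\<^sup>2 \<le> 1 / (2 * \<epsilon>) * (norm y)\<^sup>2"
    proof -
      have "0 \<le> (norm (\<epsilon> *\<^sub>R ?z - y))\<^sup>2" by simp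
      also have "\<dots> = \<epsilon>\<^sup>2 * (norm ?z)\<^sup>2 - 2 * \<epsilon> * (?z \<bullet> y) + (norm y)\<^sup>2"
        unfolding power2_norm_eq_inner inner_diff_left inner_diff_right inner_scaleR_left inner_scaleR_right
        by (simp add: inner_commute power2_eq_square algebra_simps)
      finally have "2 * \<epsilon> * (?z \<bullet> y - \<epsilon> / 2 * (norm ?z)\<^sup>2) \<le> (norm y)\<^sup>2"
        by (simp add: algebra_simps power2_eq_square)
      then show ?thesis using \<epsilon> by (simp add: field_simps)
    qed
    finally show "u (q + y) \<le> u q + p q \<bullet> y + 1 / (2 * \<epsilon>) * (norm y)\<^sup>2" by simp
  qed
  note cu = Conv_continuous[OF quadratic_above_Conv[OF smooth], of UNIV]
  \<comment> \<open>The cube is [-(k + 1), k + 1]^n, written as lower vertex plus side length to fit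
    \<open>valuation_cube_zero\<close>.\<close>
  define L where "L k = conjugate_on u (cbox (\<chi> j. - real (Suc k)) (\<chi> j. (\<chi> j. - real (Suc k)) $ j + 2 * real (Suc k)))" for k
  have ne: "cbox (\<chi> j. - real (Suc k)) (\<chi> j. (\<chi> j. - real (Suc k)) $ j + 2 * real (Suc k)) \<noteq> ({} :: (real^'n) set)" for k
    by (auto simp: interval_ne_empty_cart)
  have LC: "L k \<in> Conv" for k
    unfolding L_def by (rule Conv_conjugate_on[OF cu compact_cbox ne])
  have ZL: "Z (L k) = 0" for k
    unfolding L_def using \<epsilon> by (intro valuation_cube_zero[OF Z smooth _ corner]) auto
  have Lle: "L k x \<le> w x" for k x
  proof -
    obtain y where "L k x = x \<bullet> y - u y"
      unfolding L_def using conjugate_on_attained[OF cu compact_cbox ne] by metis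
    then show ?thesis using fenchel by simp
  qed
  have "uniform_limit (cball 0 r) L w sequentially" for r
  proof -
    obtain M where M: "\<And>z. norm z \<le> r + 1 \<Longrightarrow> \<bar>v z\<bar> \<le> M" using Conv_bounded_on_ball[OF v] by blast
    \<comment> \<open>The sum of \<epsilon> x and a subgradient of v at x is a subgradient of w at
      x; its norm is at most \<epsilon> r + 2 M.\<close>
    obtain N :: nat where N: "\<epsilon> * r + 2 * M \<le> real N" using real_arch_simple by blast
    have eq: "L k x = w x" if k: "k \<ge> N" and x: "norm x \<le> r" for k x
    proof (rule antisym[OF Lle])
      obtain y where y: "y \<in> subdifferential v x" using subdifferential_nonempty[OF v] by blast
      define q where "q = \<epsilon> *\<^sub>R x + y"
      have "q /\<^sub>R \<epsilon> - x \<in> subdifferential (\<lambda>x. (1 / \<epsilon>) * v x) x"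
        unfolding subdifferential_def
      proof (intro CollectI allI)
        fix z
        have "v z \<ge> v x + (z - x) \<bullet> y" using y unfolding subdifferential_def by blast
        then have "(1 / \<epsilon>) * (v x + (z - x) \<bullet> y) \<le> (1 / \<epsilon>) * v z" using \<epsilon> by (intro mult_left_mono) auto
        moreover have "q /\<^sub>R \<epsilon> - x = (1 / \<epsilon>) *\<^sub>R y" using \<epsilon> by (simp add: q_def scaleR_right_distrib inverse_eq_divide)
        ultimately show "(1 / \<epsilon>) * v x + (z - x) \<bullet> (q /\<^sub>R \<epsilon> - x) \<le> (1 / \<epsilon>) * v z"
          by (simp only: inner_scaleR_right distrib_left)
      qed
      then have pq: "p q = x" unfolding p_def by (rule prox_eqI[OF v\<epsilon>])
      have "norm y \<le> 2 * M" by (rule subdifferential_bounded[OF y x M])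
      moreover have "norm q \<le> \<epsilon> * norm x + norm y"
        unfolding q_def using \<epsilon> norm_triangle_ineq[of "\<epsilon> *\<^sub>R x" y] by simp
      moreover have "\<epsilon> * norm x \<le> \<epsilon> * r" using x \<epsilon> by (intro mult_left_mono) auto
      ultimately have "norm q \<le> real (Suc k)" using N k by simp
      then have "- real (Suc k) \<le> q $ j \<and> q $ j \<le> real (Suc k)" for j
        using component_le_norm_cart[of q j] by linarith
      then have "q \<in> cbox (\<chi> j. - real (Suc k)) (\<chi> j. (\<chi> j. - real (Suc k)) $ j + 2 * real (Suc k))"
        by (simp add: mem_box_cart)
      then have "x \<bullet> q - u q \<le> L k x" unfolding L_def by (rule conjugate_on_upper[OF cu compact_cbox])
      then show "w x \<le> L k x" by (simp add: u_def pq)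
    qed
    show ?thesis
      unfolding uniform_limit_iff eventually_sequentially
      using eq by (auto intro!: exI[of _ N])
  qed
  then have "(\<lambda>k. Z (L k)) \<longlonglongrightarrow> Z w" by (rule valuation_LIMSEQ[OF Z LC w])
  then have "Z w = 0" unfolding ZL by (simp add: LIMSEQ_const_iff)
  then show ?thesis by (simp add: w_def[abs_def])
qed

lemma valuation_eq_zero:
  assumes corner: "\<And>p. Z (corner p) = 0" and v: "v \<in> Conv"
  shows "Z v = 0"
proof -
  let ?w = "\<lambda>k x. v x + (1 / real (Suc k)) / 2 * (norm x)\<^sup>2"
  have sq: "(\<lambda>x::real^'n. (norm x)\<^sup>2) \<in> Conv"
    by (rule ConvI) (use half_square_convex[where w="0::real^'n"] in simp)
  have "(\<lambda>k. Z (?w k)) \<longlonglongrightarrow> Z v"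
  proof (rule valuation_LIMSEQ[OF Z _ v])
    show "?w k \<in> Conv" for k by (rule Conv_add[OF v], rule Conv_scale[OF sq]) simp
    show "uniform_limit (cball 0 r) ?w v sequentially" for r
      unfolding uniform_limit_iff
    proof (intro allI impI)
      fix e :: real assume e: "e > 0"
      have "(\<lambda>k. (1 / real (Suc k)) / 2 * r\<^sup>2) \<longlonglongrightarrow> 0 / 2 * r\<^sup>2"
        using LIMSEQ_inverse_real_of_nat by (intro tendsto_intros) (simp_all add: inverse_eq_divide)
      then have "(\<lambda>k. (1 / real (Suc k)) / 2 * r\<^sup>2) \<longlonglongrightarrow> 0" by simp
      from order_tendstoD(2)[OF this e] show "eventually (\<lambda>k. \<forall>x\<in>cball 0 r. dist (?w k x) (v x) < e) sequentially"
      proof eventually_elim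
        case (elim k)
        show ?case
        proof
          fix x :: "real^'n" assume "x \<in> cball 0 r"
          then have "(norm x)\<^sup>2 \<le> r\<^sup>2" by (intro power_mono) auto
          then have "(1 / real (Suc k)) / 2 * (norm x)\<^sup>2 \<le> (1 / real (Suc k)) / 2 * r\<^sup>2"
            by (intro mult_left_mono) auto
          moreover have "(1 / real (Suc k)) / 2 * (norm x)\<^sup>2 \<ge> 0" by simp
          ultimately show "dist (?w k x) (v x) < e" using elim unfolding dist_real_def by linarith
        qed
      qed
    qed
  qed
  moreover have "Z (?w k) = 0" for k
    using valuation_strongly_convex_zero[OF corner v, of "1 / real (Suc k)"] by simp
  ultimately show ?thesis by (simp add: LIMSEQ_const_iff)
qed

section \<open>The density read off at the corners\<close>

definition corner_density :: "real^'n \<Rightarrow> real" where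
  "corner_density x = Z (corner x)"

lemma continuous_on_corner_density: "continuous_on UNIV corner_density"
  unfolding continuous_on_sequentially
proof (intro allI ballI impI)
  fix xs and x :: "real^'n"
  assume "(\<forall>k. xs k \<in> UNIV) \<and> xs \<longlonglongrightarrow> x"
  then have xs: "xs \<longlonglongrightarrow> x" by simp
  have "(\<lambda>k. Z (corner (xs k))) \<longlonglongrightarrow> Z (corner x)"
  proof (rule valuation_LIMSEQ_bound[OF Z Conv_corner Conv_corner])
    show "\<bar>corner (xs k) z - corner x z\<bar> \<le> (\<Sum>j\<in>UNIV. \<bar>xs k $ j - x $ j\<bar>)" for k z
      unfolding corner_def sum_subtractf[symmetric]
      by (rule order_trans[OF sum_abs], rule sum_mono) (auto simp: max_def)
    have "(\<lambda>k. \<Sum>j\<in>UNIV. \<bar>xs k $ j - x $ j\<bar>) \<longlonglongrightarrow> (\<Sum>j\<in>UNIV. \<bar>x $ j - x $ j\<bar>)"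
      using xs by (intro tendsto_intros)
    then show "(\<lambda>k. \<Sum>j\<in>UNIV. \<bar>xs k $ j - x $ j\<bar>) \<longlonglongrightarrow> 0" by simp
  qed
  then show "(corner_density \<circ> xs) \<longlonglongrightarrow> corner_density x"
    by (simp add: corner_density_def o_def)
qed

text \<open>A box of side N in direction i is a stack of N unit cubes. Cutting off the last cube
  loses only a degenerate face, and translating a cube changes the conjugate by an affine function,
  so each cube contributes the same value.\<close>

lemma valuation_stacked_corner:
  "Z (\<lambda>z. \<Sum>j\<in>UNIV. (if j = i then real N else 1) * max 0 (z $ j - x $ j)) = real N * corner_density x"
proof -
  \<comment> \<open>With this linear \<open>u\<close> the conjugate over a box is the support
    function of the box with its apex moved to x.\<close>
  let ?u = "\<lambda>y::real^'n. x \<bullet> y"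
  have u: "quadratic_above 0 ?u"
    unfolding quadratic_above_def by (intro allI exI[of _ x]) (simp add: inner_add_right)
  note cu = Conv_continuous[OF quadratic_above_Conv[OF u], of UNIV]
  have shift: "conjugate_on ?u K z = conjugate_on (\<lambda>_. 0) K (z - x)" for K z
    by (simp add: conjugate_on_def inner_diff_left)
  let ?e = "\<lambda>N. set_coord i (real N) (\<chi> j. 1) :: real^'n"
  have "Z (conjugate_on ?u (cbox 0 (?e N))) = real N * corner_density x"
  proof (induction N)
    case 0
    have "{j. (0 :: real^'n) $ j < ?e 0 $ j} \<noteq> UNIV" by (auto intro: exI[of _ i])
    then have "card {j. (0 :: real^'n) $ j < ?e 0 $ j} < CARD('n)"
      by (intro psubset_card_mono) auto
    then have "Z (conjugate_on ?u (cbox 0 (?e 0))) = 0"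
      by (intro valuation_degenerate_box[OF Z u]) auto
    then show ?case by simp
  next
    case (Suc N)
    let ?s = "axis i (real N) :: real^'n"
    have eqs: "set_coord i (real N) (?e (Suc N)) = ?e N" "set_coord i (real N) 0 = ?s"
      by (auto simp: vec_eq_iff axis_def)
    have "{j. ?s $ j < ?e N $ j} \<noteq> UNIV" by (auto simp: axis_def intro: exI[of _ i])
    then have "card {j. ?s $ j < ?e N $ j} < CARD('n)" by (intro psubset_card_mono) auto
    then have "Z (conjugate_on ?u (cbox ?s (?e N))) = 0"
      by (intro valuation_degenerate_box[OF Z u]) (auto simp: axis_def)
    then have "Z (conjugate_on ?u (cbox 0 (?e (Suc N)))) = Z (conjugate_on ?u (cbox 0 (?e N))) + Z (conjugate_on ?u (cbox ?s (?e (Suc N))))"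
      using valuation_cut[OF Z quadratic_above_Conv[OF u], of 0 "?e (Suc N)" i "real N"] unfolding eqs by simp
    moreover have "Z (conjugate_on ?u (cbox ?s (?e (Suc N)))) = corner_density x"
    proof -
      have img: "cbox ?s (?e (Suc N)) = (+) ?s ` cbox 0 (\<chi> j. 1)"
      proof -
        have "?s + (\<chi> j. 1) = ?e (Suc N)" by (auto simp: vec_eq_iff axis_def)
        then show ?thesis by (simp add: cbox_translation[symmetric])
      qed
      have "conjugate_on ?u (cbox ?s (?e (Suc N))) = (\<lambda>z. corner x z + z \<bullet> ?s + (- (x \<bullet> ?s)))"
      proof
        fix z
        have ne: "cbox 0 (\<chi> j. 1) \<noteq> ({} :: (real^'n) set)" by (auto simp: interval_ne_empty_cart)
        obtain y where y: "y \<in> cbox 0 (\<chi> j. 1)" "conjugate_on (\<lambda>_. 0) (cbox 0 (\<chi> j. 1)) (z - x) = (z - x) \<bullet> y - 0"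
          "\<And>y'. y' \<in> cbox 0 (\<chi> j. 1) \<Longrightarrow> (z - x) \<bullet> y' - 0 \<le> conjugate_on (\<lambda>_. 0) (cbox 0 (\<chi> j. 1)) (z - x)"
          using conjugate_on_attained[OF continuous_on_const compact_cbox ne, of 0 "z - x"] by blast
        have c: "conjugate_on (\<lambda>_. 0) (cbox 0 (\<chi> j. 1)) (z - x) = corner x z"
          by (subst conjugate_on_zero_box) (auto simp: corner_def)
        show "conjugate_on ?u (cbox ?s (?e (Suc N))) z = corner x z + z \<bullet> ?s + (- (x \<bullet> ?s))"
        proof (rule conjugate_on_eqI[of "?s + y"])
          show "?s + y \<in> cbox ?s (?e (Suc N))" unfolding img using y(1) by blast
          show "z \<bullet> (?s + y) - x \<bullet> (?s + y) = corner x z + z \<bullet> ?s + (- (x \<bullet> ?s))"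
            using y(2) c by (simp add: inner_add_right inner_diff_left)
          fix y' assume "y' \<in> cbox ?s (?e (Suc N))"
          then obtain y'' where y'': "y' = ?s + y''" "y'' \<in> cbox 0 (\<chi> j. 1)" unfolding img by blast
          show "z \<bullet> y' - x \<bullet> y' \<le> corner x z + z \<bullet> ?s + (- (x \<bullet> ?s))"
            using y(3)[OF y''(2)] c unfolding y''(1) by (simp add: inner_add_right inner_diff_left)
        qed
      qed
      then show ?thesis
        using valuation_add_affine[OF Z Conv_corner, of x ?s "- (x \<bullet> ?s)"] by (simp add: corner_density_def)
    qed
    ultimately show ?case using Suc by (simp add: algebra_simps)
  qed
  moreover have "conjugate_on ?u (cbox 0 (?e N)) = (\<lambda>z. \<Sum>j\<in>UNIV. (if j = i then real N else 1) * max 0 (z $ j - x $ j))"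
    unfolding shift by (subst conjugate_on_zero_box) (auto intro!: sum.cong)
  ultimately show ?thesis by simp
qed

text \<open>If the support were unbounded, a far away coordinate direction of the corner could be stretched
  by a large factor at no cost, because up to a linear function the stretched part vanishes near the
  origin; after scaling down, such functions tend to \<open>0\<close> while their values stay away from \<open>0\<close>.\<close>

lemma corner_density_bounded_support:
  "\<exists>r. \<forall>x. corner_density x \<noteq> 0 \<longrightarrow> norm x \<le> r"
proof (rule ccontr)
  let ?n = "real CARD('n)"
  assume "\<not> ?thesis"
  \<comment> \<open>The factor n forces some coordinate of \<open>x k\<close> to exceed k in
    absolute value.\<close>
  then have "\<forall>k::nat. \<exists>x. corner_density x \<noteq> 0 \<and> norm x > ?n * real k" by (auto simp: not_le)
  then obtain x where x: "\<And>k. corner_density (x k) \<noteq> 0" "\<And>k. norm (x k) > ?n * real k"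
    by metis
  have "\<exists>i. \<bar>x k $ i\<bar> > real k" for k
  proof (rule ccontr)
    assume "\<not> ?thesis"
    then have "(\<Sum>i\<in>UNIV. \<bar>x k $ i\<bar>) \<le> (\<Sum>i\<in>(UNIV :: 'n set). real k)" by (intro sum_mono) (auto simp: not_less)
    then show False using norm_le_l1_cart[of "x k"] x(2)[of k] by simp
  qed
  then obtain i where i: "\<And>k. \<bar>x k $ i k\<bar> > real k" by metis
  \<comment> \<open>Makes the unstretched directions O(1/(k + 1)) on bounded sets: there are fewer
    than n of them, each contributing at most |r| + norm (x k).\<close>
  define \<epsilon> where "\<epsilon> k = 1 / (real (Suc k) * ?n * (1 + norm (x k)))" for k
  have \<epsilon>: "\<epsilon> k > 0" for k unfolding \<epsilon>_def by (auto intro!: divide_pos_pos mult_pos_pos add_pos_nonneg)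
  \<comment> \<open>The stretching factor compensates the loss \<epsilon>^n from homogeneity and
    keeps |Z (w k)| at least 1.\<close>
  have "\<exists>N::nat. 1 \<le> real N * (\<epsilon> k ^ CARD('n) * \<bar>corner_density (x k)\<bar>)" for k
  proof -
    have "\<epsilon> k ^ CARD('n) * \<bar>corner_density (x k)\<bar> > 0" using \<epsilon> x(1) by simp
    then show ?thesis using ex_less_of_nat_mult[of _ 1] by (meson less_imp_le)
  qed
  then obtain N :: "nat \<Rightarrow> nat" where N: "\<And>k. 1 \<le> real (N k) * (\<epsilon> k ^ CARD('n) * \<bar>corner_density (x k)\<bar>)" by metis
  define S where "S k z = (\<Sum>j\<in>UNIV. (if j = i k then real (N k) else 1) * max 0 (z $ j - x k $ j))" for k z
  \<comment> \<open>If \<open>x k $ i k\<close> is negative, the stretched term is affine near the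
    origin with slope \<epsilon> N and is cancelled; if it is positive, that term is zero
    there.\<close>
  define c where "c k = (if x k $ i k < 0 then - \<epsilon> k * real (N k) else 0)" for k
  define w where "w k z = \<epsilon> k * S k z + z \<bullet> axis (i k) (c k) + (- c k * x k $ i k)" for k z
  have SC: "S k \<in> Conv" for k
    unfolding S_def[abs_def] by (intro Conv_sum Conv_positive_part) auto
  have \<epsilon>SC: "(\<lambda>z. \<epsilon> k * S k z) \<in> Conv" for k using \<epsilon>[of k] by (intro Conv_scale SC) auto
  have wC: "w k \<in> Conv" for k
    unfolding w_def[abs_def] by (intro Conv_add[OF Conv_add_inner Conv_const] \<epsilon>SC)
  have Zw: "Z (w k) = \<epsilon> k ^ CARD('n) * (real (N k) * corner_density (x k))" for k
  proof -
    have "Z (w k) = Z (\<lambda>z. \<epsilon> k * S k z)" unfolding w_def[abs_def] by (rule valuation_add_affine[OF Z \<epsilon>SC])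
    also have "\<dots> = \<epsilon> k ^ CARD('n) * Z (S k)" using \<epsilon>[of k] by (intro valuation_scale[OF Z SC]) auto
    also have "Z (S k) = real (N k) * corner_density (x k)"
      unfolding S_def[abs_def] by (rule valuation_stacked_corner)
    finally show ?thesis .
  qed
  have "(\<lambda>k. Z (w k)) \<longlonglongrightarrow> Z (\<lambda>_. 0)"
  proof (rule valuation_LIMSEQ[OF Z wC Conv_const])
    fix r :: real
    have small: "\<bar>w k z\<bar> \<le> (\<bar>r\<bar> + 1) / real (Suc k)" if k: "real k \<ge> r" and z: "norm z \<le> r" for k z
    proof -
      have zi: "\<bar>z $ i k\<bar> < \<bar>x k $ i k\<bar>" using component_le_norm_cart[of z "i k"] i[of k] k z by linarith
      have "S k z = real (N k) * max 0 (z $ i k - x k $ i k) + (\<Sum>j\<in>UNIV - {i k}. max 0 (z $ j - x k $ j))"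
        unfolding S_def by (subst sum.remove[of _ "i k"]) auto
      then have "w k z = \<epsilon> k * real (N k) * max 0 (z $ i k - x k $ i k) + c k * (z $ i k - x k $ i k) +
          \<epsilon> k * (\<Sum>j\<in>UNIV - {i k}. max 0 (z $ j - x k $ j))"
        by (simp add: w_def inner_axis algebra_simps)
      also have "\<epsilon> k * real (N k) * max 0 (z $ i k - x k $ i k) + c k * (z $ i k - x k $ i k) = 0"
        using zi by (auto simp: c_def max_def)
      finally have wz: "w k z = \<epsilon> k * (\<Sum>j\<in>UNIV - {i k}. max 0 (z $ j - x k $ j))" by simp
      have "(\<Sum>j\<in>UNIV - {i k}. max 0 (z $ j - x k $ j)) \<le> (\<Sum>j\<in>UNIV - {i k}. \<bar>r\<bar> + norm (x k))"
      proof (rule sum_mono)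
        fix j
        show "max 0 (z $ j - x k $ j) \<le> \<bar>r\<bar> + norm (x k)"
          using component_le_norm_cart[of z j] component_le_norm_cart[of "x k" j] z by linarith
      qed
      also have "\<dots> \<le> (\<Sum>j\<in>(UNIV :: 'n set). \<bar>r\<bar> + norm (x k))" by (rule sum_mono2) auto
      also have "\<dots> \<le> ?n * ((\<bar>r\<bar> + 1) * (1 + norm (x k)))"
        by (simp add: algebra_simps)
      finally have "\<epsilon> k * (\<Sum>j\<in>UNIV - {i k}. max 0 (z $ j - x k $ j)) \<le> \<epsilon> k * (?n * ((\<bar>r\<bar> + 1) * (1 + norm (x k))))"
        using \<epsilon>[of k] by (intro mult_left_mono) auto
      also have "\<dots> = (\<bar>r\<bar> + 1) / real (Suc k)"
      proof -
        have "1 + norm (x k) \<noteq> 0" using norm_ge_zero[of "x k"] by linarith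
        then show ?thesis by (simp add: \<epsilon>_def)
      qed
      finally have "w k z \<le> (\<bar>r\<bar> + 1) / real (Suc k)" unfolding wz .
      moreover have "w k z \<ge> 0" unfolding wz using \<epsilon>[of k] by (intro mult_nonneg_nonneg sum_nonneg) auto
      ultimately show ?thesis by simp
    qed
    have lim: "(\<lambda>k. (\<bar>r\<bar> + 1) / real (Suc k)) \<longlonglongrightarrow> 0"
      using tendsto_mult_right_zero[OF LIMSEQ_inverse_real_of_nat, of "\<bar>r\<bar> + 1"] by (simp add: divide_inverse)
    have large: "eventually (\<lambda>k. real k \<ge> r) sequentially"
      using filterlim_real_sequentially unfolding filterlim_at_top by blast
    show "uniform_limit (cball 0 r) w (\<lambda>_. 0) sequentially"
      unfolding uniform_limit_iff
    proof (intro allI impI)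
      fix e :: real assume "e > 0"
      from order_tendstoD(2)[OF lim this] large
      show "eventually (\<lambda>k. \<forall>z\<in>cball 0 r. dist (w k z) 0 < e) sequentially"
        by eventually_elim (use small in \<open>force simp: dist_real_def\<close>)
    qed
  qed
  then have "(\<lambda>k. \<bar>Z (w k)\<bar>) \<longlonglongrightarrow> \<bar>0\<bar>" unfolding valuation_zero[OF Z] by (rule tendsto_rabs)
  moreover have "1 \<le> \<bar>Z (w k)\<bar>" for k
    using N[of k] \<epsilon>[of k] by (simp add: Zw abs_mult mult_ac)
  ultimately have "(1::real) \<le> \<bar>0\<bar>" by (intro LIMSEQ_le_const) auto
  then show False by simp
qed

lemma corner_density_C_c: "corner_density \<in> C_c"
proof -
  obtain r where r: "\<And>x. corner_density x \<noteq> 0 \<Longrightarrow> norm x \<le> r" using corner_density_bounded_support by blast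
  then have "bounded {x. corner_density x \<noteq> 0}" by (auto simp: bounded_iff)
  then show ?thesis
    using continuous_on_corner_density by (simp add: C_c_def compact_closure)
qed

end

section \<open>Assembly of the two directions\<close>

lemma regular_valuation_diff:
  assumes "regular_valuation Y" "regular_valuation Z"
  shows "regular_valuation (\<lambda>v. Y v - Z v)"
  unfolding regular_valuation_def
proof (intro conjI)
  show "epi_continuous_on Conv (\<lambda>v. Y v - Z v)"
    using assms unfolding regular_valuation_def epi_continuous_on_def by (auto intro!: tendsto_diff)
  show "dually_epi_translation_invariant_on Conv (\<lambda>v. Y v - Z v)"
    using assms unfolding regular_valuation_def dually_epi_translation_invariant_on_def by auto
  show "valuation_on Conv (\<lambda>v. Y v - Z v)"
    unfolding valuation_on_def
  proof (intro ballI impI)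
    fix u v :: "real^'a \<Rightarrow> real"
    assume uv: "u \<in> Conv" "v \<in> Conv" "(\<lambda>x. max (u x) (v x)) \<in> Conv" "(\<lambda>x. min (u x) (v x)) \<in> Conv"
    have "Y (\<lambda>x. max (u x) (v x)) + Y (\<lambda>x. min (u x) (v x)) = Y u + Y v"
      "Z (\<lambda>x. max (u x) (v x)) + Z (\<lambda>x. min (u x) (v x)) = Z u + Z v"
      using assms uv unfolding regular_valuation_def valuation_on_def by blast+
    then show "Y (\<lambda>x. max (u x) (v x)) - Z (\<lambda>x. max (u x) (v x)) + (Y (\<lambda>x. min (u x) (v x)) - Z (\<lambda>x. min (u x) (v x))) =
      Y u - Z u + (Y v - Z v)" by linarith
  qed
  show "homogeneous_on Conv CARD('a) (\<lambda>v. Y v - Z v)"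
    using assms unfolding regular_valuation_def homogeneous_on_def by (auto simp: right_diff_distrib)
qed

lemma regular_valuation_hessian_functional: "\<zeta> \<in> C_c \<Longrightarrow> regular_valuation (hessian_functional \<zeta>)"
  by (simp add: regular_valuation_def hessian_functional_continuous hessian_functional_invariant
      hessian_functional_valuation hessian_functional_homogeneous)

lemma regular_valuation_cong:
  assumes Y: "regular_valuation Y" and eq: "\<And>v. v \<in> Conv \<Longrightarrow> Z v = Y v"
  shows "regular_valuation Z"
  unfolding regular_valuation_def
proof (intro conjI)
  show "epi_continuous_on Conv Z"
    using Y eq unfolding regular_valuation_def epi_continuous_on_def by simp
  show "dually_epi_translation_invariant_on Conv Z"
    unfolding dually_epi_translation_invariant_on_def
  proof (intro ballI conjI allI impI)
    fix v l :: "real^'a \<Rightarrow> real" and \<alpha> :: real assume v: "v \<in> Conv"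
    show "Z (\<lambda>x. v x + \<alpha>) = Z v"
      using Y v eq[OF v] eq[OF Conv_add[OF v Conv_const]]
      unfolding regular_valuation_def dually_epi_translation_invariant_on_def by simp
    assume "linear l"
    then show "Z (\<lambda>x. v x + l x) = Z v"
      using Y v eq[OF v] eq[OF Conv_add[OF v Conv_linear]]
      unfolding regular_valuation_def dually_epi_translation_invariant_on_def by simp
  qed
  show "valuation_on Conv Z"
    using Y eq unfolding regular_valuation_def valuation_on_def by simp
  show "homogeneous_on Conv CARD('a) Z"
    using Y eq unfolding regular_valuation_def homogeneous_on_def by (simp add: Conv_scale)
qed

theorem theorem5:
  fixes Z :: "(real^'n \<Rightarrow> real) \<Rightarrow> real"
  shows "(epi_continuous_on Conv Z \<and> dually_epi_translation_invariant_on Conv Z \<and>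
          valuation_on Conv Z \<and> homogeneous_on Conv CARD('n) Z) \<longleftrightarrow>
         (\<exists>\<zeta>\<in>C_c. \<forall>v\<in>Conv. Z v = integral\<^sup>L (hessian_measure 0 v) (\<lambda>(x, y). \<zeta> x))"
  unfolding regular_valuation_def[symmetric] hessian_functional_def[symmetric]
proof
  assume Z: "regular_valuation Z"
  let ?\<zeta> = "corner_density Z"
  have \<zeta>: "?\<zeta> \<in> C_c" by (rule corner_density_C_c[OF Z])
  let ?W = "\<lambda>v. Z v - hessian_functional ?\<zeta> v"
  have "regular_valuation ?W"
    by (intro regular_valuation_diff Z regular_valuation_hessian_functional \<zeta>)
  moreover have "?W (corner p) = 0" for p
    by (simp add: hessian_functional_corner[OF \<zeta>] corner_density_def[OF Z])
  ultimately have "?W v = 0" if "v \<in> Conv" for v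
    using that by (rule valuation_eq_zero)
  then show "\<exists>\<zeta>\<in>C_c. \<forall>v\<in>Conv. Z v = hessian_functional \<zeta> v" using \<zeta> by auto
next
  assume "\<exists>\<zeta>\<in>C_c. \<forall>v\<in>Conv. Z v = hessian_functional \<zeta> v"
  then show "regular_valuation Z"
    using regular_valuation_cong[OF regular_valuation_hessian_functional] by blast
qed

end
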